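(* Assume that $\mathbb{Y}$ is equipped with a transitive binary relation $<$ such that: (i) $\{(y,z):y<z\}$ is a measurable subset of $\mathbb{Y}^2$; (ii) for any $y,z\in\mathbb{Y}$ at most one of the relations $y<z$ and $z<y$ is satisfied; (iii) $\lambda(\mathbb{Y}\setminus\{z\in\mathbb{Y}:z<y\text{ or }y<z\})=0$ for all $y\in\mathbb{Y}$; (iv) $(\mu,y)\mapsto\mu_y$ is a measurable mapping from $\mathbf{N}\times\mathbb{Y}$ to $\mathbf{N}$, where $\mu_y$ denotes the restriction of $\mu$ to $y_\downarrow:=\{z\in\mathbb{Y}:z<y\}$. Then for any $f\in L^2(\mathbb{P}_\eta)$, $$\mathbb{E}\int\mathbb{E}[D_yf(\eta)\mid\eta_y]^2\,\lambda(dy)<\infty,$$ and for any $f,g\in L^2(\mathbb{P}_\eta)$, $$\operatorname{Cov}[f(\eta),g(\eta)]=\mathbb{E}\int\mathbb{E}[D_yf(\eta)\mid\eta_y]\,\mathbb{E}[D_yg(\eta)\mid\eta_y]\,\lambda(dy).$$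
   Context: Let $(\mathbb{Y},\mathcal{Y})$ be a measurable space and $\lambda$ a $\sigma$-finite measure on it. Let $\mathbf{N}$ be the space of all $\sigma$-finite measures $\mu$ on $\mathbb{Y}$ with values in $\{0,1,2,\ldots\}\cup\{\infty\}$, equipped with the smallest $\sigma$-field making $\mu\mapsto\mu(B)$ measurable for every $B\in\mathcal{Y}$. On a probability space $(\Omega,\mathcal{F},\mathbb{P})$, $\eta$ is a Poisson process on $\mathbb{Y}$ with intensity measure $\lambda$: a random element of $\mathbf{N}$ such that $\eta(B)$ is Poisson distributed with parameter $\lambda(B)$ for each $B\in\mathcal{Y}$, and $\eta(B_1),\ldots,\eta(B_k)$ are independent for pairwise disjoint $B_1,\ldots,B_k\in\mathcal{Y}$. $\mathbb{P}_\eta$ is the distribution of $\eta$, and $L^2(\mathbb{P}_\eta)$ is the space of measurable $f:\mathbf{N}\to\mathbb{R}$ with $\mathbb{E}f(\eta)^2<\infty$. For measurable $f:\mathbf{N}\to\mathbb{R}$ and $y\in\mathbb{Y}$, $D_yf(\mu):=f(\mu+\delta_y)-f(\mu)$, where $\delta_y$ is the Dirac measure at $y$. The conditional expectation is always taken in the jointly measurable version $$\mathbb{E}[D_yf(\eta)\mid\eta_y]:=\int D_yf(\eta_y+\mu)\,\Pi^y(d\mu),$$ where $\Pi^y$ is the distribution of the restriction of $\eta$ to $\mathbb{Y}\setminus y_\downarrow$ (with the value $0$ on the $\mathbb{P}\otimes\lambda$-null set where this integral does not converge absolutely). *)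

theory Defs
  imports "HOL-Probability.Probability"
begin

section \<open>The space of integer-valued measures\<close>

text \<open>
  The measurable space is the carrier \<open>space L\<close> with \<open>sets L\<close>, where \<open>L\<close> is the intensity measure;
  only \<open>sets L\<close> enters the definition of the point configurations.
\<close>

definition int_valued_measures :: "'a measure \<Rightarrow> 'a measure set" where
  "int_valued_measures L =
     {\<mu>. sets \<mu> = sets L \<and> sigma_finite_measure \<mu> \<and>
         (\<forall>B\<in>sets L. emeasure \<mu> B \<in> range of_nat \<union> {\<infinity>})}"

text \<open>The smallest \<open>\<sigma>\<close>-field making all evaluations measurable (cf. \<^const>\<open>subprob_algebra\<close>).\<close>

definition config_space :: "'a measure \<Rightarrow> 'a measure measure" where
  "config_space L =
     (SUP B \<in> sets L. vimage_algebra (int_valued_measures L) (\<lambda>\<mu>. emeasure \<mu> B) borel)"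

text \<open>The restriction \<open>B \<mapsto> \<mu> (A \<inter> B)\<close>, as a measure on the whole space (unlike
  \<^const>\<open>restrict_space\<close>).\<close>

definition restr_measure :: "'a measure \<Rightarrow> 'a set \<Rightarrow> 'a measure" where
  "restr_measure \<mu> A = density \<mu> (indicator A)"

definition add_measure :: "'a measure \<Rightarrow> 'a measure \<Rightarrow> 'a measure" where
  "add_measure \<mu> \<nu> = measure_of (space \<mu>) (sets \<mu>) (\<lambda>B. emeasure \<mu> B + emeasure \<nu> B)"

text \<open>\<^term>\<open>return \<mu> y\<close> is the Dirac measure at \<open>y\<close> on the measurable space underlying \<open>\<mu>\<close>.\<close>

definition diff_op :: "'a \<Rightarrow> ('a measure \<Rightarrow> real) \<Rightarrow> 'a measure \<Rightarrow> real" where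
  "diff_op y f \<mu> = f (add_measure \<mu> (return \<mu> y)) - f \<mu>"


section \<open>Poisson processes\<close>

text \<open>
  The Poisson distribution on \<open>{0,1,2,\<dots>} \<union> {\<infinity>}\<close> with parameter in \<open>[0,\<infinity>]\<close>. The parameters
  \<open>0\<close> (excluded in \<^const>\<open>poisson_pmf\<close>) and \<open>\<infinity>\<close> give the point masses at \<open>0\<close> and \<open>\<infinity>\<close>.
\<close>

definition poisson_law :: "ennreal \<Rightarrow> ennreal measure" where
  "poisson_law l =
     (if l = 0 then return borel 0
      else if l = \<infinity> then return borel \<infinity>
      else distr (measure_pmf (poisson_pmf (enn2real l))) borel of_nat)"

definition poisson_process :: "'w measure \<Rightarrow> 'a measure \<Rightarrow> ('w \<Rightarrow> 'a measure) \<Rightarrow> bool" where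
  "poisson_process P L \<eta> \<longleftrightarrow>
     \<eta> \<in> measurable P (config_space L) \<and>
     (\<forall>B\<in>sets L. distr P borel (\<lambda>\<omega>. emeasure (\<eta> \<omega>) B) = poisson_law (emeasure L B)) \<and>
     (\<forall>(k::nat) B. B ` {..<k} \<subseteq> sets L \<longrightarrow> disjoint_family_on B {..<k} \<longrightarrow>
        prob_space.indep_vars P (\<lambda>_. borel) (\<lambda>i \<omega>. emeasure (\<eta> \<omega>) (B i)) {..<k})"

definition L2_functionals ::
    "'w measure \<Rightarrow> 'a measure \<Rightarrow> ('w \<Rightarrow> 'a measure) \<Rightarrow> ('a measure \<Rightarrow> real) set" where
  "L2_functionals P L \<eta> =
     {f. f \<in> borel_measurable (config_space L) \<and> integrable P (\<lambda>\<omega>. (f (\<eta> \<omega>))\<^sup>2)}"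

definition covariance :: "'w measure \<Rightarrow> ('w \<Rightarrow> real) \<Rightarrow> ('w \<Rightarrow> real) \<Rightarrow> real" where
  "covariance P X Y =
     (\<integral>\<omega>. (X \<omega> - (\<integral>\<omega>'. X \<omega>' \<partial>P)) * (Y \<omega> - (\<integral>\<omega>'. Y \<omega>' \<partial>P)) \<partial>P)"


section \<open>Conditional expectation of the difference operator\<close>

definition down_set :: "'a measure \<Rightarrow> ('a \<Rightarrow> 'a \<Rightarrow> bool) \<Rightarrow> 'a \<Rightarrow> 'a set" where
  "down_set L prec y = {z \<in> space L. prec z y}"

text \<open>\<open>past_measure L prec \<mu> y\<close> is \<open>\<mu>\<^sub>y\<close>.\<close>

definition past_measure ::
    "'a measure \<Rightarrow> ('a \<Rightarrow> 'a \<Rightarrow> bool) \<Rightarrow> 'a measure \<Rightarrow> 'a \<Rightarrow> 'a measure" where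
  "past_measure L prec \<mu> y = restr_measure \<mu> (down_set L prec y)"

text \<open>The distribution \<open>\<Pi>\<^sup>y\<close> of the restriction of \<open>\<eta>\<close> to the complement of \<open>down_set L prec y\<close>.\<close>

definition future_law ::
    "'w measure \<Rightarrow> 'a measure \<Rightarrow> ('w \<Rightarrow> 'a measure) \<Rightarrow> ('a \<Rightarrow> 'a \<Rightarrow> bool) \<Rightarrow> 'a
       \<Rightarrow> 'a measure measure" where
  "future_law P L \<eta> prec y =
     distr P (config_space L) (\<lambda>\<omega>. restr_measure (\<eta> \<omega>) (space L - down_set L prec y))"

text \<open>
  The version of \<open>E[D\<^sub>y f(\<eta>) | \<eta>\<^sub>y]\<close> at \<open>\<omega>\<close>. The Bochner integral is \<open>0\<close> wherever it does not converge
  absolutely, which is exactly the intended convention on the exceptional null set.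
\<close>

definition cond_diff ::
    "'w measure \<Rightarrow> 'a measure \<Rightarrow> ('w \<Rightarrow> 'a measure) \<Rightarrow> ('a \<Rightarrow> 'a \<Rightarrow> bool)
       \<Rightarrow> ('a measure \<Rightarrow> real) \<Rightarrow> 'w \<Rightarrow> 'a \<Rightarrow> real" where
  "cond_diff P L \<eta> prec f \<omega> y =
     (\<integral>\<mu>. diff_op y f (add_measure (past_measure L prec (\<eta> \<omega>) y) \<mu>) \<partial>future_law P L \<eta> prec y)"

end

theory Submission
  imports Defs "HOL-Real_Asymp.Real_Asymp"
begin

text \<open>
  For \<open>h \<ge> 0\<close> put \<open>lap h \<mu> = exp (- \<integral> h d\<mu>)\<close>. With \<open>u = 1 - exp (- h)\<close> and \<open>v = 1 - exp (- k)\<close>, the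
  conditional expectations for \<open>lap h\<close> and \<open>lap k\<close> are explicit, and the claimed identity becomes
  \<open>\<integral> exp (\<nu> (down y)) d\<nu> = exp (\<nu> Y) - 1\<close> for the finite measure \<open>d\<nu> = u v d\<lambda>\<close>. This holds because
  \<open>\<nu>\<close>-almost all points are comparable, so that \<open>\<integral> \<nu> (down y) ^ n d\<nu> = \<nu> Y ^ (n + 1) / (n + 1)\<close>.
  The span of the functionals \<open>lap h\<close> is dense in \<open>L\<^sup>2\<close>. By Mecke's formula the conditional
  expectation of the difference operator is continuous from \<open>L\<^sup>2\<close> to \<open>L\<^sup>1\<close> on sets of finite
  intensity; hence the isometry extends to all of \<open>L\<^sup>2\<close>.
\<close>

section \<open>Point configurations\<close>

text \<open>The measure \<nu> appears because Laplace functionals multiply,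
  \<open>lap h * lap k = lap (h + k)\<close>, and have mean exp (- \<integral> u d\<lambda>) under
  the Poisson process. As 1 - exp (- (h + k)) = u + v - u v, dividing the mean of the product by the
  product of the means leaves exp (\<nu> Y). The same splitting on the common past of y produces exp
  (\<nu> (down y)). The division needs positive means, so h is restricted by the integrability of u.
  Density alone would only extend the isometry to an abstract operator, which must still be
  recognised as the given integral of the difference operator. That integral evaluates f at
  configurations with an added point, so even its independence of the choice of f up to null sets
  rests on Mecke's formula. A second obstacle is measurability: only the restriction to the past is
  assumed to be jointly measurable. The restriction to the complement is recovered by subtraction,
  which is meaningless for infinite counts.\<close>

lemma space_config_space: "space (config_space L) = int_valued_measures L"
  by (auto simp: config_space_def space_Sup_eq_UN)

lemma measurable_emeasure_config [measurable]:
  "B \<in> sets L \<Longrightarrow> (\<lambda>\<mu>. emeasure \<mu> B) \<in> borel_measurable (config_space L)"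
  by (auto intro!: measurable_Sup1 measurable_vimage_algebra1 simp: config_space_def)

lemma measurable_config_spaceI:
  assumes "\<And>x. x \<in> space M \<Longrightarrow> K x \<in> int_valued_measures L"
    and "\<And>B. B \<in> sets L \<Longrightarrow> (\<lambda>x. emeasure (K x) B) \<in> borel_measurable M"
  shows "K \<in> measurable M (config_space L)"
  using assms by (auto intro!: measurable_Sup2 measurable_vimage_algebra2 simp: config_space_def)

lemma config_spaceD:
  assumes "\<mu> \<in> int_valued_measures L"
  shows "sets \<mu> = sets L" "space \<mu> = space L" "sigma_finite_measure \<mu>"
    "B \<in> sets L \<Longrightarrow> emeasure \<mu> B \<in> range of_nat \<union> {\<infinity>}"
  using assms by (auto simp: int_valued_measures_def dest: sets_eq_imp_space_eq)

section \<open>Sums of configurations\<close>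

lemma space_add_measure [simp]: "space (add_measure \<mu> \<nu>) = space \<mu>"
  and sets_add_measure [simp]: "sets (add_measure \<mu> \<nu>) = sets \<mu>"
  by (simp_all add: add_measure_def)

lemma emeasure_add_measure:
  assumes s: "sets \<nu> = sets \<mu>" and B: "B \<in> sets \<mu>"
  shows "emeasure (add_measure \<mu> \<nu>) B = emeasure \<mu> B + emeasure \<nu> B"
  unfolding add_measure_def
proof (rule emeasure_measure_of_sigma[OF _ _ _ B])
  show "sigma_algebra (space \<mu>) (sets \<mu>)" ..
  show "positive (sets \<mu>) (\<lambda>B. emeasure \<mu> B + emeasure \<nu> B)"
    by (simp add: positive_def)
  show "countably_additive (sets \<mu>) (\<lambda>B. emeasure \<mu> B + emeasure \<nu> B)"
    unfolding countably_additive_def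
  proof (intro allI impI)
    fix A :: "nat \<Rightarrow> _" assume A: "range A \<subseteq> sets \<mu>" "disjoint_family A" "\<Union> (range A) \<in> sets \<mu>"
    have "(\<Sum>i. emeasure \<mu> (A i) + emeasure \<nu> (A i)) = (\<Sum>i. emeasure \<mu> (A i)) + (\<Sum>i. emeasure \<nu> (A i))"
      by (rule suminf_add[symmetric]) auto
    then show "(\<Sum>i. emeasure \<mu> (A i) + emeasure \<nu> (A i)) =
        emeasure \<mu> (\<Union> (range A)) + emeasure \<nu> (\<Union> (range A))"
      using A s by (simp add: suminf_emeasure)
  qed
qed

lemma nn_integral_add_measure:
  assumes s: "sets \<nu> = sets \<mu>" and h: "h \<in> borel_measurable \<mu>"
  shows "(\<integral>\<^sup>+z. h z \<partial>add_measure \<mu> \<nu>) = (\<integral>\<^sup>+z. h z \<partial>\<mu>) + (\<integral>\<^sup>+z. h z \<partial>\<nu>)"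
proof -
  note [measurable_cong] = s sets_add_measure[of \<mu> \<nu>]
  have [simp]: "space \<nu> = space \<mu>" using s by (rule sets_eq_imp_space_eq)
  from h show ?thesis
  proof induct
    case (cong f g)
    then show ?case
      by (metis (mono_tags, lifting) nn_integral_cong space_add_measure \<open>space \<nu> = space \<mu>\<close>)
  next
    case (set A)
    then show ?case using s by (simp add: emeasure_add_measure)
  next
    case (mult u c)
    then show ?case
      by (simp add: nn_integral_cmult distrib_left)
  next
    case (add u v)
    then show ?case
      by (simp add: nn_integral_add ac_simps)
  next
    case (seq U)
    have *: "U i \<in> borel_measurable \<nu>" "U i \<in> borel_measurable (add_measure \<mu> \<nu>)" for i
      using seq(1)[of i] by measurable
    have "(\<integral>\<^sup>+z. (SUP i. U i z) \<partial>add_measure \<mu> \<nu>) = (SUP i. integral\<^sup>N (add_measure \<mu> \<nu>) (U i))"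
      by (rule nn_integral_monotone_convergence_SUP) (use seq * in auto)
    also have "\<dots> = (SUP i. integral\<^sup>N \<mu> (U i) + integral\<^sup>N \<nu> (U i))"
      using seq by simp
    also have "\<dots> = (SUP i. integral\<^sup>N \<mu> (U i)) + (SUP i. integral\<^sup>N \<nu> (U i))"
      by (rule ennreal_SUP_add) (use seq in \<open>auto intro!: incseq_SucI nn_integral_mono simp: incseq_Suc_iff le_fun_def\<close>)
    also have "\<dots> = (\<integral>\<^sup>+z. (SUP i. U i z) \<partial>\<mu>) + (\<integral>\<^sup>+z. (SUP i. U i z) \<partial>\<nu>)"
      using seq * by (simp add: nn_integral_monotone_convergence_SUP)
    finally show ?case by (simp add: image_comp SUP_apply[abs_def])
  qed
qed

lemma add_range_nat_infinity:
  fixes a b :: ennreal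
  assumes "a \<in> range of_nat \<union> {\<infinity>}" "b \<in> range of_nat \<union> {\<infinity>}"
  shows "a + b \<in> range of_nat \<union> {\<infinity>}"
proof -
  have "of_nat m + of_nat n \<in> (range of_nat :: ennreal set)" for m n
    by (metis of_nat_add rangeI)
  then show ?thesis using assms by auto
qed

lemma add_measure_config:
  assumes m: "\<mu> \<in> int_valued_measures L" and n: "\<nu> \<in> int_valued_measures L"
  shows "add_measure \<mu> \<nu> \<in> int_valued_measures L"
proof -
  note M = config_spaceD[OF m] and N = config_spaceD[OF n]
  obtain A :: "nat \<Rightarrow> _" where A: "range A \<subseteq> sets \<mu>" "(\<Union>i. A i) = space \<mu>"
    "\<And>i. emeasure \<mu> (A i) \<noteq> \<infinity>" "incseq A"
    using sigma_finite_measure.sigma_finite_incseq[OF M(3)] by metis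
  obtain B :: "nat \<Rightarrow> _" where B: "range B \<subseteq> sets \<nu>" "(\<Union>i. B i) = space \<nu>"
    "\<And>i. emeasure \<nu> (B i) \<noteq> \<infinity>" "incseq B"
    using sigma_finite_measure.sigma_finite_incseq[OF N(3)] by metis
  have s[simp]: "sets \<nu> = sets \<mu>" "A i \<in> sets \<mu>" "B i \<in> sets \<mu>" for i
    using A B M N by auto
  \<comment> \<open>Both exhaustions increase, so a point of \<open>A i\<close> and
    \<open>B j\<close> lies in both sets of index \<open>max i j\<close>. The intersections
    therefore still cover the space, and both measures are finite on them.\<close>
  have "(\<Union>i. A i \<inter> B i) = space \<mu>"
  proof (intro equalityI subsetI)
    fix x assume x: "x \<in> space \<mu>"
    then obtain i j where "x \<in> A i" "x \<in> B j" using A(2) B(2) M N by blast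
    then have "x \<in> A (max i j)" "x \<in> B (max i j)"
      using A(4) B(4) by (meson in_mono incseqD max.cobounded1 max.cobounded2)+
    then show "x \<in> (\<Union>i. A i \<inter> B i)" by auto
  qed (use A in auto)
  moreover have "emeasure (add_measure \<mu> \<nu>) (A i \<inter> B i) \<noteq> \<infinity>" for i
  proof -
    have "emeasure \<mu> (A i \<inter> B i) \<le> emeasure \<mu> (A i)" "emeasure \<nu> (A i \<inter> B i) \<le> emeasure \<nu> (B i)"
      by (auto intro!: emeasure_mono)
    then show ?thesis using A(3)[of i] B(3)[of i]
      by (subst emeasure_add_measure) (auto simp: top_unique)
  qed
  ultimately have "sigma_finite_measure (add_measure \<mu> \<nu>)"
    by (intro sigma_finite_measure.intro exI[of _ "range (\<lambda>i. A i \<inter> B i)"]) auto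
  moreover have "emeasure (add_measure \<mu> \<nu>) C \<in> range of_nat \<union> {\<infinity>}" if "C \<in> sets L" for C
    using that M(1) N(1) add_range_nat_infinity[OF M(4)[OF that] N(4)[OF that]]
    by (simp add: emeasure_add_measure)
  ultimately show ?thesis using M(1) by (auto simp: int_valued_measures_def)
qed

lemma measurable_add_measure [measurable (raw)]:
  assumes f[measurable]: "f \<in> measurable M (config_space L)" and g[measurable]: "g \<in> measurable M (config_space L)"
  shows "(\<lambda>x. add_measure (f x) (g x)) \<in> measurable M (config_space L)"
proof (rule measurable_config_spaceI)
  have fg: "f x \<in> int_valued_measures L" "g x \<in> int_valued_measures L" if "x \<in> space M" for x
    using measurable_space[OF f that] measurable_space[OF g that] by (simp_all add: space_config_space)
  show "add_measure (f x) (g x) \<in> int_valued_measures L" if "x \<in> space M" for x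
    using fg[OF that] by (rule add_measure_config)
  fix B assume B[measurable]: "B \<in> sets L"
  have "(\<lambda>x. emeasure (f x) B + emeasure (g x) B) \<in> borel_measurable M"
    by measurable
  also have "?this \<longleftrightarrow> (\<lambda>x. emeasure (add_measure (f x) (g x)) B) \<in> borel_measurable M"
    using config_spaceD(1)[OF fg(1)] config_spaceD(1)[OF fg(2)] B
    by (intro measurable_cong emeasure_add_measure[symmetric]) auto
  finally show "(\<lambda>x. emeasure (add_measure (f x) (g x)) B) \<in> borel_measurable M" .
qed

lemma return_config: "y \<in> space L \<Longrightarrow> return L y \<in> int_valued_measures L"
  unfolding int_valued_measures_def
proof (intro CollectI conjI ballI)
  assume y: "y \<in> space L"
  interpret prob_space "return L y" using y by (rule prob_space_return)
  show "sigma_finite_measure (return L y)" ..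
  fix B assume B: "B \<in> sets L"
  show "emeasure (return L y) B \<in> range of_nat \<union> {\<infinity>}"
    using B by (auto simp: indicator_def image_iff intro: exI[of _ 0] exI[of _ 1])
qed simp

lemma measurable_return_config [measurable]: "return L \<in> measurable L (config_space L)"
proof (rule measurable_config_spaceI)
  fix B assume B[measurable]: "B \<in> sets L"
  have "indicator B \<in> borel_measurable L" by measurable
  then show "(\<lambda>x. emeasure (return L x) B) \<in> borel_measurable L"
    using B by simp
qed (rule return_config)

lemma null_measure_config: "null_measure L \<in> int_valued_measures L"
  unfolding int_valued_measures_def
proof (intro CollectI conjI ballI)
  have "finite_measure (null_measure L)" by (rule finite_measureI) simp
  then show "sigma_finite_measure (null_measure L)" by (rule finite_measure.axioms)
  show "emeasure (null_measure L) B \<in> range of_nat \<union> {\<infinity>}" for B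
    by (auto simp: image_iff intro: exI[of _ 0])
qed simp

section \<open>Restrictions of configurations and integrals against them\<close>

lemma space_restr_measure [simp]: "space (restr_measure \<mu> A) = space \<mu>"
  and sets_restr_measure [simp, measurable_cong]: "sets (restr_measure \<mu> A) = sets \<mu>"
  by (simp_all add: restr_measure_def)

lemma emeasure_restr_measure:
  "A \<in> sets \<mu> \<Longrightarrow> B \<in> sets \<mu> \<Longrightarrow> emeasure (restr_measure \<mu> A) B = emeasure \<mu> (A \<inter> B)"
  by (simp add: restr_measure_def emeasure_density indicator_inter_arith[symmetric])

lemma nn_integral_restr_measure:
  "A \<in> sets \<mu> \<Longrightarrow> h \<in> borel_measurable \<mu> \<Longrightarrow>
    (\<integral>\<^sup>+z. h z \<partial>restr_measure \<mu> A) = (\<integral>\<^sup>+z. h z * indicator A z \<partial>\<mu>)"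
  by (simp add: restr_measure_def nn_integral_density mult.commute)

lemma sigma_finite_restr_measure:
  assumes "sigma_finite_measure \<mu>" "A \<in> sets \<mu>"
  shows "sigma_finite_measure (restr_measure \<mu> A)"
proof -
  interpret sigma_finite_measure \<mu> by fact
  obtain F :: "nat \<Rightarrow> _" where F: "range F \<subseteq> sets \<mu>" "(\<Union>i. F i) = space \<mu>" "\<And>i. emeasure \<mu> (F i) \<noteq> \<infinity>"
    using sigma_finite by blast
  have "emeasure (restr_measure \<mu> A) (F i) \<noteq> \<infinity>" for i
  proof -
    have "emeasure \<mu> (A \<inter> F i) \<le> emeasure \<mu> (F i)"
      using F by (intro emeasure_mono) auto
    then show ?thesis
      using F(1) F(3)[of i] assms(2) by (subst emeasure_restr_measure) (auto simp: top_unique image_subset_iff)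
  qed
  then show ?thesis
    using F by (intro sigma_finite_measure.intro exI[of _ "range F"]) auto
qed

lemma restr_measure_config:
  assumes m: "\<mu> \<in> int_valued_measures L" and A: "A \<in> sets L"
  shows "restr_measure \<mu> A \<in> int_valued_measures L"
  using config_spaceD[OF m] A
  by (auto simp: int_valued_measures_def emeasure_restr_measure sigma_finite_restr_measure)

lemma measurable_restr_measure [measurable]:
  assumes A[measurable]: "A \<in> sets L"
  shows "(\<lambda>\<mu>. restr_measure \<mu> A) \<in> measurable (config_space L) (config_space L)"
proof (rule measurable_config_spaceI)
  fix B assume B[measurable]: "B \<in> sets L"
  have "(\<lambda>\<mu>. emeasure \<mu> (A \<inter> B)) \<in> borel_measurable (config_space L)" by measurable
  also have "?this \<longleftrightarrow> (\<lambda>\<mu>. emeasure (restr_measure \<mu> A) B) \<in> borel_measurable (config_space L)"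
    using A B by (intro measurable_cong emeasure_restr_measure[symmetric]) (auto simp: space_config_space dest: config_spaceD)
  finally show "(\<lambda>\<mu>. emeasure (restr_measure \<mu> A) B) \<in> borel_measurable (config_space L)" .
qed (auto simp: space_config_space A intro: restr_measure_config)

text \<open>Induction on \<open>h\<close>. Indicators give the evaluations that generate the
  \<sigma>-field, and since every configuration has the measurable sets of \<open>L\<close>,
  linearity and monotone convergence hold for each of them.\<close>

lemma measurable_nn_integral_config [measurable]:
  assumes "h \<in> borel_measurable L"
  shows "(\<lambda>\<mu>. \<integral>\<^sup>+z. h z \<partial>\<mu>) \<in> borel_measurable (config_space L)"
  using assms
proof induct
  case (cong f g)
  have "(\<integral>\<^sup>+z. f z \<partial>\<mu>) = (\<integral>\<^sup>+z. g z \<partial>\<mu>)" if "\<mu> \<in> space (config_space L)" for \<mu>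
    using that cong(3) by (intro nn_integral_cong) (auto simp: space_config_space dest: config_spaceD)
  then show ?case using cong(4) by (subst measurable_cong) auto
next
  case (set B)
  have "(\<integral>\<^sup>+z. indicator B z \<partial>\<mu>) = emeasure \<mu> B" if "\<mu> \<in> space (config_space L)" for \<mu>
    using that set by (intro nn_integral_indicator) (auto simp: space_config_space dest: config_spaceD)
  then show ?case using set by (subst measurable_cong) auto
next
  case (mult u c)
  have "u \<in> borel_measurable \<mu>" if "\<mu> \<in> space (config_space L)" for \<mu>
    using that mult(2) config_spaceD(1)[of \<mu> L] measurable_cong_sets[of \<mu> L borel borel] by (auto simp: space_config_space)
  then show ?case using mult
    by (subst measurable_cong[of _ _ "\<lambda>\<mu>. c * integral\<^sup>N \<mu> u"]) (auto simp: nn_integral_cmult)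
next
  case (add u v)
  have "u \<in> borel_measurable \<mu>" "v \<in> borel_measurable \<mu>" if "\<mu> \<in> space (config_space L)" for \<mu>
    using that add(1,4) config_spaceD(1)[of \<mu> L] measurable_cong_sets[of \<mu> L borel borel] by (auto simp: space_config_space)
  then show ?case using add
    by (subst measurable_cong[of _ _ "\<lambda>\<mu>. integral\<^sup>N \<mu> v + integral\<^sup>N \<mu> u"]) (auto simp: nn_integral_add)
next
  case (seq U)
  have "U i \<in> borel_measurable \<mu>" if "\<mu> \<in> space (config_space L)" for \<mu> i
    using that seq(1)[of i] config_spaceD(1)[of \<mu> L] measurable_cong_sets[of \<mu> L borel borel] by (auto simp: space_config_space)
  moreover have "(\<Squnion> range U) = (\<lambda>x. SUP i. U i x)"
    by (simp add: fun_eq_iff image_comp)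
  ultimately show ?case using seq
    by (subst measurable_cong[of _ _ "\<lambda>\<mu>. SUP i. integral\<^sup>N \<mu> (U i)"])
       (auto simp: nn_integral_monotone_convergence_SUP)
qed

section \<open>Laplace functionals\<close>

text \<open>The continuous extension of exp (- x) to [0, \<infinity>]. The case distinction matters
  because \<open>enn2real \<infinity>\<close> is 0, which would yield the value 1.\<close>

definition exp_neg :: "ennreal \<Rightarrow> real" where
  "exp_neg x = (if x = \<infinity> then 0 else exp (- enn2real x))"

lemma exp_neg_0 [simp]: "exp_neg 0 = 1"
  and exp_neg_top [simp]: "exp_neg \<top> = 0"
  by (simp_all add: exp_neg_def)

lemma exp_neg_ennreal: "0 \<le> x \<Longrightarrow> exp_neg (ennreal x) = exp (- x)"
  by (simp add: exp_neg_def)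

lemma exp_neg_nonneg [simp]: "0 \<le> exp_neg x"
  by (simp add: exp_neg_def)

lemma exp_neg_le_1 [simp]: "exp_neg x \<le> 1"
  by (simp add: exp_neg_def)

lemma abs_exp_neg_le_1 [simp]: "\<bar>exp_neg x\<bar> \<le> 1"
  by (simp add: abs_le_iff order_trans[OF _ exp_neg_nonneg])

lemma exp_neg_add: "exp_neg (x + y) = exp_neg x * exp_neg y"
  by (cases x; cases y) (auto simp: exp_neg_ennreal exp_add[symmetric] simp flip: ennreal_plus)

lemma exp_neg_sum: "exp_neg (\<Sum>i\<in>I. f i) = (\<Prod>i\<in>I. exp_neg (f i))"
  by (induct I rule: infinite_finite_induct) (auto simp: exp_neg_add)

lemma borel_measurable_exp_neg [measurable]: "exp_neg \<in> borel_measurable borel"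
  unfolding exp_neg_def[abs_def] by measurable

lemma exp_neg_mono: "x \<le> y \<Longrightarrow> exp_neg y \<le> exp_neg x"
  by (cases x; cases y) (auto simp: exp_neg_ennreal top_unique)

lemma tendsto_exp_neg:
  assumes "(f \<longlongrightarrow> x) F"
  shows "((\<lambda>i. exp_neg (f i)) \<longlongrightarrow> exp_neg x) F"
proof (cases x)
  case (real r)
  then have "((\<lambda>i. exp (- enn2real (f i))) \<longlongrightarrow> exp (- r)) F"
    using assms by (intro tendsto_intros tendsto_enn2real) auto
  moreover have "eventually (\<lambda>i. f i < \<top>) F"
    using assms real by (intro order_tendstoD(2)[of f x]) auto
  then have "eventually (\<lambda>i. exp (- enn2real (f i)) = exp_neg (f i)) F"
    by eventually_elim (simp add: exp_neg_def)
  ultimately show ?thesis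
    using real by (auto simp: exp_neg_ennreal intro: Lim_transform_eventually)
next
  case top
  show ?thesis
  proof (rule order_tendstoI)
    fix a assume "exp_neg x < a"
    then have a: "0 < a" using top by simp
    \<comment> \<open>The threshold 1 - ln a is chosen because exp (- (1 - ln a)) = a / e, which is
      below a; the maximum with 0 keeps it in the range of \<open>ennreal\<close>.\<close>
    have "eventually (\<lambda>i. ennreal (max 0 (1 - ln a)) < f i) F"
      using assms top by (intro order_tendstoD(1)[of f x]) auto
    then show "eventually (\<lambda>i. exp_neg (f i) < a) F"
    proof eventually_elim
      case (elim i)
      then have "exp_neg (f i) \<le> exp_neg (ennreal (max 0 (1 - ln a)))"
        by (intro exp_neg_mono) simp
      also have "\<dots> = exp (- max 0 (1 - ln a))" by (rule exp_neg_ennreal) simp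
      also have "\<dots> < exp (ln a)" by (subst exp_less_cancel_iff) auto
      finally show ?case using a by simp
    qed
  qed (auto intro!: always_eventually order.strict_trans2[OF _ exp_neg_nonneg] simp: top)
qed

text \<open>The integrand of the Laplace functional of a point process. Where \<open>h\<close> is
  infinite it acts as a void indicator: the value is 0 as soon as the configuration charges the set
  on which \<open>h\<close> is infinite.\<close>

definition lap :: "('a \<Rightarrow> ennreal) \<Rightarrow> 'a measure \<Rightarrow> real" where
  "lap h \<mu> = exp_neg (\<integral>\<^sup>+z. h z \<partial>\<mu>)"

lemma lap_nonneg [simp]: "0 \<le> lap h \<mu>"
  and lap_le_1 [simp]: "lap h \<mu> \<le> 1"
  and abs_lap_le_1 [simp]: "\<bar>lap h \<mu>\<bar> \<le> 1"
  by (simp_all add: lap_def)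

lemma measurable_lap [measurable]:
  "h \<in> borel_measurable L \<Longrightarrow> lap h \<in> borel_measurable (config_space L)"
  unfolding lap_def[abs_def] by measurable

lemma borel_measurable_config:
  "h \<in> borel_measurable L \<Longrightarrow> \<mu> \<in> int_valued_measures L \<Longrightarrow> h \<in> borel_measurable \<mu>"
  using config_spaceD(1)[of \<mu> L] measurable_cong_sets[of \<mu> L borel borel] by auto

lemma lap_add_fun:
  assumes "h \<in> borel_measurable L" "k \<in> borel_measurable L" "\<mu> \<in> int_valued_measures L"
  shows "lap (\<lambda>z. h z + k z) \<mu> = lap h \<mu> * lap k \<mu>"
  using assms by (simp add: lap_def nn_integral_add borel_measurable_config exp_neg_add)

lemma lap_add_measure:
  assumes h: "h \<in> borel_measurable L" "\<mu> \<in> int_valued_measures L" "\<nu> \<in> int_valued_measures L"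
  shows "lap h (add_measure \<mu> \<nu>) = lap h \<mu> * lap h \<nu>"
  using assms by (simp add: lap_def nn_integral_add_measure borel_measurable_config config_spaceD exp_neg_add)

lemma lap_restr_measure:
  assumes "h \<in> borel_measurable L" "\<mu> \<in> int_valued_measures L" "A \<in> sets L"
  shows "lap h (restr_measure \<mu> A) = lap (\<lambda>z. h z * indicator A z) \<mu>"
  using assms by (simp add: lap_def nn_integral_restr_measure borel_measurable_config config_spaceD)

lemma lap_return:
  "h \<in> borel_measurable L \<Longrightarrow> y \<in> space L \<Longrightarrow> lap h (return L y) = exp_neg (h y)"
  by (simp add: lap_def nn_integral_return)

section \<open>The Laplace functional of the Poisson process\<close>

lemma sets_poisson_law [simp]: "sets (poisson_law l) = sets borel"
  by (simp add: poisson_law_def)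

text \<open>This is the generating function E s^N = exp (- l (1 - s)) of the Poisson distribution at
  s = exp (- x), stated so that infinite values of \<open>x\<close> and the degenerate parameters 0
  and \<infinity> are included.\<close>

lemma integral_exp_neg_poisson_law:
  "(\<integral>n. exp_neg (x * n) \<partial>poisson_law l) = exp_neg (l * ennreal (1 - exp_neg x))"
proof -
  consider "l = 0" | "l = \<infinity>" | "l \<noteq> 0" "l \<noteq> \<infinity>" by blast
  then show ?thesis
  proof cases
    case 1
    then show ?thesis by (simp add: poisson_law_def integral_return)
  next
    case 2
    have "exp_neg (x * \<infinity>) = exp_neg (\<infinity> * ennreal (1 - exp_neg x))"
    \<comment> \<open>For x = 0 both arguments are 0 by the convention 0 * \<infinity> = 0; for x >
      0 both are infinite.\<close>
    proof (cases "x = 0")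
      case False
      then have "exp_neg x < 1" by (cases x) (auto simp: exp_neg_ennreal)
      then show ?thesis using False by (simp add: ennreal_mult_top ennreal_top_mult)
    qed simp
    with 2 show ?thesis by (simp add: poisson_law_def integral_return)
  next
    case 3
    define r where "r = enn2real l"
    then have r: "l = ennreal r" "r > 0"
      using 3 by (cases l; auto simp: enn2real_positive_iff)+
    have nn: "exp_neg (x * of_nat n) = exp_neg x ^ n" for n
      by (induct n) (simp_all add: distrib_left exp_neg_add)
    have "(\<integral>n. exp_neg (x * n) \<partial>poisson_law l) = (\<integral>n. exp_neg x ^ n \<partial>measure_pmf (poisson_pmf r))"
      using 3 by (simp add: poisson_law_def integral_distr nn r_def)
    also have "\<dots> = (\<integral>n. pmf (poisson_pmf r) n * exp_neg x ^ n \<partial>count_space UNIV)"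
      by (simp add: measure_pmf_eq_density integral_density)
    also have "(\<lambda>n. pmf (poisson_pmf r) n * exp_neg x ^ n) = (\<lambda>n. exp (-r) * ((r * exp_neg x) ^ n /\<^sub>R fact n))"
      using r by (simp add: fun_eq_iff power_mult_distrib field_simps)
    also have "(\<integral>n. exp (-r) * ((r * exp_neg x) ^ n /\<^sub>R fact n) \<partial>count_space UNIV) = exp (-r) * exp (r * exp_neg x)"
    proof -
      define f where "f n = exp (-r) * ((r * exp_neg x) ^ n /\<^sub>R fact n)" for n
      have s: "f sums (exp (-r) * exp (r * exp_neg x))"
        unfolding f_def by (intro sums_mult exp_converges)
      have "0 \<le> f n" for n
        using r by (simp add: f_def)
      then have "integrable (count_space UNIV) f"
        using sums_summable[OF s] by (simp add: integrable_count_space_nat_iff)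
      then show ?thesis
        using s unfolding f_def[symmetric] by (simp add: integral_count_space_nat sums_iff)
    qed
    also have "\<dots> = exp_neg (l * ennreal (1 - exp_neg x))"
      using r by (simp add: exp_neg_ennreal ennreal_mult[symmetric] mult_exp_exp algebra_simps)
    finally show ?thesis .
  qed
qed

locale poisson = prob_space P + L: sigma_finite_measure L
  for P :: "'w measure" and L :: "'a measure" +
  fixes \<eta> :: "'w \<Rightarrow> 'a measure"
  assumes poisson_process: "poisson_process P L \<eta>"
begin

lemma measurable_eta [measurable]: "\<eta> \<in> measurable P (config_space L)"
  using poisson_process by (simp add: poisson_process_def)

lemma eta_config: "\<omega> \<in> space P \<Longrightarrow> \<eta> \<omega> \<in> int_valued_measures L"
  using measurable_space[OF measurable_eta] by (simp add: space_config_space)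

lemma expectation_exp_neg_mult:
  assumes B[measurable]: "B \<in> sets L"
  shows "(\<integral>\<omega>. exp_neg (x * emeasure (\<eta> \<omega>) B) \<partial>P) = exp_neg (emeasure L B * ennreal (1 - exp_neg x))"
proof -
  have "(\<integral>\<omega>. exp_neg (x * emeasure (\<eta> \<omega>) B) \<partial>P) = (\<integral>n. exp_neg (x * n) \<partial>distr P borel (\<lambda>\<omega>. emeasure (\<eta> \<omega>) B))"
    by (subst integral_distr) simp_all
  also have "distr P borel (\<lambda>\<omega>. emeasure (\<eta> \<omega>) B) = poisson_law (emeasure L B)"
    using poisson_process B by (auto simp: poisson_process_def)
  finally show ?thesis by (simp add: integral_exp_neg_poisson_law)
qed

text \<open>The level sets of a simple function are disjoint, so the counts in them are independent
  and the mean of the exponential of their weighted sum factorises into Poisson generating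
  functions.\<close>

lemma laplace_simple:
  assumes h: "simple_function L h"
  shows "(\<integral>\<omega>. lap h (\<eta> \<omega>) \<partial>P) = exp_neg (\<integral>\<^sup>+z. ennreal (1 - exp_neg (h z)) \<partial>L)"
proof -
  define I where "I = h ` space L"
  have fin: "finite I" using h by (simp add: I_def simple_function_def)
  define B where "B x = h -` {x} \<inter> space L" for x
  have B[measurable]: "B x \<in> sets L" for x
    using simple_functionD(2)[OF h] by (simp add: B_def)
  \<comment> \<open>\<open>poisson_process\<close> states independence for families indexed by an
    initial segment of the natural numbers, so the values of \<open>h\<close> are
    enumerated.\<close>
  obtain e where e: "bij_betw e {..<card I} I"
    using ex_bij_betw_nat_finite[OF fin] by (auto simp: atLeast0LessThan)
  have "disjoint_family_on (\<lambda>i. B (e i)) {..<card I}"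
    using e by (auto simp: disjoint_family_on_def B_def bij_betw_def inj_on_def)
  then have "indep_vars (\<lambda>_. borel) (\<lambda>i \<omega>. emeasure (\<eta> \<omega>) (B (e i))) {..<card I}"
    using poisson_process[unfolded poisson_process_def, THEN conjunct2, THEN conjunct2, rule_format, of "\<lambda>i. B (e i)" "card I"]
      image_subsetI[of "{..<card I}" "\<lambda>i. B (e i)" "sets L"] B
    by blast
  then have ind: "indep_vars (\<lambda>_. borel) (\<lambda>i \<omega>. exp_neg (e i * emeasure (\<eta> \<omega>) (B (e i)))) {..<card I}"
    by (rule indep_vars_compose2) measurable
  have "(\<integral>\<omega>. lap h (\<eta> \<omega>) \<partial>P) = (\<integral>\<omega>. (\<Prod>i<card I. exp_neg (e i * emeasure (\<eta> \<omega>) (B (e i)))) \<partial>P)"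
  proof (intro Bochner_Integration.integral_cong refl)
    fix \<omega> assume "\<omega> \<in> space P"
    then have w: "\<eta> \<omega> \<in> int_valued_measures L" by (rule eta_config)
    have "simple_function (\<eta> \<omega>) h"
      using h config_spaceD(1,2)[OF w] by (simp add: simple_function_def)
    then have "(\<integral>\<^sup>+z. h z \<partial>\<eta> \<omega>) = (\<Sum>x\<in>I. x * emeasure (\<eta> \<omega>) (B x))"
      using config_spaceD(2)[OF w]
      by (subst nn_integral_eq_simple_integral) (auto simp: simple_integral_def I_def B_def)
    also have "\<dots> = (\<Sum>i<card I. e i * emeasure (\<eta> \<omega>) (B (e i)))"
      by (rule sum.reindex_bij_betw[OF e, symmetric])
    finally show "lap h (\<eta> \<omega>) = (\<Prod>i<card I. exp_neg (e i * emeasure (\<eta> \<omega>) (B (e i))))"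
      by (simp add: lap_def exp_neg_sum)
  qed
  also have "\<dots> = (\<Prod>i<card I. \<integral>\<omega>. exp_neg (e i * emeasure (\<eta> \<omega>) (B (e i))) \<partial>P)"
    by (intro indep_vars_lebesgue_integral ind) (auto intro!: integrable_const_bound[of _ 1])
  also have "\<dots> = (\<Prod>i<card I. exp_neg (emeasure L (B (e i)) * ennreal (1 - exp_neg (e i))))"
    by (simp add: expectation_exp_neg_mult)
  also have "\<dots> = (\<Prod>x\<in>I. exp_neg (emeasure L (B x) * ennreal (1 - exp_neg x)))"
    by (rule prod.reindex_bij_betw[OF e])
  also have "\<dots> = exp_neg (\<Sum>x\<in>I. emeasure L (B x) * ennreal (1 - exp_neg x))"
    by (simp add: exp_neg_sum)
  also have "(\<Sum>x\<in>I. emeasure L (B x) * ennreal (1 - exp_neg x)) = (\<integral>\<^sup>+z. (\<Sum>x\<in>I. ennreal (1 - exp_neg x) * indicator (B x) z) \<partial>L)"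
    by (subst nn_integral_sum) (auto simp: nn_integral_cmult_indicator intro!: sum.cong mult.commute)
  also have "\<dots> = (\<integral>\<^sup>+z. ennreal (1 - exp_neg (h z)) \<partial>L)"
  proof (rule nn_integral_cong)
    fix z assume z: "z \<in> space L"
    have "(\<Sum>x\<in>I. ennreal (1 - exp_neg x) * indicator (B x) z) = (\<Sum>x\<in>I. if x = h z then ennreal (1 - exp_neg x) else 0)"
      using z by (intro sum.cong) (auto simp: B_def)
    also have "\<dots> = ennreal (1 - exp_neg (h z))"
      using fin z by (auto simp: I_def)
    finally show "(\<Sum>x\<in>I. ennreal (1 - exp_neg x) * indicator (B x) z) = ennreal (1 - exp_neg (h z))" .
  qed
  finally show ?thesis .
qed

text \<open>Simple functions increase to \<open>h\<close>. On the left, monotone convergence applies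
  inside the exponential for each configuration and dominated convergence with bound 1 outside; on
  the right the integrand 1 - exp (- h) increases with \<open>h\<close>.\<close>

lemma laplace:
  assumes h: "h \<in> borel_measurable L"
  shows "(\<integral>\<omega>. lap h (\<eta> \<omega>) \<partial>P) = exp_neg (\<integral>\<^sup>+z. ennreal (1 - exp_neg (h z)) \<partial>L)"
proof -
  obtain f where f: "\<And>i. simple_function L (f i)" "incseq f" "\<And>i x. f i x < \<top>" "\<And>x. (SUP i. f i x) = h x"
    using borel_measurable_implies_simple_function_sequence'[OF h] by metis
  have [measurable]: "f i \<in> borel_measurable L" for i
    using f(1) by (rule borel_measurable_simple_function)
  have inc: "incseq (\<lambda>i. f i x)" for x using f(2) by (auto simp: incseq_def le_fun_def)
  have lim: "(\<lambda>i. f i x) \<longlonglongrightarrow> h x" for x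
    using LIMSEQ_SUP[OF inc[of x]] by (simp add: f(4))
  have lap_lim: "(\<lambda>i. lap (f i) \<mu>) \<longlonglongrightarrow> lap h \<mu>" if "\<mu> \<in> int_valued_measures L" for \<mu>
  proof -
    have "f i \<in> borel_measurable \<mu>" for i
      using borel_measurable_config[of "f i" L \<mu>] that by simp
    then have "(\<integral>\<^sup>+z. h z \<partial>\<mu>) = (SUP i. \<integral>\<^sup>+z. f i z \<partial>\<mu>)"
      by (subst f(4)[symmetric]) (intro nn_integral_monotone_convergence_SUP f(2))
    moreover have "incseq (\<lambda>i. \<integral>\<^sup>+z. f i z \<partial>\<mu>)"
      using f(2) by (auto simp: incseq_def le_fun_def intro!: nn_integral_mono)
    ultimately show ?thesis
      unfolding lap_def by (metis LIMSEQ_SUP tendsto_exp_neg)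
  qed
  have "(\<lambda>i. \<integral>\<omega>. lap (f i) (\<eta> \<omega>) \<partial>P) \<longlonglongrightarrow> (\<integral>\<omega>. lap h (\<eta> \<omega>) \<partial>P)"
    by (rule integral_dominated_convergence[where w = "\<lambda>_. 1"])
       (use h in \<open>auto intro!: AE_I2 lap_lim eta_config\<close>)
  moreover have "(\<lambda>i. exp_neg (\<integral>\<^sup>+z. ennreal (1 - exp_neg (f i z)) \<partial>L)) \<longlonglongrightarrow> exp_neg (\<integral>\<^sup>+z. ennreal (1 - exp_neg (h z)) \<partial>L)"
  proof (intro tendsto_exp_neg nn_integral_LIMSEQ)
    show "incseq (\<lambda>i z. ennreal (1 - exp_neg (f i z)))"
      using f(2) by (auto simp: incseq_def le_fun_def intro!: ennreal_leI exp_neg_mono)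
    show "(\<lambda>i. ennreal (1 - exp_neg (f i x))) \<longlonglongrightarrow> ennreal (1 - exp_neg (h x))" for x
      by (intro tendsto_ennrealI tendsto_diff tendsto_const tendsto_exp_neg lim)
  qed auto
  ultimately show ?thesis
    using laplace_simple[OF f(1)] LIMSEQ_unique by auto
qed

end

section \<open>Density of the Laplace functionals\<close>

text \<open>By \<open>laplace\<close> these are the measurable \<open>h\<close> for which the mean
  of \<open>lap h\<close> is positive. Infinite values remain possible on sets of finite
  intensity.\<close>

definition lap_funs :: "'a measure \<Rightarrow> ('a \<Rightarrow> ennreal) set" where
  "lap_funs L = {h \<in> borel_measurable L. (\<integral>\<^sup>+z. ennreal (1 - exp_neg (h z)) \<partial>L) < \<infinity>}"

lemma lap_funs_measurable: "h \<in> lap_funs L \<Longrightarrow> h \<in> borel_measurable L"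
  by (simp add: lap_funs_def)

lemma lap_funs_zero: "(\<lambda>_. 0) \<in> lap_funs L"
  by (simp add: lap_funs_def)

lemma one_minus_exp_neg_add_le:
  "ennreal (1 - exp_neg (x + y)) \<le> ennreal (1 - exp_neg x) + ennreal (1 - exp_neg y)"
proof -
  have "0 \<le> (1 - exp_neg x) * (1 - exp_neg y)" by simp
  then show ?thesis
    by (subst ennreal_plus[symmetric]) (auto simp: exp_neg_add algebra_simps intro!: ennreal_leI)
qed

lemma lap_funs_add:
  assumes "h \<in> lap_funs L" "k \<in> lap_funs L"
  shows "(\<lambda>z. h z + k z) \<in> lap_funs L"
proof -
  have [measurable]: "h \<in> borel_measurable L" "k \<in> borel_measurable L"
    using assms by (auto simp: lap_funs_def)
  have "(\<integral>\<^sup>+z. ennreal (1 - exp_neg (h z + k z)) \<partial>L) \<le>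
      (\<integral>\<^sup>+z. ennreal (1 - exp_neg (h z)) + ennreal (1 - exp_neg (k z)) \<partial>L)"
    by (intro nn_integral_mono one_minus_exp_neg_add_le)
  also have "\<dots> < \<infinity>"
    using assms by (subst nn_integral_add) (auto simp: lap_funs_def)
  finally show ?thesis by (simp add: lap_funs_def)
qed

lemma lap_funs_scaled_indicator:
  assumes B[measurable]: "B \<in> sets L" "emeasure L B < \<infinity>"
  shows "(\<lambda>z. c * indicator B z) \<in> lap_funs L"
proof -
  have "(\<integral>\<^sup>+z. ennreal (1 - exp_neg (c * indicator B z)) \<partial>L) \<le> (\<integral>\<^sup>+z. indicator B z \<partial>L)"
    by (intro nn_integral_mono) (auto simp: indicator_def)
  then show ?thesis using B by (auto simp: lap_funs_def)
qed

text \<open>The linear span of Laplace functionals, regarded as functions of configurations only.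
  Functionals are defined on all measures, whereas the product rule \<open>lap_add_fun\<close> holds
  on configurations; the rule \<open>cong\<close> bridges the difference.\<close>

inductive_set lap_span :: "'a measure \<Rightarrow> ('a measure \<Rightarrow> real) set" for L where
  lap: "h \<in> lap_funs L \<Longrightarrow> lap h \<in> lap_span L"
| add: "f \<in> lap_span L \<Longrightarrow> g \<in> lap_span L \<Longrightarrow> (\<lambda>\<mu>. f \<mu> + g \<mu>) \<in> lap_span L"
| scale: "f \<in> lap_span L \<Longrightarrow> (\<lambda>\<mu>. c * f \<mu>) \<in> lap_span L"
| cong: "f \<in> lap_span L \<Longrightarrow> (\<And>\<mu>. \<mu> \<in> int_valued_measures L \<Longrightarrow> f \<mu> = g \<mu>) \<Longrightarrow> g \<in> lap_span L"

lemma lap_span_measurable: "f \<in> lap_span L \<Longrightarrow> f \<in> borel_measurable (config_space L)"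
proof (induct rule: lap_span.induct)
  case (cong f g)
  then show ?case by (subst measurable_cong[of _ _ f]) (auto simp: space_config_space)
qed (auto intro: measurable_lap lap_funs_measurable)

lemma lap_span_bounded: "f \<in> lap_span L \<Longrightarrow> \<exists>C. \<forall>\<mu>\<in>int_valued_measures L. \<bar>f \<mu>\<bar> \<le> C"
proof (induct rule: lap_span.induct)
  case (add f g)
  then obtain C D where "\<forall>\<mu>\<in>int_valued_measures L. \<bar>f \<mu>\<bar> \<le> C" "\<forall>\<mu>\<in>int_valued_measures L. \<bar>g \<mu>\<bar> \<le> D"
    by blast
  then have "\<forall>\<mu>\<in>int_valued_measures L. \<bar>f \<mu> + g \<mu>\<bar> \<le> C + D"
    by (meson abs_triangle_ineq add_mono order_trans)
  then show ?case ..
next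
  case (scale f c)
  then obtain C where "\<forall>\<mu>\<in>int_valued_measures L. \<bar>f \<mu>\<bar> \<le> C" by blast
  then have "\<forall>\<mu>\<in>int_valued_measures L. \<bar>c * f \<mu>\<bar> \<le> \<bar>c\<bar> * C"
    by (auto simp: abs_mult intro!: mult_left_mono)
  then show ?case ..
qed (auto intro: exI[of _ 1])

lemma lap_span_const: "(\<lambda>_. c) \<in> lap_span L"
proof -
  have "(\<lambda>\<mu>. c * lap (\<lambda>_. 0) \<mu>) \<in> lap_span L"
    by (intro lap_span.scale lap_span.lap lap_funs_zero)
  then show ?thesis by (simp add: lap_def)
qed

lemma lap_span_diff:
  "f \<in> lap_span L \<Longrightarrow> g \<in> lap_span L \<Longrightarrow> (\<lambda>\<mu>. f \<mu> - g \<mu>) \<in> lap_span L"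
  using lap_span.add[OF _ lap_span.scale[of g L "-1"], of f] by simp

text \<open>Since \<open>lap h * lap k = lap (h + k)\<close>, the span is an algebra. The two
  factors are treated one after the other, here the left one and in \<open>lap_span_mult\<close> the
  right one.\<close>

lemma lap_span_mult_lap:
  assumes k: "k \<in> lap_funs L"
  shows "f \<in> lap_span L \<Longrightarrow> (\<lambda>\<mu>. f \<mu> * lap k \<mu>) \<in> lap_span L"
proof (induct rule: lap_span.induct)
  case (lap h)
  show ?case
    by (rule lap_span.cong[OF lap_span.lap[OF lap_funs_add[OF lap k]]])
       (rule lap_add_fun[OF lap_funs_measurable[OF lap] lap_funs_measurable[OF k]])
next
  case (add f g)
  then show ?case using lap_span.add[OF add(2,4)] by (simp add: distrib_right)
next
  case (scale f c)
  then show ?case using lap_span.scale[OF scale(2)] by (simp add: mult.assoc)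
next
  case (cong f g)
  then show ?case by (intro lap_span.cong[OF cong(2)]) auto
qed

lemma lap_span_mult:
  assumes f: "f \<in> lap_span L"
  shows "g \<in> lap_span L \<Longrightarrow> (\<lambda>\<mu>. f \<mu> * g \<mu>) \<in> lap_span L"
proof (induct rule: lap_span.induct)
  case (lap h)
  then show ?case by (rule lap_span_mult_lap[OF _ f])
next
  case (add g h)
  then show ?case using lap_span.add[OF add(2,4)] by (simp add: distrib_left)
next
  case (scale g c)
  then show ?case using lap_span.scale[OF scale(2), of c] by (simp add: mult.left_commute)
next
  case (cong g h)
  then show ?case by (intro lap_span.cong[OF cong(2)]) auto
qed

lemma lap_span_power: "f \<in> lap_span L \<Longrightarrow> (\<lambda>\<mu>. f \<mu> ^ n) \<in> lap_span L"
  by (induct n) (auto simp: lap_span_const intro: lap_span_mult)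

section \<open>Indicators as bounded limits of elements of the span, and uniqueness of laws\<close>

definition lap_limit_sets :: "'a measure \<Rightarrow> 'a measure set set" where
  "lap_limit_sets L = {A \<in> sets (config_space L). \<exists>s. \<forall>n. s n \<in> lap_span L \<and>
     (\<forall>\<mu>\<in>int_valued_measures L. \<bar>s n \<mu>\<bar> \<le> 1 \<and> (\<lambda>n. s n \<mu>) \<longlonglongrightarrow> indicator A \<mu>)}"

text \<open>Products of approximating sequences approximate the indicator of the intersection, and
  the bound 1 is preserved by products. The bound also permits dominated convergence under any
  finite measure.\<close>

lemma Int_stable_lap_limit_sets: "Int_stable (lap_limit_sets L)"
proof (rule Int_stableI)
  fix A B assume "A \<in> lap_limit_sets L" "B \<in> lap_limit_sets L"
  then obtain s t where st: "A \<in> sets (config_space L)" "B \<in> sets (config_space L)"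
    "\<And>n. s n \<in> lap_span L" "\<And>n. t n \<in> lap_span L"
    "\<And>n \<mu>. \<mu> \<in> int_valued_measures L \<Longrightarrow> \<bar>s n \<mu>\<bar> \<le> 1"
    "\<And>n \<mu>. \<mu> \<in> int_valued_measures L \<Longrightarrow> \<bar>t n \<mu>\<bar> \<le> 1"
    "\<And>\<mu>. \<mu> \<in> int_valued_measures L \<Longrightarrow> (\<lambda>n. s n \<mu>) \<longlonglongrightarrow> indicator A \<mu>"
    "\<And>\<mu>. \<mu> \<in> int_valued_measures L \<Longrightarrow> (\<lambda>n. t n \<mu>) \<longlonglongrightarrow> indicator B \<mu>"
    unfolding lap_limit_sets_def by blast
  have "\<bar>s n \<mu> * t n \<mu>\<bar> \<le> 1" if "\<mu> \<in> int_valued_measures L" for n \<mu>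
    using st(5,6)[OF that, of n] by (simp add: abs_mult mult_le_one)
  moreover have "(\<lambda>n. s n \<mu> * t n \<mu>) \<longlonglongrightarrow> indicator (A \<inter> B) \<mu>" if "\<mu> \<in> int_valued_measures L" for \<mu>
    using st(7,8)[OF that] by (simp add: indicator_inter_arith tendsto_mult)
  ultimately show "A \<inter> B \<in> lap_limit_sets L"
    using st(1-4) unfolding lap_limit_sets_def
    by (intro CollectI conjI exI[of _ "\<lambda>n \<mu>. s n \<mu> * t n \<mu>"]) (auto intro: lap_span_mult)
qed

lemma lap_limit_sets_subset: "lap_limit_sets L \<subseteq> Pow (int_valued_measures L)"
  unfolding space_config_space[symmetric] by (auto simp: lap_limit_sets_def dest: sets.sets_into_space)

lemma space_lap_limit_sets: "int_valued_measures L \<in> lap_limit_sets L"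
  unfolding lap_limit_sets_def
  by (intro CollectI conjI exI[of _ "\<lambda>n \<mu>. 1"])
     (auto intro: lap_span_const simp: space_config_space[symmetric])

text \<open>The expression behaves like exp (- (2 x)^m), hence separates x < 1/2 from x > 1/2. It is
  the device of Brosowski and Deutsch for the Stone-Weierstrass theorem. Bernoulli's inequality
  gives the lower bound, 1 - t \<le> exp (- t) the upper one.\<close>

lemma tendsto_power_power_two:
  fixes x :: real
  assumes "0 \<le> x" "x \<le> 1"
  shows "2 * x < 1 \<Longrightarrow> (\<lambda>m. (1 - x ^ m) ^ (2 ^ m)) \<longlonglongrightarrow> 1"
    and "2 * x > 1 \<Longrightarrow> (\<lambda>m. (1 - x ^ m) ^ (2 ^ m)) \<longlonglongrightarrow> 0"
proof -
  have x: "0 \<le> x ^ m" "x ^ m \<le> 1" for m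
    using assms by (auto intro: power_le_one)
  {
    assume "2 * x < 1"
    have lower: "1 - (2 * x) ^ m \<le> (1 - x ^ m) ^ (2 ^ m)" for m
      using Bernoulli_inequality[of "- (x ^ m)" "2 ^ m"] x[of m] by (simp add: power_mult_distrib)
    have "norm (2 * x) < 1" using \<open>2 * x < 1\<close> assms by simp
    then have "(\<lambda>m. (2 * x) ^ m) \<longlonglongrightarrow> 0" by (rule LIMSEQ_power_zero)
    then have "(\<lambda>m. 1 - (2 * x) ^ m) \<longlonglongrightarrow> 1 - 0" by (intro tendsto_diff tendsto_const)
    then have "(\<lambda>m. 1 - (2 * x) ^ m) \<longlonglongrightarrow> 1" by simp
    moreover have "(1 - x ^ m) ^ (2 ^ m) \<le> 1" for m
      by (rule power_le_one) (use x[of m] in auto)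
    ultimately show "(\<lambda>m. (1 - x ^ m) ^ (2 ^ m)) \<longlonglongrightarrow> 1"
      using lower by (rule_tac tendsto_sandwich[OF always_eventually always_eventually _ tendsto_const]) auto
  }
  assume gt: "2 * x > 1"
  have upper: "(1 - x ^ m) ^ (2 ^ m) \<le> inverse ((2 * x) ^ m)" for m
  proof -
    have "1 - x ^ m \<le> exp (- (x ^ m))" using exp_ge_add_one_self[of "- (x ^ m)"] by simp
    then have "(1 - x ^ m) ^ (2 ^ m) \<le> exp (- (x ^ m)) ^ (2 ^ m)"
      using x[of m] by (intro power_mono) auto
    also have "\<dots> = exp (- ((2 * x) ^ m))"
      by (simp add: exp_of_nat_mult[symmetric] power_mult_distrib)
    also have "\<dots> \<le> inverse ((2 * x) ^ m)"
      unfolding exp_minus using gt exp_ge_add_one_self[of "(2 * x) ^ m"] by (intro le_imp_inverse_le zero_less_power) linarith+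
    finally show ?thesis .
  qed
  have "(\<lambda>m. inverse ((2 * x) ^ m)) \<longlonglongrightarrow> 0"
    using gt by (rule LIMSEQ_inverse_realpow_zero)
  moreover have "0 \<le> (1 - x ^ m) ^ (2 ^ m)" for m
    by (rule zero_le_power) (use x[of m] in auto)
  ultimately show "(\<lambda>m. (1 - x ^ m) ^ (2 ^ m)) \<longlonglongrightarrow> 0"
    using upper by (rule_tac tendsto_sandwich[OF always_eventually always_eventually tendsto_const]) auto
qed

lemma exp_neg_of_nat_mult: "exp_neg (of_nat m * a) = exp_neg a ^ m"
  by (induct m) (auto simp: distrib_right exp_neg_add)

text \<open>With x = exp (- t \<mu>(B)), every power of x is a Laplace functional, so (1 -
  x^m)^(2^m) lies in the span. Its limit is 1 or 0 according to whether x is below or above 1/2,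
  that is, whether the count is large or small.\<close>

lemma count_gt_in_lap_limit_sets:
  assumes B[measurable]: "B \<in> sets L" and fin: "emeasure L B < \<infinity>"
  shows "{\<mu> \<in> int_valued_measures L. of_nat n < emeasure \<mu> B} \<in> lap_limit_sets L"
proof -
  \<comment> \<open>For this t the function exp (- t j) passes through 1/2 exactly at j = n + 1/2.
    Counts are integers, so the undecided value 1/2 is never attained.\<close>
  define t :: real where "t = ln 2 / (n + 1 / 2)"
  have t: "t > 0" by (simp add: t_def)
  define s where "s m \<mu> = (1 - lap (\<lambda>z. (of_nat m * ennreal t) * indicator B z) \<mu>) ^ (2 ^ m)" for m \<mu>
  have "s m \<in> lap_span L" for m
    unfolding s_def by (intro lap_span_power lap_span_diff lap_span_const lap_span.lap lap_funs_scaled_indicator B fin)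
  moreover have "\<bar>s m \<mu>\<bar> \<le> 1" for m \<mu>
    by (simp add: s_def power_abs[symmetric] power_le_one)
  moreover have "(\<lambda>m. s m \<mu>) \<longlonglongrightarrow> indicator {\<mu> \<in> int_valued_measures L. of_nat n < emeasure \<mu> B} \<mu>"
    if mu: "\<mu> \<in> int_valued_measures L" for \<mu>
  proof -
    have [simp]: "B \<in> sets \<mu>" using config_spaceD(1)[OF mu] by simp
    define x where "x = exp_neg (ennreal t * emeasure \<mu> B)"
    have "(\<integral>\<^sup>+z. (of_nat m * ennreal t) * indicator B z \<partial>\<mu>) = of_nat m * (ennreal t * emeasure \<mu> B)" for m
      by (subst nn_integral_cmult_indicator) (simp_all add: mult.assoc)
    then have s: "s m \<mu> = (1 - x ^ m) ^ (2 ^ m)" for m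
      by (simp add: s_def lap_def x_def exp_neg_of_nat_mult del: of_nat_mult)
    have x: "0 \<le> x" "x \<le> 1" by (simp_all add: x_def)
    show ?thesis
    proof (cases "emeasure \<mu> B = \<infinity>")
      case True
      \<comment> \<open>An infinite count falls under the case x < 1/2.\<close>
      then have "x = 0" using t by (simp add: x_def ennreal_mult_top)
      then show ?thesis using tendsto_power_power_two(1)[OF x] True mu
        by (simp add: s[abs_def] of_nat_less_top)
    next
      case False
      then obtain j where j: "emeasure \<mu> B = of_nat j" using config_spaceD(4)[OF mu B] by auto
      have xj: "x = exp (- (t * j))"
        using t by (simp add: x_def j ennreal_of_nat_eq_real_of_nat ennreal_mult[symmetric] exp_neg_ennreal)
      have x2: "2 * x = exp (ln 2 - t * j)" by (simp add: xj exp_diff exp_minus divide_inverse)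
      have tn: "ln 2 = t * (n + 1/2)" by (simp add: t_def field_simps)
      show ?thesis
      proof (cases "n < j")
        case True
        then have "real j \<ge> n + 1" by linarith
        then have "ln 2 - t * j < 0" using t unfolding tn by (simp add: mult_less_cancel_left)
        then have "2 * x < 1" unfolding x2 by simp
        then show ?thesis using tendsto_power_power_two(1)[OF x] True mu
          by (simp add: s[abs_def] j)
      next
        case False
        then have "real j < n + 1 / 2" by linarith
        then have "ln 2 - t * j > 0" using t unfolding tn by (simp add: mult_less_cancel_left)
        then have "2 * x > 1" unfolding x2 by simp
        then show ?thesis using tendsto_power_power_two(2)[OF x] False mu
          by (simp add: s[abs_def] j)
      qed
    qed
  qed
  moreover have "{\<mu> \<in> space (config_space L). of_nat n < emeasure \<mu> B} \<in> sets (config_space L)"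
    by measurable
  ultimately show ?thesis
    unfolding lap_limit_sets_def space_config_space by blast
qed

text \<open>The evaluations can be rebuilt from the \<pi>-system: for \<open>B\<close> of finite
  intensity the count is recovered from its level sets, and for general \<open>B\<close> it is the
  supremum of the counts in sets of finite intensity.\<close>

lemma (in sigma_finite_measure) sets_config_space_lap_limit:
  "sets (config_space M) = sigma_sets (int_valued_measures M) (lap_limit_sets M)"
proof
  let ?S = "sigma (int_valued_measures M) (lap_limit_sets M)"
  note [simp] = space_measure_of[OF lap_limit_sets_subset] sets_measure_of[OF lap_limit_sets_subset]
  have fin: "(\<lambda>\<mu>. emeasure \<mu> B) \<in> borel_measurable ?S" if B: "B \<in> sets M" "emeasure M B < \<infinity>" for B
  proof -
    let ?A = "\<lambda>n. {\<mu> \<in> int_valued_measures M. of_nat n < emeasure \<mu> B}"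
    have [measurable]: "?A n \<in> sets ?S" for n
      using count_gt_in_lap_limit_sets[OF B] by auto
    \<comment> \<open>A value in {0, 1, 2, ...} \<union> {\<infinity>} is the number of natural
      numbers strictly below it.\<close>
    have eq: "emeasure \<mu> B = (\<Sum>n. indicator (?A n) \<mu>)" if mu: "\<mu> \<in> int_valued_measures M" for \<mu>
    proof -
      have "(\<Sum>n. indicator (?A n) \<mu>) = (\<Sum>n. if of_nat n < emeasure \<mu> B then 1 else 0 :: ennreal)"
        using mu by (intro suminf_cong) (auto simp: indicator_def)
      moreover have "(\<Sum>n. if of_nat n < emeasure \<mu> B then 1 else 0 :: ennreal) = emeasure \<mu> B"
      proof (cases "emeasure \<mu> B = \<infinity>")
        case True
        have "(\<Sum>n. 1 :: ennreal) = \<infinity>"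
          using nn_integral_count_space_nat[of "\<lambda>_. 1::ennreal"] by simp
        then show ?thesis using True by (simp add: of_nat_less_top)
      next
        case False
        then obtain j where j: "emeasure \<mu> B = of_nat j" using config_spaceD(4)[OF mu B(1)] by auto
        have "(\<Sum>n. if of_nat n < emeasure \<mu> B then 1 else 0 :: ennreal) = (\<Sum>n\<in>{..<j}. 1)"
          by (subst suminf_finite[of "{..<j}"]) (auto simp: j)
        then show ?thesis by (simp add: j)
      qed
      ultimately show ?thesis by simp
    qed
    have "(\<lambda>\<mu>. \<Sum>n. indicator (?A n) \<mu> :: ennreal) \<in> borel_measurable ?S" by measurable
    then show ?thesis
      by (rule measurable_cong[THEN iffD1, rotated]) (rule eq[symmetric], simp)
  qed
  obtain F :: "nat \<Rightarrow> _" where F: "range F \<subseteq> sets M" "(\<Union>i. F i) = space M" "\<And>i. emeasure M (F i) \<noteq> \<infinity>" "incseq F"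
    using sigma_finite_incseq by blast
  have "(\<lambda>\<mu>. \<mu>) \<in> measurable ?S (config_space M)"
  proof (rule measurable_config_spaceI)
    fix B assume B: "B \<in> sets M"
    have eq: "emeasure \<mu> B = (SUP i. emeasure \<mu> (B \<inter> F i))" if mu: "\<mu> \<in> int_valued_measures M" for \<mu>
    proof -
      have "(SUP i. emeasure \<mu> (B \<inter> F i)) = emeasure \<mu> (\<Union>i. B \<inter> F i)"
        using F B config_spaceD(1)[OF mu] by (intro SUP_emeasure_incseq monoI) (auto dest: incseqD[OF F(4)])
      also have "(\<Union>i. B \<inter> F i) = B" using F(2) sets.sets_into_space[OF B] by auto
      finally show ?thesis ..
    qed
    have "emeasure M (B \<inter> F i) < \<infinity>" for i
    proof -
      have "emeasure M (B \<inter> F i) \<le> emeasure M (F i)"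
        using F(1) by (intro emeasure_mono) auto
      then show ?thesis using F(3)[of i] by (auto simp: less_top intro: le_less_trans)
    qed
    then have "(\<lambda>\<mu>. emeasure \<mu> (B \<inter> F i)) \<in> borel_measurable ?S" for i
      using F B by (intro fin) auto
    then have "(\<lambda>\<mu>. SUP i. emeasure \<mu> (B \<inter> F i)) \<in> borel_measurable ?S"
      by measurable
    then show "(\<lambda>\<mu>. emeasure \<mu> B) \<in> borel_measurable ?S"
      by (rule measurable_cong[THEN iffD1, rotated]) (rule eq[symmetric], simp)
  qed auto
  then have meas: "A \<inter> int_valued_measures M \<in> sigma_sets (int_valued_measures M) (lap_limit_sets M)"
    if "A \<in> sets (config_space M)" for A
    using measurable_sets[of "\<lambda>\<mu>. \<mu>" ?S "config_space M" A] that by simp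
  show "sets (config_space M) \<subseteq> sigma_sets (int_valued_measures M) (lap_limit_sets M)"
  proof
    fix A assume A: "A \<in> sets (config_space M)"
    then have "A \<inter> int_valued_measures M = A"
      using sets.sets_into_space[OF A] by (simp add: space_config_space Int_absorb2)
    with meas[OF A] show "A \<in> sigma_sets (int_valued_measures M) (lap_limit_sets M)" by simp
  qed
  show "sigma_sets (int_valued_measures M) (lap_limit_sets M) \<subseteq> sets (config_space M)"
    unfolding space_config_space[symmetric]
    by (rule sets.sigma_sets_subset) (auto simp: lap_limit_sets_def)
qed

text \<open>Equality of the integrals passes to the span by linearity, to the sets in
  \<open>lap_limit_sets\<close> by bounded convergence, and to the whole \<sigma>-field because
  these sets form a generating \<pi>-system. It is stated for finite measures since the two measures
  compared for Mecke's formula are not normalised.\<close>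

lemma (in sigma_finite_measure) laplace_unique:
  assumes "finite_measure N1" "finite_measure N2"
    and [measurable_cong]: "sets N1 = sets (config_space M)" "sets N2 = sets (config_space M)"
    and eq: "\<And>h. h \<in> lap_funs M \<Longrightarrow> (\<integral>\<mu>. lap h \<mu> \<partial>N1) = (\<integral>\<mu>. lap h \<mu> \<partial>N2)"
  shows "N1 = N2"
proof -
  interpret N1: finite_measure N1 by fact
  interpret N2: finite_measure N2 by fact
  have sp: "space N1 = int_valued_measures M" "space N2 = int_valued_measures M"
    using sets_eq_imp_space_eq[OF assms(3)] sets_eq_imp_space_eq[OF assms(4)] by (simp_all add: space_config_space)
  have int1: "integrable N1 f" if f: "f \<in> lap_span M" for f
  proof -
    have [measurable]: "f \<in> borel_measurable N1" using lap_span_measurable[OF f] by measurable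
    show ?thesis using lap_span_bounded[OF f] sp by (auto intro!: N1.integrable_const_bound AE_I2)
  qed
  have int2: "integrable N2 f" if f: "f \<in> lap_span M" for f
  proof -
    have [measurable]: "f \<in> borel_measurable N2" using lap_span_measurable[OF f] by measurable
    show ?thesis using lap_span_bounded[OF f] sp by (auto intro!: N2.integrable_const_bound AE_I2)
  qed
  have eqs: "f \<in> lap_span M \<Longrightarrow> (\<integral>\<mu>. f \<mu> \<partial>N1) = (\<integral>\<mu>. f \<mu> \<partial>N2)" for f
  proof (induct rule: lap_span.induct)
    case (cong f g)
    have "(\<integral>\<mu>. f \<mu> \<partial>N1) = (\<integral>\<mu>. g \<mu> \<partial>N1)" "(\<integral>\<mu>. f \<mu> \<partial>N2) = (\<integral>\<mu>. g \<mu> \<partial>N2)"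
      using cong(3) sp by (auto intro!: Bochner_Integration.integral_cong)
    with cong show ?case by simp
  qed (simp_all add: eq int1 int2)
  have lim: "emeasure N1 A = emeasure N2 A" if A: "A \<in> lap_limit_sets M" for A
  proof -
    obtain s where s: "\<And>n. s n \<in> lap_span M" "\<And>n \<mu>. \<mu> \<in> int_valued_measures M \<Longrightarrow> \<bar>s n \<mu>\<bar> \<le> 1"
      "\<And>\<mu>. \<mu> \<in> int_valued_measures M \<Longrightarrow> (\<lambda>n. s n \<mu>) \<longlonglongrightarrow> indicator A \<mu>"
      and [measurable]: "A \<in> sets (config_space M)"
      using A unfolding lap_limit_sets_def by blast
    have [measurable]: "s n \<in> borel_measurable (config_space M)" for n
      using s(1) by (rule lap_span_measurable)
    have "(\<lambda>n. \<integral>\<mu>. s n \<mu> \<partial>N1) \<longlonglongrightarrow> (\<integral>\<mu>. indicator A \<mu> \<partial>N1)"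
      by (rule integral_dominated_convergence[where w = "\<lambda>_. 1"]) (auto simp: sp s intro!: AE_I2)
    moreover have "(\<lambda>n. \<integral>\<mu>. s n \<mu> \<partial>N2) \<longlonglongrightarrow> (\<integral>\<mu>. indicator A \<mu> \<partial>N2)"
      by (rule integral_dominated_convergence[where w = "\<lambda>_. 1"]) (auto simp: sp s intro!: AE_I2)
    ultimately have "(\<integral>\<mu>. indicator A \<mu> \<partial>N1) = (\<integral>\<mu>. indicator A \<mu> \<partial>N2 :: real)"
      using eqs[OF s(1)] LIMSEQ_unique by auto
    moreover have "A \<subseteq> int_valued_measures M"
      using sets.sets_into_space[of A "config_space M"] by (auto simp: space_config_space)
    ultimately show ?thesis
      by (simp add: N1.emeasure_eq_measure N2.emeasure_eq_measure sp Int_absorb2)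
  qed
  show ?thesis
  proof (rule measure_eqI_generator_eq[OF Int_stable_lap_limit_sets _ lim])
    show "lap_limit_sets M \<subseteq> Pow (int_valued_measures M)" by (rule lap_limit_sets_subset)
    show "sets N1 = sigma_sets (int_valued_measures M) (lap_limit_sets M)"
      "sets N2 = sigma_sets (int_valued_measures M) (lap_limit_sets M)"
      by (simp_all add: assms sets_config_space_lap_limit)
    show "range (\<lambda>_. int_valued_measures M) \<subseteq> lap_limit_sets M"
      using space_lap_limit_sets by auto
    show "emeasure N1 (int_valued_measures M) \<noteq> \<infinity>" by simp
  qed auto
qed


section \<open>Approximation in mean square by the span\<close>

lemma nn_integral_square_add_le:
  fixes f g :: "'b \<Rightarrow> real"
  assumes [measurable]: "f \<in> borel_measurable N" "g \<in> borel_measurable N"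
  shows "(\<integral>\<^sup>+x. ennreal ((f x + g x)\<^sup>2) \<partial>N) \<le> 2 * (\<integral>\<^sup>+x. ennreal ((f x)\<^sup>2) \<partial>N) + 2 * (\<integral>\<^sup>+x. ennreal ((g x)\<^sup>2) \<partial>N)"
proof -
  have "(\<integral>\<^sup>+x. ennreal ((f x + g x)\<^sup>2) \<partial>N) \<le> (\<integral>\<^sup>+x. 2 * ennreal ((f x)\<^sup>2) + 2 * ennreal ((g x)\<^sup>2) \<partial>N)"
  proof (rule nn_integral_mono)
    fix x
    have "(f x + g x)\<^sup>2 \<le> 2 * (f x)\<^sup>2 + 2 * (g x)\<^sup>2"
      using zero_le_power2[of "f x - g x"] by (simp add: power2_eq_square algebra_simps)
    then have "ennreal ((f x + g x)\<^sup>2) \<le> ennreal (2 * (f x)\<^sup>2 + 2 * (g x)\<^sup>2)" by (rule ennreal_leI)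
    then show "ennreal ((f x + g x)\<^sup>2) \<le> 2 * ennreal ((f x)\<^sup>2) + 2 * ennreal ((g x)\<^sup>2)"
      by (simp add: ennreal_mult)
  qed
  also have "\<dots> = 2 * (\<integral>\<^sup>+x. ennreal ((f x)\<^sup>2) \<partial>N) + 2 * (\<integral>\<^sup>+x. ennreal ((g x)\<^sup>2) \<partial>N)"
    by (simp add: nn_integral_add nn_integral_cmult)
  finally show ?thesis .
qed

text \<open>Membership in the closure of the span in L^2(N). The nonnegative integral measures the
  error, so closure properties can be proved before any integrability of \<open>f\<close> is
  known.\<close>

definition lap_approx :: "'a measure \<Rightarrow> 'a measure measure \<Rightarrow> ('a measure \<Rightarrow> real) \<Rightarrow> bool" where
  "lap_approx L N f \<longleftrightarrow> (\<forall>e::real>0. \<exists>s\<in>lap_span L. (\<integral>\<^sup>+\<mu>. ennreal ((f \<mu> - s \<mu>)\<^sup>2) \<partial>N) \<le> ennreal e)"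

lemma lap_span_lap_approx: "s \<in> lap_span L \<Longrightarrow> lap_approx L N s"
  unfolding lap_approx_def by (intro allI impI bexI[of _ s]) simp_all

lemma lap_approx_closed:
  assumes N[measurable_cong]: "sets N = sets (config_space L)"
    and [measurable]: "f \<in> borel_measurable (config_space L)"
    and close: "\<And>e::real. e > 0 \<Longrightarrow> \<exists>g\<in>borel_measurable (config_space L). lap_approx L N g \<and> (\<integral>\<^sup>+\<mu>. ennreal ((f \<mu> - g \<mu>)\<^sup>2) \<partial>N) \<le> ennreal e"
  shows "lap_approx L N f"
  unfolding lap_approx_def
proof (intro allI impI)
  fix e :: real assume e: "e > 0"
  \<comment> \<open>The error e / 4 anticipates the factors 2 in (a + b)^2 \<le> 2 a^2 + 2
    b^2.\<close>
  then obtain g where [measurable]: "g \<in> borel_measurable (config_space L)" and g: "lap_approx L N g"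
    "(\<integral>\<^sup>+\<mu>. ennreal ((f \<mu> - g \<mu>)\<^sup>2) \<partial>N) \<le> ennreal (e / 4)"
    using close[of "e / 4"] by auto
  obtain s where s: "s \<in> lap_span L" "(\<integral>\<^sup>+\<mu>. ennreal ((g \<mu> - s \<mu>)\<^sup>2) \<partial>N) \<le> ennreal (e / 4)"
    using g(1) e unfolding lap_approx_def by (metis divide_pos_pos zero_less_numeral)
  have [measurable]: "s \<in> borel_measurable (config_space L)" using s(1) by (rule lap_span_measurable)
  have "(\<integral>\<^sup>+\<mu>. ennreal ((f \<mu> - s \<mu>)\<^sup>2) \<partial>N) = (\<integral>\<^sup>+\<mu>. ennreal (((f \<mu> - g \<mu>) + (g \<mu> - s \<mu>))\<^sup>2) \<partial>N)"
    by simp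
  also have "\<dots> \<le> 2 * (\<integral>\<^sup>+\<mu>. ennreal ((f \<mu> - g \<mu>)\<^sup>2) \<partial>N) + 2 * (\<integral>\<^sup>+\<mu>. ennreal ((g \<mu> - s \<mu>)\<^sup>2) \<partial>N)"
    by (rule nn_integral_square_add_le) measurable
  also have "\<dots> \<le> ennreal 2 * ennreal (e / 4) + ennreal 2 * ennreal (e / 4)"
    using g s by (intro add_mono mult_mono) auto
  also have "\<dots> = ennreal e"
    using e by (simp add: ennreal_mult[symmetric] ennreal_plus[symmetric] del: ennreal_plus ennreal_numeral)
  finally show "\<exists>s\<in>lap_span L. (\<integral>\<^sup>+\<mu>. ennreal ((f \<mu> - s \<mu>)\<^sup>2) \<partial>N) \<le> ennreal e"
    using s(1) by blast
qed

lemma lap_approx_add: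
  assumes N[measurable_cong]: "sets N = sets (config_space L)"
    and [measurable]: "f \<in> borel_measurable (config_space L)" "g \<in> borel_measurable (config_space L)"
    and f: "lap_approx L N f" and g: "lap_approx L N g"
  shows "lap_approx L N (\<lambda>\<mu>. f \<mu> + g \<mu>)"
  unfolding lap_approx_def
proof (intro allI impI)
  fix e :: real assume "e > 0"
  then have e: "e / 4 > 0" by simp
  obtain s where s: "s \<in> lap_span L" "(\<integral>\<^sup>+\<mu>. ennreal ((f \<mu> - s \<mu>)\<^sup>2) \<partial>N) \<le> ennreal (e / 4)"
    using f e unfolding lap_approx_def by metis
  obtain t where t: "t \<in> lap_span L" "(\<integral>\<^sup>+\<mu>. ennreal ((g \<mu> - t \<mu>)\<^sup>2) \<partial>N) \<le> ennreal (e / 4)"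
    using g e unfolding lap_approx_def by metis
  have [measurable]: "s \<in> borel_measurable (config_space L)" "t \<in> borel_measurable (config_space L)"
    using s(1) t(1) by (auto intro: lap_span_measurable)
  have "(\<integral>\<^sup>+\<mu>. ennreal ((f \<mu> + g \<mu> - (s \<mu> + t \<mu>))\<^sup>2) \<partial>N) = (\<integral>\<^sup>+\<mu>. ennreal (((f \<mu> - s \<mu>) + (g \<mu> - t \<mu>))\<^sup>2) \<partial>N)"
    by (simp add: algebra_simps)
  also have "\<dots> \<le> 2 * (\<integral>\<^sup>+\<mu>. ennreal ((f \<mu> - s \<mu>)\<^sup>2) \<partial>N) + 2 * (\<integral>\<^sup>+\<mu>. ennreal ((g \<mu> - t \<mu>)\<^sup>2) \<partial>N)"
    by (rule nn_integral_square_add_le) measurable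
  also have "\<dots> \<le> ennreal 2 * ennreal (e / 4) + ennreal 2 * ennreal (e / 4)"
    using s t by (intro add_mono mult_mono) auto
  also have "\<dots> = ennreal e"
    using \<open>e > 0\<close> by (simp add: ennreal_mult[symmetric] ennreal_plus[symmetric] del: ennreal_plus ennreal_numeral)
  finally show "\<exists>s\<in>lap_span L. (\<integral>\<^sup>+\<mu>. ennreal ((f \<mu> + g \<mu> - s \<mu>)\<^sup>2) \<partial>N) \<le> ennreal e"
    by (intro bexI[of _ "\<lambda>\<mu>. s \<mu> + t \<mu>"] lap_span.add s t)
qed

lemma lap_approx_scale:
  assumes N[measurable_cong]: "sets N = sets (config_space L)"
    and [measurable]: "f \<in> borel_measurable (config_space L)"
    and f: "lap_approx L N f"
  shows "lap_approx L N (\<lambda>\<mu>. c * f \<mu>)"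
  unfolding lap_approx_def
proof (intro allI impI)
  fix e :: real assume e: "e > 0"
  \<comment> \<open>Dividing the error by 1 + c^2 rather than c^2 includes the case c = 0.\<close>
  have c: "1 + c\<^sup>2 > 0" by (simp add: add_pos_nonneg)
  obtain s where s: "s \<in> lap_span L" "(\<integral>\<^sup>+\<mu>. ennreal ((f \<mu> - s \<mu>)\<^sup>2) \<partial>N) \<le> ennreal (e / (1 + c\<^sup>2))"
    using f e c unfolding lap_approx_def by (metis divide_pos_pos)
  have [measurable]: "s \<in> borel_measurable (config_space L)"
    using s(1) by (rule lap_span_measurable)
  have "(\<integral>\<^sup>+\<mu>. ennreal ((c * f \<mu> - c * s \<mu>)\<^sup>2) \<partial>N) = (\<integral>\<^sup>+\<mu>. ennreal (c\<^sup>2) * ennreal ((f \<mu> - s \<mu>)\<^sup>2) \<partial>N)"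
    by (simp add: right_diff_distrib[symmetric] power_mult_distrib ennreal_mult)
  also have "\<dots> = ennreal (c\<^sup>2) * (\<integral>\<^sup>+\<mu>. ennreal ((f \<mu> - s \<mu>)\<^sup>2) \<partial>N)"
    by (rule nn_integral_cmult) measurable
  also have "\<dots> \<le> ennreal (c\<^sup>2) * ennreal (e / (1 + c\<^sup>2))"
    by (intro mult_left_mono s) simp
  also have "\<dots> \<le> ennreal e"
    using e c by (simp add: ennreal_mult[symmetric] field_simps)
  finally show "\<exists>s\<in>lap_span L. (\<integral>\<^sup>+\<mu>. ennreal ((c * f \<mu> - s \<mu>)\<^sup>2) \<partial>N) \<le> ennreal e"
    by (intro bexI[of _ "\<lambda>\<mu>. c * s \<mu>"] lap_span.scale s)
qed

lemma ex_le_ennreal_of_tendsto_0: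
  fixes f :: "nat \<Rightarrow> ennreal"
  assumes "f \<longlonglongrightarrow> 0" "e > 0"
  shows "\<exists>n. f n \<le> ennreal e"
proof -
  have "eventually (\<lambda>n. f n < ennreal e) sequentially"
    using assms by (intro order_tendstoD(2)[OF assms(1)]) simp
  then show ?thesis by (auto simp: eventually_sequentially intro: less_imp_le)
qed

text \<open>Induction over the \<sigma>-field generated by a \<pi>-system: bounded convergence
  settles the generators, constants in the span settle complements, and the partial sums of a
  disjoint union converge in mean square because \<open>N\<close> is finite.\<close>

lemma (in sigma_finite_measure) lap_approx_indicator:
  assumes "finite_measure N" and N[measurable_cong]: "sets N = sets (config_space M)"
    and A: "A \<in> sets (config_space M)"
  shows "lap_approx M N (indicator A)"
proof -
  interpret N: finite_measure N by fact
  have sp: "space N = int_valued_measures M"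
    using sets_eq_imp_space_eq[OF N] by (simp add: space_config_space)
  from A have "A \<in> sigma_sets (int_valued_measures M) (lap_limit_sets M)"
    by (simp add: sets_config_space_lap_limit)
  with Int_stable_lap_limit_sets lap_limit_sets_subset show ?thesis
  proof (induct rule: sigma_sets_induct_disjoint)
    case (basic A)
    then obtain s where s: "\<And>n. s n \<in> lap_span M" "\<And>n \<mu>. \<mu> \<in> int_valued_measures M \<Longrightarrow> \<bar>s n \<mu>\<bar> \<le> 1"
      "\<And>\<mu>. \<mu> \<in> int_valued_measures M \<Longrightarrow> (\<lambda>n. s n \<mu>) \<longlonglongrightarrow> indicator A \<mu>"
      and A[measurable]: "A \<in> sets (config_space M)"
      unfolding lap_limit_sets_def by blast
    have [measurable]: "s n \<in> borel_measurable (config_space M)" for n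
      using s(1) by (rule lap_span_measurable)
    have bound: "ennreal ((indicator A \<mu> - s n \<mu>)\<^sup>2) \<le> 4" if "\<mu> \<in> int_valued_measures M" for n \<mu>
    proof -
      have "\<bar>indicator A \<mu> - s n \<mu>\<bar> \<le> 2"
        using s(2)[OF that, of n] by (auto simp: indicator_def)
      then have "(indicator A \<mu> - s n \<mu>)\<^sup>2 \<le> 2\<^sup>2" by (simp only: abs_le_square_iff[symmetric] abs_numeral)
      then have "(indicator A \<mu> - s n \<mu>)\<^sup>2 \<le> 4" by simp
      then have "ennreal ((indicator A \<mu> - s n \<mu>)\<^sup>2) \<le> ennreal 4" by (rule ennreal_leI)
      then show ?thesis by simp
    qed
    have "(\<lambda>n. \<integral>\<^sup>+\<mu>. ennreal ((indicator A \<mu> - s n \<mu>)\<^sup>2) \<partial>N) \<longlonglongrightarrow> (\<integral>\<^sup>+\<mu>. 0 \<partial>N)"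
    proof (rule nn_integral_dominated_convergence[where w = "\<lambda>_. 4"])
      show "AE \<mu> in N. (\<lambda>n. ennreal ((indicator A \<mu> - s n \<mu>)\<^sup>2)) \<longlonglongrightarrow> 0"
      proof (rule AE_I2)
        fix \<mu> assume "\<mu> \<in> space N"
        then have "(\<lambda>n. ennreal ((indicator A \<mu> - s n \<mu>)\<^sup>2)) \<longlonglongrightarrow> ennreal ((indicator A \<mu> - indicator A \<mu>)\<^sup>2)"
          using s(3)[of \<mu>] sp by (intro tendsto_ennrealI tendsto_intros) auto
        then show "(\<lambda>n. ennreal ((indicator A \<mu> - s n \<mu>)\<^sup>2)) \<longlonglongrightarrow> 0" by simp
      qed
      show "(\<integral>\<^sup>+\<mu>. 4 \<partial>N) < \<infinity>" by (simp add: N.emeasure_eq_measure ennreal_mult_less_top)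
    qed (auto intro!: AE_I2 bound simp: sp)
    then have lim: "(\<lambda>n. \<integral>\<^sup>+\<mu>. ennreal ((indicator A \<mu> - s n \<mu>)\<^sup>2) \<partial>N) \<longlonglongrightarrow> 0" by simp
    show ?case
      unfolding lap_approx_def
    proof (intro allI impI)
      fix e :: real assume "e > 0"
      then obtain n where "(\<integral>\<^sup>+\<mu>. ennreal ((indicator A \<mu> - s n \<mu>)\<^sup>2) \<partial>N) \<le> ennreal e"
        using ex_le_ennreal_of_tendsto_0[OF lim] by blast
      then show "\<exists>s\<in>lap_span M. (\<integral>\<^sup>+\<mu>. ennreal ((indicator A \<mu> - s \<mu>)\<^sup>2) \<partial>N) \<le> ennreal e"
        using s(1) by blast
    qed
  next
    case empty
    then show ?case using lap_span_lap_approx[OF lap_span_const[of 0]] by (simp add: indicator_def)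
  next
    case (compl A)
    then have [measurable]: "A \<in> sets (config_space M)" by (simp add: sets_config_space_lap_limit)
    have "lap_approx M N (\<lambda>\<mu>. 1 + (-1) * indicator A \<mu>)"
      by (intro lap_approx_add lap_approx_scale N lap_span_lap_approx lap_span_const compl) measurable
    moreover have "(\<integral>\<^sup>+\<mu>. ennreal ((1 + (-1) * indicator A \<mu> - s \<mu>)\<^sup>2) \<partial>N) =
        (\<integral>\<^sup>+\<mu>. ennreal ((indicator (int_valued_measures M - A) \<mu> - s \<mu>)\<^sup>2) \<partial>N)" for s
      by (intro nn_integral_cong) (auto simp: sp indicator_def)
    ultimately show ?case unfolding lap_approx_def by simp
  next
    case (union A)
    then have [measurable]: "A n \<in> sets (config_space M)" for n by (auto simp: sets_config_space_lap_limit)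
    let ?g = "\<lambda>n \<mu>. \<Sum>i<n. indicator (A i) \<mu> :: real"
    have g: "lap_approx M N (?g n)" for n
    proof (induct n)
      case 0
      then show ?case using lap_span_lap_approx[OF lap_span_const[of 0]] by simp
    next
      case (Suc n)
      show ?case unfolding sum.lessThan_Suc
        by (rule lap_approx_add[OF N _ _ Suc union(3)]) measurable
    qed
    have g_eq: "?g n \<mu> = indicator (\<Union>i<n. A i) \<mu>" for n \<mu>
      using union(1) by (intro indicator_UN_disjoint[symmetric]) (auto intro: disjoint_family_on_mono)
    have "(\<lambda>n. \<integral>\<^sup>+\<mu>. ennreal ((indicator (\<Union>i. A i) \<mu> - ?g n \<mu>)\<^sup>2) \<partial>N) \<longlonglongrightarrow> (\<integral>\<^sup>+\<mu>. 0 \<partial>N)"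
    proof (rule nn_integral_dominated_convergence[where w = "\<lambda>_. 1"])
      have "eventually (\<lambda>n. ennreal ((indicator (\<Union>i. A i) \<mu> - ?g n \<mu>)\<^sup>2) = 0) sequentially" for \<mu>
      proof (cases "\<mu> \<in> (\<Union>i. A i)")
        case True
        then obtain i where "\<mu> \<in> A i" by auto
        then show ?thesis using True unfolding g_eq
          by (intro eventually_sequentiallyI[of "Suc i"]) (auto simp: indicator_def Suc_le_eq)
      qed (auto simp: g_eq indicator_def)
      then show "AE \<mu> in N. (\<lambda>n. ennreal ((indicator (\<Union>i. A i) \<mu> - ?g n \<mu>)\<^sup>2)) \<longlonglongrightarrow> 0"
        by (intro AE_I2 tendsto_eventually)
      show "(\<integral>\<^sup>+\<mu>. 1 \<partial>N) < \<infinity>" by (simp add: N.emeasure_eq_measure)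
      show "AE \<mu> in N. ennreal ((indicator (\<Union>i. A i) \<mu> - ?g n \<mu>)\<^sup>2) \<le> 1" for n
        unfolding g_eq by (intro AE_I2) (auto simp: indicator_def)
    qed measurable
    then have lim: "(\<lambda>n. \<integral>\<^sup>+\<mu>. ennreal ((indicator (\<Union>i. A i) \<mu> - ?g n \<mu>)\<^sup>2) \<partial>N) \<longlonglongrightarrow> 0" by simp
    show ?case
    proof (rule lap_approx_closed[OF N])
      fix e :: real assume "e > 0"
      then obtain n where "(\<integral>\<^sup>+\<mu>. ennreal ((indicator (\<Union>i. A i) \<mu> - ?g n \<mu>)\<^sup>2) \<partial>N) \<le> ennreal e"
        using ex_le_ennreal_of_tendsto_0[OF lim] by blast
      then show "\<exists>g\<in>borel_measurable (config_space M). lap_approx M N g \<and>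
          (\<integral>\<^sup>+\<mu>. ennreal ((indicator (\<Union>i. A i) \<mu> - g \<mu>)\<^sup>2) \<partial>N) \<le> ennreal e"
        by (intro bexI[of _ "?g n"] conjI g) auto
    qed measurable
  qed
qed

lemma (in sigma_finite_measure) lap_approx_L2:
  assumes fin: "finite_measure N" and N[measurable_cong]: "sets N = sets (config_space M)"
    and f[measurable]: "f \<in> borel_measurable (config_space M)"
    and second_moment: "integrable N (\<lambda>\<mu>. (f \<mu>)\<^sup>2)"
  shows "lap_approx M N f"
proof -
  have "f \<in> borel_measurable N" by measurable
  from borel_measurable_implies_sequence_metric[OF this, of 0] obtain F
    where F0: "\<forall>i. simple_function N (F i)" "\<forall>x\<in>space N. (\<lambda>i. F i x) \<longlonglongrightarrow> f x"
      "\<forall>i. \<forall>x\<in>space N. dist (F i x) 0 \<le> 2 * dist (f x) 0"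
    by blast
  then have F: "\<And>i. simple_function N (F i)" "\<And>x. x \<in> space N \<Longrightarrow> (\<lambda>i. F i x) \<longlonglongrightarrow> f x"
    "\<And>i x. x \<in> space N \<Longrightarrow> norm (F i x) \<le> 2 * norm (f x)"
    by auto
  have [measurable]: "F i \<in> borel_measurable (config_space M)" for i
    using borel_measurable_simple_function[OF F(1)[of i]] measurable_cong_sets[OF N refl, of borel] by simp
  have approx: "lap_approx M N (F i)" for i
  proof -
    have sum: "lap_approx M N (\<lambda>\<mu>. \<Sum>y\<in>Y. y * indicator (F i -` {y} \<inter> space N) \<mu>)" if "finite Y" for Y
      using that
    proof induct
      case empty
      then show ?case using lap_span_lap_approx[OF lap_span_const[of 0]] by simp
    next
      case (insert y Y)
      have [measurable]: "F i -` {y} \<inter> space N \<in> sets (config_space M)" for y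
        using simple_functionD(2)[OF F(1)] N by simp
      show ?case unfolding sum.insert[OF insert(1,2)]
        by (intro lap_approx_add lap_approx_scale N insert lap_approx_indicator fin) measurable
    qed
    have rep: "(\<Sum>y\<in>F i ` space N. y * indicator (F i -` {y} \<inter> space N) \<mu>) = F i \<mu>"
      if "\<mu> \<in> space N" for \<mu>
      by (subst simple_function_indicator_representation_banach[OF F(1) that])
         (intro sum.cong refl, simp add: mult.commute)
    have "lap_approx M N (\<lambda>\<mu>. \<Sum>y\<in>F i ` space N. y * indicator (F i -` {y} \<inter> space N) \<mu>)"
      by (rule sum) (rule simple_functionD(1)[OF F(1)])
    moreover have "(\<integral>\<^sup>+\<mu>. ennreal (((\<Sum>y\<in>F i ` space N. y * indicator (F i -` {y} \<inter> space N) \<mu>) - s \<mu>)\<^sup>2) \<partial>N) =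
        (\<integral>\<^sup>+\<mu>. ennreal ((F i \<mu> - s \<mu>)\<^sup>2) \<partial>N)" for s
      by (intro nn_integral_cong) (simp only: rep)
    ultimately show ?thesis unfolding lap_approx_def by simp
  qed
  have "(\<lambda>n. \<integral>\<^sup>+\<mu>. ennreal ((f \<mu> - F n \<mu>)\<^sup>2) \<partial>N) \<longlonglongrightarrow> (\<integral>\<^sup>+\<mu>. 0 \<partial>N)"
  proof (rule nn_integral_dominated_convergence[where w = "\<lambda>\<mu>. ennreal (9 * (f \<mu>)\<^sup>2)"])
    show "AE \<mu> in N. (\<lambda>n. ennreal ((f \<mu> - F n \<mu>)\<^sup>2)) \<longlonglongrightarrow> 0"
    proof (rule AE_I2)
      fix \<mu> assume "\<mu> \<in> space N"
      then have "(\<lambda>n. ennreal ((f \<mu> - F n \<mu>)\<^sup>2)) \<longlonglongrightarrow> ennreal ((f \<mu> - f \<mu>)\<^sup>2)"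
        by (intro tendsto_ennrealI tendsto_intros F(2))
      then show "(\<lambda>n. ennreal ((f \<mu> - F n \<mu>)\<^sup>2)) \<longlonglongrightarrow> 0" by simp
    qed
    have "integrable N (\<lambda>\<mu>. 9 * (f \<mu>)\<^sup>2)" using second_moment by simp
    then show "(\<integral>\<^sup>+\<mu>. ennreal (9 * (f \<mu>)\<^sup>2) \<partial>N) < \<infinity>"
      by (subst nn_integral_eq_integral) auto
    \<comment> \<open>The simple functions satisfy |F n| \<le> 2 |f|, hence |f - F n| \<le> 3 |f|;
      squaring gives the constant 9.\<close>
    show "AE \<mu> in N. ennreal ((f \<mu> - F n \<mu>)\<^sup>2) \<le> ennreal (9 * (f \<mu>)\<^sup>2)" for n
    proof (intro AE_I2 ennreal_leI)
      fix \<mu> assume "\<mu> \<in> space N"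
      then have "\<bar>f \<mu> - F n \<mu>\<bar> \<le> \<bar>3 * f \<mu>\<bar>" using F(3)[of \<mu> n] by simp
      then show "(f \<mu> - F n \<mu>)\<^sup>2 \<le> 9 * (f \<mu>)\<^sup>2"
        unfolding abs_le_square_iff by (simp add: power_mult_distrib)
    qed
  qed measurable
  then have lim: "(\<lambda>n. \<integral>\<^sup>+\<mu>. ennreal ((f \<mu> - F n \<mu>)\<^sup>2) \<partial>N) \<longlonglongrightarrow> 0" by simp
  show ?thesis
  proof (rule lap_approx_closed[OF N f])
    fix e :: real assume "e > 0"
    then obtain n where "(\<integral>\<^sup>+\<mu>. ennreal ((f \<mu> - F n \<mu>)\<^sup>2) \<partial>N) \<le> ennreal e"
      using ex_le_ennreal_of_tendsto_0[OF lim] by blast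
    then show "\<exists>g\<in>borel_measurable (config_space M). lap_approx M N g \<and>
        (\<integral>\<^sup>+\<mu>. ennreal ((f \<mu> - g \<mu>)\<^sup>2) \<partial>N) \<le> ennreal e"
      by (intro bexI[of _ "F n"] conjI approx) auto
  qed
qed

section \<open>The Mecke formula\<close>

text \<open>A difference quotient at 0 with step t = 1 / (n + 1). Here it is taken of the Laplace
  transform of a Poisson variable with mean c, in the next lemma of that of the constant c.\<close>

lemma tendsto_difference_quotient_exp:
  fixes c :: real
  shows "(\<lambda>n. real (Suc n) * (1 - exp (- ((1 - exp (- (1 / real (Suc n)))) * c)))) \<longlonglongrightarrow> c"
  by real_asymp

lemma tendsto_difference_quotient_exp1:
  fixes c :: real
  shows "(\<lambda>n. real (Suc n) * (1 - exp (- (1 / real (Suc n) * c)))) \<longlonglongrightarrow> c"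
  by real_asymp

lemma difference_quotient_exp_le:
  fixes c :: real
  shows "real (Suc n) * (1 - exp (- (1 / real (Suc n) * c))) \<le> c"
proof -
  have "1 - exp (- (1 / real (Suc n) * c)) \<le> 1 / real (Suc n) * c"
    using exp_ge_add_one_self[of "- (1 / real (Suc n) * c)"] by simp
  then have "real (Suc n) * (1 - exp (- (1 / real (Suc n) * c))) \<le> real (Suc n) * (1 / real (Suc n) * c)"
    by (intro mult_left_mono) auto
  then show ?thesis by simp
qed

context poisson begin

text \<open>Adding t on \<open>B\<close> increases 1 - exp (- h) by (1 - exp (- t)) exp (- h) there,
  so \<open>laplace\<close> contributes one further exponential factor. Differentiating in t at 0
  will bring down the number of points in \<open>B\<close>.\<close>

lemma integral_lap_add_indicator:
  assumes h: "h \<in> lap_funs L" and B[measurable]: "B \<in> sets L" and fin: "emeasure L B < \<infinity>" and t: "0 \<le> t"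
  shows "(\<integral>\<omega>. lap (\<lambda>z. h z + ennreal t * indicator B z) (\<eta> \<omega>) \<partial>P) =
     (\<integral>\<omega>. lap h (\<eta> \<omega>) \<partial>P) * exp (- ((1 - exp (- t)) * (\<integral>z\<in>B. exp_neg (h z) \<partial>L)))"
proof -
  have [measurable]: "h \<in> borel_measurable L" using h by (rule lap_funs_measurable)
  have e: "exp (- t) \<le> 1" using t by simp
  have "ennreal (1 - exp_neg (h z + ennreal t * indicator B z)) =
      ennreal (1 - exp_neg (h z)) + ennreal (1 - exp (- t)) * (ennreal (exp_neg (h z)) * indicator B z)" for z
  proof (cases "z \<in> B")
    case True
    have "ennreal (1 - exp_neg (h z + ennreal t * indicator B z)) =
        ennreal ((1 - exp_neg (h z)) + (1 - exp (- t)) * exp_neg (h z))"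
      using True t by (simp add: exp_neg_add exp_neg_ennreal algebra_simps)
    also have "\<dots> = ennreal (1 - exp_neg (h z)) + ennreal ((1 - exp (- t)) * exp_neg (h z))"
      using e by (intro ennreal_plus) auto
    finally show ?thesis
      using True e by (simp add: ennreal_mult)
  qed simp
  then have "(\<integral>\<^sup>+z. ennreal (1 - exp_neg (h z + ennreal t * indicator B z)) \<partial>L) =
      (\<integral>\<^sup>+z. ennreal (1 - exp_neg (h z)) + ennreal (1 - exp (- t)) * (ennreal (exp_neg (h z)) * indicator B z) \<partial>L)"
    by simp
  also have "\<dots> = (\<integral>\<^sup>+z. ennreal (1 - exp_neg (h z)) \<partial>L) + ennreal (1 - exp (- t)) * (\<integral>\<^sup>+z\<in>B. ennreal (exp_neg (h z)) \<partial>L)"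
    by (simp add: nn_integral_add nn_integral_cmult)
  also have "(\<integral>\<^sup>+z\<in>B. ennreal (exp_neg (h z)) \<partial>L) = ennreal (\<integral>z\<in>B. exp_neg (h z) \<partial>L)"
  proof -
    have "set_integrable L B (\<lambda>z. exp_neg (h z))"
      unfolding set_integrable_def
      by (rule Bochner_Integration.integrable_bound[of _ "indicator B"]) (use fin in \<open>auto simp: indicator_def\<close>)
    then show ?thesis
      unfolding set_lebesgue_integral_def set_integrable_def
      by (subst nn_integral_eq_integral[symmetric]) (auto intro!: nn_integral_cong simp: indicator_def)
  qed
  finally show ?thesis
    using e by (simp add: laplace exp_neg_add exp_neg_ennreal set_lebesgue_integral_def flip: ennreal_mult)
qed

text \<open>The quotients (1 - exp (- t N)) / t converge to the count N as t tends to 0 and their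
  means are explicit, so Fatou's lemma bounds the mean of N.\<close>

lemma integral_count:
  assumes B[measurable]: "B \<in> sets L" and fin: "emeasure L B < \<infinity>"
  shows "AE \<omega> in P. emeasure (\<eta> \<omega>) B < \<infinity>" "integrable P (\<lambda>\<omega>. measure (\<eta> \<omega>) B)"
proof -
  define c where "c = (\<integral>z\<in>B. exp_neg 0 \<partial>L)"
  let ?f = "\<lambda>n \<omega>. ennreal (real (Suc n) * (1 - exp_neg (ennreal (1 / real (Suc n)) * emeasure (\<eta> \<omega>) B)))"
  have lap: "lap (\<lambda>z. ennreal t * indicator B z) (\<eta> \<omega>) = exp_neg (ennreal t * emeasure (\<eta> \<omega>) B)" if "\<omega> \<in> space P" for t \<omega>
    using config_spaceD(1)[OF eta_config[OF that]] by (simp add: lap_def nn_integral_cmult_indicator)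
  have eq: "(\<integral>\<^sup>+\<omega>. ?f n \<omega> \<partial>P) = ennreal (real (Suc n) * (1 - exp (- ((1 - exp (- (1 / real (Suc n)))) * c))))" for n
  proof -
    have "(\<integral>\<omega>. exp_neg (ennreal (1 / real (Suc n)) * emeasure (\<eta> \<omega>) B) \<partial>P) =
        (\<integral>\<omega>. lap (\<lambda>z. 0 + ennreal (1 / real (Suc n)) * indicator B z) (\<eta> \<omega>) \<partial>P)"
      by (intro Bochner_Integration.integral_cong) (simp_all add: lap)
    also have "\<dots> = exp (- ((1 - exp (- (1 / real (Suc n)))) * c))"
      by (subst integral_lap_add_indicator[OF lap_funs_zero B fin]) (simp_all add: c_def lap_def prob_space)
    finally have *: "(\<integral>\<omega>. exp_neg (ennreal (1 / real (Suc n)) * emeasure (\<eta> \<omega>) B) \<partial>P) = exp (- ((1 - exp (- (1 / real (Suc n)))) * c))" .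
    have int: "integrable P (\<lambda>\<omega>. exp_neg (ennreal (1 / real (Suc n)) * emeasure (\<eta> \<omega>) B))"
      by (rule integrable_const_bound[of _ 1]) auto
    have "(\<integral>\<^sup>+\<omega>. ?f n \<omega> \<partial>P) = ennreal (\<integral>\<omega>. real (Suc n) * (1 - exp_neg (ennreal (1 / real (Suc n)) * emeasure (\<eta> \<omega>) B)) \<partial>P)"
      using int by (intro nn_integral_eq_integral) auto
    also have "(\<integral>\<omega>. real (Suc n) * (1 - exp_neg (ennreal (1 / real (Suc n)) * emeasure (\<eta> \<omega>) B)) \<partial>P)
       = real (Suc n) * (1 - exp (- ((1 - exp (- (1 / real (Suc n)))) * c)))"
      using int by (simp add: * prob_space del: of_nat_Suc)
    finally show ?thesis .
  qed
  \<comment> \<open>The limit is valid for an infinite count too, where the quotient equals n + 1.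
    This is what lets finiteness of the count be deduced instead of presupposed.\<close>
  have lim_f: "(\<lambda>n. ?f n \<omega>) \<longlonglongrightarrow> emeasure (\<eta> \<omega>) B" for \<omega>
  proof (cases "emeasure (\<eta> \<omega>) B")
    case (real r)
    have "(\<lambda>n. ennreal (real (Suc n) * (1 - exp (- (1 / real (Suc n) * r))))) \<longlonglongrightarrow> ennreal r"
      by (intro tendsto_ennrealI tendsto_difference_quotient_exp1)
    then show ?thesis using real
      by (simp add: ennreal_mult[symmetric] exp_neg_ennreal del: of_nat_Suc)
  next
    case top
    have "ennreal (1 / real (Suc n)) \<noteq> 0" for n by simp
    then have "?f n \<omega> = of_nat (Suc n)" for n
      using top by (simp add: ennreal_mult_top ennreal_of_nat_eq_real_of_nat del: of_nat_Suc)
    moreover have "(\<lambda>n. of_nat (Suc n) :: ennreal) \<longlonglongrightarrow> \<infinity>"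
      using LIMSEQ_Suc[OF of_nat_tendsto_top_ennreal] by simp
    ultimately show ?thesis using top by simp
  qed
  have "(\<integral>\<^sup>+\<omega>. emeasure (\<eta> \<omega>) B \<partial>P) = (\<integral>\<^sup>+\<omega>. liminf (\<lambda>n. ?f n \<omega>) \<partial>P)"
    by (intro nn_integral_cong) (metis lim_f lim_imp_Liminf sequentially_bot)
  also have "\<dots> \<le> liminf (\<lambda>n. \<integral>\<^sup>+\<omega>. ?f n \<omega> \<partial>P)"
    by (intro nn_integral_liminf) measurable
  also have "\<dots> = ennreal c"
    unfolding eq by (intro lim_imp_Liminf tendsto_ennrealI tendsto_difference_quotient_exp) simp
  finally have le: "(\<integral>\<^sup>+\<omega>. emeasure (\<eta> \<omega>) B \<partial>P) \<le> ennreal c" .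
  then have "(\<integral>\<^sup>+\<omega>. emeasure (\<eta> \<omega>) B \<partial>P) \<noteq> \<infinity>" by (auto simp: top_unique)
  then show AE: "AE \<omega> in P. emeasure (\<eta> \<omega>) B < \<infinity>"
    using nn_integral_PInf_AE[of "\<lambda>\<omega>. emeasure (\<eta> \<omega>) B" P] by (auto simp: less_top)
  have [measurable]: "(\<lambda>\<omega>. measure (\<eta> \<omega>) B) \<in> borel_measurable P"
    unfolding measure_def by measurable
  have "(\<integral>\<^sup>+\<omega>. ennreal (measure (\<eta> \<omega>) B) \<partial>P) = (\<integral>\<^sup>+\<omega>. emeasure (\<eta> \<omega>) B \<partial>P)"
    using AE by (intro nn_integral_cong_AE) (auto simp: emeasure_eq_ennreal_measure)
  then show "integrable P (\<lambda>\<omega>. measure (\<eta> \<omega>) B)"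
    using le by (intro integrableI_bounded) (auto intro: le_less_trans)
qed

text \<open>Both sides are minus the derivative at t = 0 of the mean of
  \<open>lap (h + t 1_B)\<close>. The difference quotients are dominated by the count in
  \<open>B\<close>, which is integrable.\<close>

lemma integral_lap_count:
  assumes h: "h \<in> lap_funs L" and B[measurable]: "B \<in> sets L" and fin: "emeasure L B < \<infinity>"
  shows "(\<integral>\<omega>. measure (\<eta> \<omega>) B * lap h (\<eta> \<omega>) \<partial>P) = (\<integral>\<omega>. lap h (\<eta> \<omega>) \<partial>P) * (\<integral>z\<in>B. exp_neg (h z) \<partial>L)"
proof -
  have [measurable]: "h \<in> borel_measurable L" using h by (rule lap_funs_measurable)
  define c where "c = (\<integral>z\<in>B. exp_neg (h z) \<partial>L)"
  define \<Phi> where "\<Phi> = (\<integral>\<omega>. lap h (\<eta> \<omega>) \<partial>P)"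
  have [measurable]: "(\<lambda>\<omega>. measure (\<eta> \<omega>) B) \<in> borel_measurable P"
    unfolding measure_def by measurable
  let ?k = "\<lambda>n z. h z + ennreal (1 / real (Suc n)) * indicator B z"
  let ?f = "\<lambda>n \<omega>. real (Suc n) * (lap h (\<eta> \<omega>) - lap (?k n) (\<eta> \<omega>))"
  have AE: "AE \<omega> in P. \<forall>n. ?f n \<omega> = real (Suc n) * (1 - exp (- (1 / real (Suc n) * measure (\<eta> \<omega>) B))) * lap h (\<eta> \<omega>)"
    using integral_count(1)[OF B fin] AE_space
  proof eventually_elim
    case (elim \<omega>)
    then have c: "\<eta> \<omega> \<in> int_valued_measures L" by (intro eta_config)
    have [simp]: "B \<in> sets (\<eta> \<omega>)" using config_spaceD(1)[OF c] by simp
    have "lap (?k n) (\<eta> \<omega>) = lap h (\<eta> \<omega>) * lap (\<lambda>z. ennreal (1 / real (Suc n)) * indicator B z) (\<eta> \<omega>)" for n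
      using c by (intro lap_add_fun) auto
    moreover have "lap (\<lambda>z. ennreal (1 / real (Suc n)) * indicator B z) (\<eta> \<omega>) = exp (- (1 / real (Suc n) * measure (\<eta> \<omega>) B))" for n
    proof -
      have "lap (\<lambda>z. ennreal (1 / real (Suc n)) * indicator B z) (\<eta> \<omega>) = exp_neg (ennreal (1 / real (Suc n)) * ennreal (measure (\<eta> \<omega>) B))"
        using elim unfolding lap_def
        by (subst nn_integral_cmult_indicator) (auto simp: emeasure_eq_ennreal_measure)
      also have "\<dots> = exp (- (1 / real (Suc n) * measure (\<eta> \<omega>) B))"
        by (subst ennreal_mult[symmetric]) (auto intro!: exp_neg_ennreal)
      finally show ?thesis .
    qed
    ultimately show ?case by (simp add: algebra_simps del: of_nat_Suc)
  qed
  have lim: "(\<lambda>n. \<integral>\<omega>. ?f n \<omega> \<partial>P) \<longlonglongrightarrow> (\<integral>\<omega>. measure (\<eta> \<omega>) B * lap h (\<eta> \<omega>) \<partial>P)"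
  proof (rule integral_dominated_convergence[where w = "\<lambda>\<omega>. measure (\<eta> \<omega>) B"])
    show "integrable P (\<lambda>\<omega>. measure (\<eta> \<omega>) B)" by (rule integral_count[OF B fin])
    show "AE \<omega> in P. (\<lambda>n. ?f n \<omega>) \<longlonglongrightarrow> measure (\<eta> \<omega>) B * lap h (\<eta> \<omega>)"
      using AE
    proof eventually_elim
      case (elim \<omega>)
      show ?case unfolding elim[rule_format]
        by (intro tendsto_mult tendsto_const tendsto_difference_quotient_exp1)
    qed
    show "AE \<omega> in P. norm (?f n \<omega>) \<le> measure (\<eta> \<omega>) B" for n
      using AE
    proof eventually_elim
      case (elim \<omega>)
      have "0 \<le> real (Suc n) * (1 - exp (- (1 / real (Suc n) * measure (\<eta> \<omega>) B)))"
        by (intro mult_nonneg_nonneg) auto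
      then have "norm (?f n \<omega>) \<le> real (Suc n) * (1 - exp (- (1 / real (Suc n) * measure (\<eta> \<omega>) B)))"
        unfolding elim[rule_format] by (simp add: abs_mult mult_left_le del: of_nat_Suc)
      also have "\<dots> \<le> measure (\<eta> \<omega>) B" by (rule difference_quotient_exp_le)
      finally show ?case .
    qed
  qed measurable
  have eq: "(\<integral>\<omega>. ?f n \<omega> \<partial>P) = \<Phi> * (real (Suc n) * (1 - exp (- ((1 - exp (- (1 / real (Suc n)))) * c))))" for n
  proof -
    have "integrable P (\<lambda>\<omega>. lap h (\<eta> \<omega>))" "integrable P (\<lambda>\<omega>. lap (?k n) (\<eta> \<omega>))"
      by (auto intro!: integrable_const_bound[of _ 1])
    then have "(\<integral>\<omega>. ?f n \<omega> \<partial>P) = real (Suc n) * (\<Phi> - (\<integral>\<omega>. lap (?k n) (\<eta> \<omega>) \<partial>P))"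
      by (simp add: \<Phi>_def del: of_nat_Suc)
    also have "(\<integral>\<omega>. lap (?k n) (\<eta> \<omega>) \<partial>P) = \<Phi> * exp (- ((1 - exp (- (1 / real (Suc n)))) * c))"
      unfolding \<Phi>_def c_def by (rule integral_lap_add_indicator[OF h B fin]) simp
    finally show ?thesis by (simp add: algebra_simps del: of_nat_Suc)
  qed
  have "(\<lambda>n. \<Phi> * (real (Suc n) * (1 - exp (- ((1 - exp (- (1 / real (Suc n)))) * c))))) \<longlonglongrightarrow> \<Phi> * c"
    by (intro tendsto_mult tendsto_const tendsto_difference_quotient_exp)
  with lim show ?thesis
    unfolding eq c_def[symmetric] \<Phi>_def[symmetric] by (rule LIMSEQ_unique)
qed

text \<open>Each side integrates \<open>F\<close> against a finite measure on configurations. These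
  agree on every \<open>lap h\<close>: adding the point y multiplies \<open>lap h\<close> by exp (-
  h y), and the count-weighted mean is \<open>integral_lap_count\<close>. Uniqueness then gives all
  \<open>F\<close>.\<close>

lemma mecke:
  assumes B[measurable]: "B \<in> sets L" and fin: "emeasure L B < \<infinity>"
    and F[measurable]: "F \<in> borel_measurable (config_space L)"
  shows "(\<integral>\<^sup>+\<omega>. (\<integral>\<^sup>+y\<in>B. F (add_measure (\<eta> \<omega>) (return L y)) \<partial>L) \<partial>P) = (\<integral>\<^sup>+\<omega>. F (\<eta> \<omega>) * emeasure (\<eta> \<omega>) B \<partial>P)"
proof -
  let ?D = "distr P (config_space L) \<eta>"
  \<comment> \<open>The real-valued count may serve as density because the count in \<open>B\<close>
    is almost surely finite.\<close>
  let ?N2 = "density ?D (\<lambda>\<mu>. ennreal (measure \<mu> B))"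
  let ?LB = "restr_measure L B"
  let ?a = "\<lambda>(\<omega>, y). add_measure (\<eta> \<omega>) (return L y)"
  let ?N1 = "distr (P \<Otimes>\<^sub>M ?LB) (config_space L) ?a"
  have [measurable]: "(\<lambda>\<mu>. measure \<mu> B) \<in> borel_measurable (config_space L)"
    unfolding measure_def by measurable
  have emLB: "emeasure ?LB (space ?LB) = emeasure L B"
    by (simp add: emeasure_restr_measure)
  interpret LB: finite_measure ?LB
    using fin emLB by (intro finite_measureI) auto
  interpret PLB: pair_sigma_finite P ?LB ..
  interpret PP: finite_measure "P \<Otimes>\<^sub>M ?LB"
    by (intro finite_measureI)
      (use fin in \<open>auto simp: space_pair_measure LB.emeasure_pair_measure_Times emeasure_space_1 emLB[simplified]\<close>)
  have fin1: "finite_measure ?N1"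
    by (rule PP.finite_measure_distr) measurable
  have "emeasure ?N2 (space ?N2) = (\<integral>\<^sup>+\<omega>. ennreal (measure (\<eta> \<omega>) B) \<partial>P)"
    by (auto simp: emeasure_density nn_integral_distr measurable_space[OF measurable_eta] intro!: nn_integral_cong)
  then have fin2: "finite_measure ?N2"
    using integral_count(2)[OF B fin] by (intro finite_measureI) (simp add: nn_integral_eq_integral)
  have "?N1 = ?N2"
  proof (rule L.laplace_unique[OF fin1 fin2])
    fix h assume h: "h \<in> lap_funs L"
    then have [measurable]: "h \<in> borel_measurable L" by (rule lap_funs_measurable)
    have int: "integrable (P \<Otimes>\<^sub>M ?LB) (\<lambda>x. lap h (?a x))"
      by (rule PP.integrable_const_bound[of _ 1]) auto
    have "(\<integral>\<mu>. lap h \<mu> \<partial>?N1) = (\<integral>x. lap h (?a x) \<partial>(P \<Otimes>\<^sub>M ?LB))"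
      by (rule integral_distr) measurable
    also have "\<dots> = (\<integral>\<omega>. (\<integral>y. lap h (?a (\<omega>, y)) \<partial>?LB) \<partial>P)"
      by (rule PLB.integral_fst'[OF int, symmetric])
    also have "\<dots> = (\<integral>\<omega>. lap h (\<eta> \<omega>) * (\<integral>y. exp_neg (h y) \<partial>?LB) \<partial>P)"
    proof (intro Bochner_Integration.integral_cong refl)
      fix \<omega> assume "\<omega> \<in> space P"
      then have c: "\<eta> \<omega> \<in> int_valued_measures L" by (rule eta_config)
      have "(\<integral>y. lap h (?a (\<omega>, y)) \<partial>?LB) = (\<integral>y. lap h (\<eta> \<omega>) * exp_neg (h y) \<partial>?LB)"
        using c by (intro Bochner_Integration.integral_cong refl)
          (simp add: lap_add_measure[of h L] return_config lap_return)
      then show "(\<integral>y. lap h (?a (\<omega>, y)) \<partial>?LB) = lap h (\<eta> \<omega>) * (\<integral>y. exp_neg (h y) \<partial>?LB)"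
        by simp
    qed
    also have "\<dots> = (\<integral>\<omega>. lap h (\<eta> \<omega>) \<partial>P) * (\<integral>y. exp_neg (h y) \<partial>?LB)"
      by simp
    also have "(\<integral>y. exp_neg (h y) \<partial>?LB) = (\<integral>z\<in>B. exp_neg (h z) \<partial>L)"
    proof -
      have "?LB = density L (\<lambda>x. ennreal (indicator B x))"
        by (simp add: restr_measure_def ennreal_indicator)
      then show ?thesis by (simp add: integral_density set_lebesgue_integral_def)
    qed
    also have "(\<integral>\<omega>. lap h (\<eta> \<omega>) \<partial>P) * (\<integral>z\<in>B. exp_neg (h z) \<partial>L) = (\<integral>\<omega>. measure (\<eta> \<omega>) B * lap h (\<eta> \<omega>) \<partial>P)"
      by (rule integral_lap_count[OF h B fin, symmetric])
    also have "\<dots> = (\<integral>\<mu>. lap h \<mu> \<partial>?N2)"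
      by (simp add: integral_density integral_distr)
    finally show "(\<integral>\<mu>. lap h \<mu> \<partial>?N1) = (\<integral>\<mu>. lap h \<mu> \<partial>?N2)" .
  qed simp_all
  then have "(\<integral>\<^sup>+\<mu>. F \<mu> \<partial>?N1) = (\<integral>\<^sup>+\<mu>. F \<mu> \<partial>?N2)" by simp
  also have "(\<integral>\<^sup>+\<mu>. F \<mu> \<partial>?N1) = (\<integral>\<^sup>+x. F (?a x) \<partial>(P \<Otimes>\<^sub>M ?LB))"
    by (rule nn_integral_distr) measurable
  also have "\<dots> = (\<integral>\<^sup>+\<omega>. (\<integral>\<^sup>+y. F (?a (\<omega>, y)) \<partial>?LB) \<partial>P)"
    by (rule LB.nn_integral_fst[symmetric]) measurable
  also have "\<dots> = (\<integral>\<^sup>+\<omega>. (\<integral>\<^sup>+y\<in>B. F (add_measure (\<eta> \<omega>) (return L y)) \<partial>L) \<partial>P)"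
    by (intro nn_integral_cong) (simp add: nn_integral_restr_measure)
  also have "(\<integral>\<^sup>+\<mu>. F \<mu> \<partial>?N2) = (\<integral>\<^sup>+\<omega>. ennreal (measure (\<eta> \<omega>) B) * F (\<eta> \<omega>) \<partial>P)"
    by (simp add: nn_integral_density nn_integral_distr)
  also have "\<dots> = (\<integral>\<^sup>+\<omega>. F (\<eta> \<omega>) * emeasure (\<eta> \<omega>) B \<partial>P)"
    using integral_count(1)[OF B fin]
    by (intro nn_integral_cong_AE) (auto simp: emeasure_eq_ennreal_measure mult.commute)
  finally show ?thesis .
qed

end

section \<open>Past and future of an independent copy\<close>

lemma square_integrable_mult:
  fixes a b :: "'b \<Rightarrow> real"
  assumes [measurable]: "a \<in> borel_measurable M" "b \<in> borel_measurable M"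
    and a: "integrable M (\<lambda>x. (a x)\<^sup>2)" and b: "integrable M (\<lambda>x. (b x)\<^sup>2)"
  shows "integrable M (\<lambda>x. a x * b x)"
proof (rule Bochner_Integration.integrable_bound)
  show "integrable M (\<lambda>x. (a x)\<^sup>2 + (b x)\<^sup>2)" using a b by simp
  show "AE x in M. norm (a x * b x) \<le> norm ((a x)\<^sup>2 + (b x)\<^sup>2)"
  proof (rule AE_I2)
    fix x
    have "2 * (\<bar>a x\<bar> * \<bar>b x\<bar>) \<le> (a x)\<^sup>2 + (b x)\<^sup>2"
      using sum_squares_bound[of "\<bar>a x\<bar>" "\<bar>b x\<bar>"] by simp
    moreover have "0 \<le> \<bar>a x\<bar> * \<bar>b x\<bar>" by simp
    ultimately have "\<bar>a x\<bar> * \<bar>b x\<bar> \<le> (a x)\<^sup>2 + (b x)\<^sup>2" by linarith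
    then show "norm (a x * b x) \<le> norm ((a x)\<^sup>2 + (b x)\<^sup>2)" by (simp add: abs_mult)
  qed
qed measurable

text \<open>The integral of (a + t b)^2 is a nonnegative quadratic polynomial in t, which is
  evaluated at its minimum t = - C / B.\<close>

lemma Cauchy_Schwarz_integral:
  fixes a b :: "'b \<Rightarrow> real"
  assumes [measurable]: "a \<in> borel_measurable M" "b \<in> borel_measurable M"
    and a: "integrable M (\<lambda>x. (a x)\<^sup>2)" and b: "integrable M (\<lambda>x. (b x)\<^sup>2)"
  shows "(\<integral>x. a x * b x \<partial>M)\<^sup>2 \<le> (\<integral>x. (a x)\<^sup>2 \<partial>M) * (\<integral>x. (b x)\<^sup>2 \<partial>M)"
proof -
  define A B C where "A = (\<integral>x. (a x)\<^sup>2 \<partial>M)" and "B = (\<integral>x. (b x)\<^sup>2 \<partial>M)" and "C = (\<integral>x. a x * b x \<partial>M)"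
  have ab: "integrable M (\<lambda>x. a x * b x)" by (rule square_integrable_mult[OF assms])
  have quad: "0 \<le> A + 2 * t * C + t\<^sup>2 * B" for t
  proof -
    have "0 \<le> (\<integral>x. (a x + t * b x)\<^sup>2 \<partial>M)" by simp
    also have "(\<lambda>x. (a x + t * b x)\<^sup>2) = (\<lambda>x. (a x)\<^sup>2 + 2 * t * (a x * b x) + t\<^sup>2 * (b x)\<^sup>2)"
      by (simp add: fun_eq_iff power2_eq_square algebra_simps)
    also have "(\<integral>x. (a x)\<^sup>2 + 2 * t * (a x * b x) + t\<^sup>2 * (b x)\<^sup>2 \<partial>M) = A + 2 * t * C + t\<^sup>2 * B"
      using a b ab by (simp add: A_def B_def C_def)
    finally show ?thesis .
  qed
  have "0 \<le> B" by (simp add: B_def)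
  show ?thesis
  proof (cases "B = 0")
    case True
    have "C = 0"
    proof (rule ccontr)
      assume "C \<noteq> 0"
      \<comment> \<open>For B = 0 the polynomial is affine in t, and this t would give it the value
        -1.\<close>
      then show False using quad[of "- (A + 1) / (2 * C)"] True by (simp add: field_simps)
    qed
    then show ?thesis using True by (simp add: A_def B_def C_def)
  next
    case False
    then have "0 < B" using \<open>0 \<le> B\<close> by simp
    have "0 \<le> A - C\<^sup>2 / B"
      using quad[of "- C / B"] \<open>0 < B\<close> by (simp add: power2_eq_square field_simps)
    then show ?thesis using \<open>0 < B\<close> by (simp add: A_def B_def C_def field_simps)
  qed
qed

context poisson begin

text \<open>Mecke's formula with \<open>F\<close> the count in \<open>B\<close>: a point added
  inside \<open>B\<close> raises the count by one, so the second moment is the mean count plus 1,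
  times the intensity of \<open>B\<close>.\<close>

lemma integrable_count_square:
  assumes B[measurable]: "B \<in> sets L" and fin: "emeasure L B < \<infinity>"
  shows "integrable P (\<lambda>\<omega>. (measure (\<eta> \<omega>) B)\<^sup>2)"
proof -
  have [measurable]: "(\<lambda>\<omega>. measure (\<eta> \<omega>) B) \<in> borel_measurable P"
    unfolding measure_def by measurable
  have int: "(\<integral>\<^sup>+\<omega>. emeasure (\<eta> \<omega>) B \<partial>P) < \<infinity>"
  proof -
    have "(\<integral>\<^sup>+\<omega>. emeasure (\<eta> \<omega>) B \<partial>P) = (\<integral>\<^sup>+\<omega>. ennreal (measure (\<eta> \<omega>) B) \<partial>P)"
      using integral_count(1)[OF B fin] by (intro nn_integral_cong_AE) (auto simp: emeasure_eq_ennreal_measure)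
    then show ?thesis using integral_count(2)[OF B fin] by (simp add: nn_integral_eq_integral)
  qed
  have "(\<integral>\<^sup>+\<omega>. ennreal ((measure (\<eta> \<omega>) B)\<^sup>2) \<partial>P) = (\<integral>\<^sup>+\<omega>. emeasure (\<eta> \<omega>) B * emeasure (\<eta> \<omega>) B \<partial>P)"
    using integral_count(1)[OF B fin]
    by (intro nn_integral_cong_AE) (auto simp: emeasure_eq_ennreal_measure power2_eq_square ennreal_mult)
  also have "\<dots> = (\<integral>\<^sup>+\<omega>. (\<integral>\<^sup>+y\<in>B. emeasure (add_measure (\<eta> \<omega>) (return L y)) B \<partial>L) \<partial>P)"
    by (rule mecke[OF B fin, symmetric]) measurable
  also have "\<dots> = (\<integral>\<^sup>+\<omega>. (\<integral>\<^sup>+y\<in>B. (emeasure (\<eta> \<omega>) B + 1) \<partial>L) \<partial>P)"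
  proof (intro nn_integral_cong)
    fix \<omega> y assume "\<omega> \<in> space P" "y \<in> space L"
    then show "emeasure (add_measure (\<eta> \<omega>) (return L y)) B * indicator B y = (emeasure (\<eta> \<omega>) B + 1) * indicator B y"
      using config_spaceD(1)[OF eta_config] by (auto simp: emeasure_add_measure indicator_def)
  qed
  also have "\<dots> = (\<integral>\<^sup>+\<omega>. (emeasure (\<eta> \<omega>) B + 1) * emeasure L B \<partial>P)"
    by (simp add: nn_integral_cmult_indicator)
  also have "\<dots> = ((\<integral>\<^sup>+\<omega>. emeasure (\<eta> \<omega>) B \<partial>P) + 1) * emeasure L B"
    by (simp add: nn_integral_multc nn_integral_add emeasure_space_1)
  also have "\<dots> < \<infinity>" using int fin by (simp add: ennreal_mult_less_top)
  finally show ?thesis by (intro integrableI_bounded) auto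
qed

text \<open>One exhaustion is fixed for good, because the later definition of \<open>future\<close>
  refers to it.\<close>

definition exhaust :: "nat \<Rightarrow> 'a set" where
  "exhaust = (SOME F. range F \<subseteq> sets L \<and> (\<Union>i. F i) = space L \<and> (\<forall>i. emeasure L (F i) \<noteq> \<infinity>) \<and> incseq F)"

lemma exhaust: "exhaust i \<in> sets L" "(\<Union>i. exhaust i) = space L" "emeasure L (exhaust i) < \<infinity>" "incseq exhaust"
proof -
  have "\<exists>F. range F \<subseteq> sets L \<and> (\<Union>i. F i) = space L \<and> (\<forall>i. emeasure L (F i) \<noteq> \<infinity>) \<and> incseq (F :: nat \<Rightarrow> _)"
    using L.sigma_finite_incseq by metis
  note someI_ex[OF this, folded exhaust_def]
  then  show "exhaust i \<in> sets L" "(\<Union>i. exhaust i) = space L" "emeasure L (exhaust i) < \<infinity>" "incseq exhaust"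
    by (auto simp: less_top[symmetric])
qed

lemma exhaust_sets [measurable]: "exhaust i \<in> sets L" by (rule exhaust)

lemma AE_exhaust_finite: "AE \<omega> in P. \<forall>i. emeasure (\<eta> \<omega>) (exhaust i) < \<infinity>"
  unfolding AE_all_countable using integral_count(1)[OF exhaust(1,3)] by auto

end

locale poisson_order = poisson P L \<eta>
  for P :: "'w measure" and L :: "'a measure" and \<eta> :: "'w \<Rightarrow> 'a measure" +
  fixes prec :: "'a \<Rightarrow> 'a \<Rightarrow> bool"
  assumes trans: "transp_on (space L) prec"
    and prec_sets: "{(y, z) \<in> space L \<times> space L. prec y z} \<in> sets (L \<Otimes>\<^sub>M L)"
    and asym: "\<forall>y\<in>space L. \<forall>z\<in>space L. \<not> (prec y z \<and> prec z y)"
    and comparable: "\<forall>y\<in>space L. emeasure L (space L - {z \<in> space L. prec z y \<or> prec y z}) = 0"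
    and measurable_past_config: "(\<lambda>(\<mu>, y). past_measure L prec \<mu> y) \<in> measurable (config_space L \<Otimes>\<^sub>M L) (config_space L)"
begin

abbreviation down :: "'a \<Rightarrow> 'a set" where "down y \<equiv> down_set L prec y"
abbreviation past :: "'a measure \<Rightarrow> 'a \<Rightarrow> 'a measure" where "past \<mu> y \<equiv> past_measure L prec \<mu> y"

lemma measurable_prec [measurable]: "Measurable.pred (L \<Otimes>\<^sub>M L) (\<lambda>x. prec (fst x) (snd x))"
proof -
  have "{x \<in> space (L \<Otimes>\<^sub>M L). prec (fst x) (snd x)} = {(y, z) \<in> space L \<times> space L. prec y z}"
    by (auto simp: space_pair_measure)
  then show ?thesis using prec_sets by (simp add: pred_def)
qed

lemma pred_prec [measurable (raw)]:
  assumes "f \<in> measurable M L" "g \<in> measurable M L"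
  shows "Measurable.pred M (\<lambda>x. prec (f x) (g x))"
  using measurable_compose[OF measurable_Pair[OF assms] measurable_prec] by simp

lemma down_sets: "y \<in> space L \<Longrightarrow> down y \<in> sets L"
  unfolding down_set_def by measurable

lemma measurable_past [measurable (raw)]:
  assumes "f \<in> measurable M (config_space L)" "g \<in> measurable M L"
  shows "(\<lambda>x. past (f x) (g x)) \<in> measurable M (config_space L)"
  using measurable_compose[OF measurable_Pair[OF assms] measurable_past_config] by simp

lemma past_config: "\<mu> \<in> int_valued_measures L \<Longrightarrow> y \<in> space L \<Longrightarrow> past \<mu> y \<in> int_valued_measures L"
  unfolding past_measure_def by (intro restr_measure_config down_sets)

text \<open>Replacing configurations with infinitely many points in a set of the exhaustion, a null event,
  by the zero measure makes the restriction to the complement of the past jointly measurable.\<close>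

definition future :: "'a measure \<Rightarrow> 'a \<Rightarrow> 'a measure" where
  "future \<mu> y = (if \<forall>i. emeasure \<mu> (exhaust i) < \<infinity> then restr_measure \<mu> (space L - down y) else null_measure L)"

lemma future_config: "\<mu> \<in> int_valued_measures L \<Longrightarrow> y \<in> space L \<Longrightarrow> future \<mu> y \<in> int_valued_measures L"
  unfolding future_def by (auto intro!: restr_measure_config null_measure_config down_sets)

text \<open>Where counts are finite, the mass outside the past is total mass minus past mass. This
  writes it through functions known to be measurable in (\<mu>, y), and the supremum along the
  exhaustion reaches arbitrary \<open>B\<close>.\<close>

lemma emeasure_future:
  assumes c: "\<mu> \<in> int_valued_measures L" and y: "y \<in> space L" and B: "B \<in> sets L"
  shows "emeasure (future \<mu> y) B = (if \<forall>i. emeasure \<mu> (exhaust i) < \<infinity>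
    then SUP i. emeasure \<mu> (B \<inter> exhaust i) - emeasure (past \<mu> y) (B \<inter> exhaust i) else 0)"
proof (cases "\<forall>i. emeasure \<mu> (exhaust i) < \<infinity>")
  case True
  note s = config_spaceD(1)[OF c]
  let ?C = "space L - down y"
  have [simp]: "down y \<in> sets L" using y by (rule down_sets)
  have fin: "emeasure \<mu> (D \<inter> exhaust i) \<noteq> \<infinity>" for i D
  proof -
    have "emeasure \<mu> (D \<inter> exhaust i) \<le> emeasure \<mu> (exhaust i)"
      using s exhaust(1) by (intro emeasure_mono) auto
    then show ?thesis using True[rule_format, of i] by (auto simp: top_unique)
  qed
  have "emeasure \<mu> (B \<inter> exhaust i) - emeasure (past \<mu> y) (B \<inter> exhaust i) = emeasure \<mu> ((?C \<inter> B) \<inter> exhaust i)" for i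
  proof -
    have "emeasure (past \<mu> y) (B \<inter> exhaust i) = emeasure \<mu> ((down y \<inter> B) \<inter> exhaust i)"
      using B s exhaust(1) by (simp add: past_measure_def emeasure_restr_measure Int_assoc)
    moreover have "emeasure \<mu> (B \<inter> exhaust i) - emeasure \<mu> ((down y \<inter> B) \<inter> exhaust i) = emeasure \<mu> (B \<inter> exhaust i - (down y \<inter> B) \<inter> exhaust i)"
      using B s fin by (intro emeasure_Diff[symmetric]) (auto intro!: sets.Int exhaust(1))
    moreover have "B \<inter> exhaust i - (down y \<inter> B) \<inter> exhaust i = (?C \<inter> B) \<inter> exhaust i"
      using sets.sets_into_space[OF B] by auto
    ultimately show ?thesis by simp
  qed
  then have "(SUP i. emeasure \<mu> (B \<inter> exhaust i) - emeasure (past \<mu> y) (B \<inter> exhaust i)) = (SUP i. emeasure \<mu> ((?C \<inter> B) \<inter> exhaust i))"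
    by simp
  also have "\<dots> = emeasure \<mu> (\<Union>i. (?C \<inter> B) \<inter> exhaust i)"
  proof (rule SUP_emeasure_incseq)
    show "range (\<lambda>i. (?C \<inter> B) \<inter> exhaust i) \<subseteq> sets \<mu>"
      unfolding s by (intro image_subsetI sets.Int sets.compl_sets exhaust(1) B down_sets y)
    show "incseq (\<lambda>i. (?C \<inter> B) \<inter> exhaust i)"
      using incseqD[OF exhaust(4)] by (intro monoI Int_mono order_refl)
  qed
  also have "(\<Union>i. (?C \<inter> B) \<inter> exhaust i) = ?C \<inter> B"
    using exhaust(2) by (simp only: Int_UN_distrib[symmetric]) blast
  also have "emeasure \<mu> (?C \<inter> B) = emeasure (future \<mu> y) B"
    using True B s by (simp add: future_def emeasure_restr_measure sets.compl_sets)
  finally show ?thesis using True by simp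
next
  case False
  then show ?thesis by (simp only: future_def if_False) simp
qed

lemma measurable_future_config: "(\<lambda>(\<mu>, y). future \<mu> y) \<in> measurable (config_space L \<Otimes>\<^sub>M L) (config_space L)"
proof (rule measurable_config_spaceI)
  fix B assume B[measurable]: "B \<in> sets L"
  have "(\<lambda>x. if \<forall>i. emeasure (fst x) (exhaust i) < \<infinity>
    then SUP i. emeasure (fst x) (B \<inter> exhaust i) - emeasure (past (fst x) (snd x)) (B \<inter> exhaust i) else 0)
    \<in> borel_measurable (config_space L \<Otimes>\<^sub>M L)"
    by measurable
  then show "(\<lambda>x. emeasure (case x of (\<mu>, y) \<Rightarrow> future \<mu> y) B) \<in> borel_measurable (config_space L \<Otimes>\<^sub>M L)"
    by (rule measurable_cong[THEN iffD1, rotated])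
       (use B in \<open>auto simp: space_pair_measure space_config_space emeasure_future split_beta\<close>)
qed (auto simp: space_pair_measure space_config_space intro: future_config)

lemma measurable_future [measurable (raw)]:
  assumes "f \<in> measurable M (config_space L)" "g \<in> measurable M L"
  shows "(\<lambda>x. future (f x) (g x)) \<in> measurable M (config_space L)"
  using measurable_compose[OF measurable_Pair[OF assms] measurable_future_config] by simp

text \<open>The past of one realisation is continued by the future of an independent one. Averaging
  over \<omega>' with \<omega> fixed is conditioning on the past of y.\<close>

definition mix :: "'w \<Rightarrow> 'w \<Rightarrow> 'a \<Rightarrow> 'a measure" where
  "mix \<omega> \<omega>' y = add_measure (past (\<eta> \<omega>) y) (future (\<eta> \<omega>') y)"

lemma mix_config: "\<omega> \<in> space P \<Longrightarrow> \<omega>' \<in> space P \<Longrightarrow> y \<in> space L \<Longrightarrow> mix \<omega> \<omega>' y \<in> int_valued_measures L"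
  unfolding mix_def by (intro add_measure_config past_config future_config eta_config)

lemma measurable_mix [measurable (raw)]:
  assumes [measurable]: "f \<in> measurable M P" "g \<in> measurable M P" "h \<in> measurable M L"
  shows "(\<lambda>x. mix (f x) (g x) (h x)) \<in> measurable M (config_space L)"
  unfolding mix_def by measurable

lemma integral_lap_past:
  assumes h: "h \<in> borel_measurable L" and y: "y \<in> space L"
  shows "(\<integral>\<omega>. lap h (past (\<eta> \<omega>) y) \<partial>P) = exp_neg (\<integral>\<^sup>+z\<in>down y. ennreal (1 - exp_neg (h z)) \<partial>L)"
proof -
  have [measurable]: "h \<in> borel_measurable L" "down y \<in> sets L" using h y by (auto intro: down_sets)
  have "(\<integral>\<omega>. lap h (past (\<eta> \<omega>) y) \<partial>P) = (\<integral>\<omega>. lap (\<lambda>z. h z * indicator (down y) z) (\<eta> \<omega>) \<partial>P)"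
    unfolding past_measure_def
    by (intro Bochner_Integration.integral_cong refl lap_restr_measure[OF h eta_config]) measurable
  also have "\<dots> = exp_neg (\<integral>\<^sup>+z. ennreal (1 - exp_neg (h z * indicator (down y) z)) \<partial>L)"
    by (rule laplace) measurable
  also have "(\<integral>\<^sup>+z. ennreal (1 - exp_neg (h z * indicator (down y) z)) \<partial>L) = (\<integral>\<^sup>+z\<in>down y. ennreal (1 - exp_neg (h z)) \<partial>L)"
    by (intro nn_integral_cong) (auto simp: indicator_def)
  finally show ?thesis .
qed

lemma AE_future: "AE \<omega> in P. \<forall>y. future (\<eta> \<omega>) y = restr_measure (\<eta> \<omega>) (space L - down y)"
  using AE_exhaust_finite by eventually_elim (simp add: future_def)

lemma integral_lap_future:
  assumes h: "h \<in> borel_measurable L" and y: "y \<in> space L"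
  shows "(\<integral>\<omega>. lap h (future (\<eta> \<omega>) y) \<partial>P) = exp_neg (\<integral>\<^sup>+z\<in>space L - down y. ennreal (1 - exp_neg (h z)) \<partial>L)"
proof -
  let ?C = "space L - down y"
  have [measurable]: "h \<in> borel_measurable L" "?C \<in> sets L" using h y by (auto intro: down_sets)
  have [measurable]: "y \<in> space L" by fact
  have "(\<integral>\<omega>. lap h (future (\<eta> \<omega>) y) \<partial>P) = (\<integral>\<omega>. lap (\<lambda>z. h z * indicator ?C z) (\<eta> \<omega>) \<partial>P)"
  proof (rule integral_cong_AE)
    show "AE \<omega> in P. lap h (future (\<eta> \<omega>) y) = lap (\<lambda>z. h z * indicator ?C z) (\<eta> \<omega>)"
      using AE_future AE_space
    proof eventually_elim
      case (elim \<omega>)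
      then show ?case by (simp add: lap_restr_measure[OF h eta_config])
    qed
  qed measurable
  also have "\<dots> = exp_neg (\<integral>\<^sup>+z. ennreal (1 - exp_neg (h z * indicator ?C z)) \<partial>L)"
    by (rule laplace) measurable
  also have "(\<integral>\<^sup>+z. ennreal (1 - exp_neg (h z * indicator ?C z)) \<partial>L) = (\<integral>\<^sup>+z\<in>?C. ennreal (1 - exp_neg (h z)) \<partial>L)"
    by (intro nn_integral_cong) (auto simp: indicator_def)
  finally show ?thesis .
qed

lemma nn_integral_split_down:
  assumes u: "u \<in> borel_measurable L" and y: "y \<in> space L"
  shows "(\<integral>\<^sup>+z\<in>down y. u z \<partial>L) + (\<integral>\<^sup>+z\<in>space L - down y. u z \<partial>L) = (\<integral>\<^sup>+z. u z \<partial>L)"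
proof -
  have [measurable]: "down y \<in> sets L" using y by (rule down_sets)
  show ?thesis using u
    by (subst nn_integral_add[symmetric]) (auto intro!: nn_integral_cong simp: indicator_def)
qed

text \<open>The past and the future of y live on disjoint sets and are therefore independent, so
  exchanging the future for an independent copy preserves the law. In terms of Laplace functionals,
  the exponent splits into the integrals over \<open>down y\<close> and its complement.\<close>

lemma nn_integral_mix:
  assumes y[measurable]: "y \<in> space L" and F[measurable]: "F \<in> borel_measurable (config_space L)"
  shows "(\<integral>\<^sup>+\<omega>. (\<integral>\<^sup>+\<omega>'. F (mix \<omega> \<omega>' y) \<partial>P) \<partial>P) = (\<integral>\<^sup>+\<omega>. F (\<eta> \<omega>) \<partial>P)"
proof -
  interpret PP: pair_prob_space P P ..
  let ?m = "\<lambda>x. mix (fst x) (snd x) y"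
  let ?N1 = "distr (P \<Otimes>\<^sub>M P) (config_space L) ?m" and ?N2 = "distr P (config_space L) \<eta>"
  have "?N1 = ?N2"
  proof (rule L.laplace_unique)
    show "finite_measure ?N1" by (rule PP.finite_measure_distr) measurable
    show "finite_measure ?N2" by (rule finite_measure_distr) measurable
    fix h assume "h \<in> lap_funs L"
    then have h[measurable]: "h \<in> borel_measurable L" by (rule lap_funs_measurable)
    have "(\<integral>\<mu>. lap h \<mu> \<partial>?N1) = (\<integral>x. lap h (?m x) \<partial>(P \<Otimes>\<^sub>M P))"
      by (rule integral_distr) measurable
    also have "\<dots> = (\<integral>\<omega>. (\<integral>\<omega>'. lap h (?m (\<omega>, \<omega>')) \<partial>P) \<partial>P)"
      by (rule PP.integral_fst'[symmetric]) (auto intro!: PP.integrable_const_bound[of _ 1])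
    also have "\<dots> = (\<integral>\<omega>. (\<integral>\<omega>'. lap h (past (\<eta> \<omega>) y) * lap h (future (\<eta> \<omega>') y) \<partial>P) \<partial>P)"
      by (intro Bochner_Integration.integral_cong refl)
         (auto simp: mix_def intro!: lap_add_measure[OF h] past_config future_config eta_config y)
    also have "\<dots> = exp_neg (\<integral>\<^sup>+z\<in>down y. ennreal (1 - exp_neg (h z)) \<partial>L) * exp_neg (\<integral>\<^sup>+z\<in>space L - down y. ennreal (1 - exp_neg (h z)) \<partial>L)"
      by (simp add: integral_lap_past[OF h y] integral_lap_future[OF h y])
    also have "\<dots> = exp_neg (\<integral>\<^sup>+z. ennreal (1 - exp_neg (h z)) \<partial>L)"
      by (simp add: exp_neg_add[symmetric] nn_integral_split_down[OF _ y])
    also have "\<dots> = (\<integral>\<mu>. lap h \<mu> \<partial>?N2)"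
      by (simp add: integral_distr laplace)
    finally show "(\<integral>\<mu>. lap h \<mu> \<partial>?N1) = (\<integral>\<mu>. lap h \<mu> \<partial>?N2)" .
  qed simp_all
  then have "(\<integral>\<^sup>+\<mu>. F \<mu> \<partial>?N1) = (\<integral>\<^sup>+\<mu>. F \<mu> \<partial>?N2)" by simp
  also have "(\<integral>\<^sup>+\<mu>. F \<mu> \<partial>?N1) = (\<integral>\<^sup>+x. F (?m x) \<partial>(P \<Otimes>\<^sub>M P))"
    by (rule nn_integral_distr) measurable
  also have "\<dots> = (\<integral>\<^sup>+\<omega>. (\<integral>\<^sup>+\<omega>'. F (?m (\<omega>, \<omega>')) \<partial>P) \<partial>P)"
    by (rule nn_integral_fst[symmetric]) measurable
  also have "(\<integral>\<^sup>+\<mu>. F \<mu> \<partial>?N2) = (\<integral>\<^sup>+\<omega>. F (\<eta> \<omega>) \<partial>P)"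
    by (rule nn_integral_distr) measurable
  finally show ?thesis by simp
qed

end

section \<open>Largest points\<close>

context poisson_order begin

text \<open>By asymmetry no point is both below and above z. The points incomparable to z, among
  them z itself, form a null set of \<open>L\<close>, hence of \<nu>.\<close>

lemma emeasure_down_up:
  assumes fin: "finite_measure \<nu>" and s[measurable_cong]: "sets \<nu> = sets L" and ac: "absolutely_continuous L \<nu>"
    and z[measurable]: "z \<in> space L"
  shows "emeasure \<nu> (down z) + emeasure \<nu> {y \<in> space L. prec z y} = emeasure \<nu> (space L)"
proof -
  have [measurable]: "down z \<in> sets L" "{y \<in> space L. prec z y} \<in> sets L"
    using z by (auto intro: down_sets)
  let ?U = "{y \<in> space L. prec z y}" and ?N = "space L - {y \<in> space L. prec y z \<or> prec z y}"
  have N: "?N = space L - (down z \<union> ?U)" by (auto simp: down_set_def)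
  have "?N \<in> null_sets L"
    using comparable z by (auto simp: N null_sets_def)
  then have N0: "emeasure \<nu> ?N = 0" using ac by (auto simp: absolutely_continuous_def)
  have "emeasure \<nu> (down z) + emeasure \<nu> ?U = emeasure \<nu> (down z \<union> ?U)"
    by (rule plus_emeasure) (use asym z in \<open>auto simp: down_set_def s\<close>)
  also have "\<dots> = emeasure \<nu> (down z \<union> ?U) + emeasure \<nu> ?N" using N0 by simp
  also have "\<dots> = emeasure \<nu> ((down z \<union> ?U) \<union> ?N)"
    by (rule plus_emeasure) (auto simp: N s)
  also have "(down z \<union> ?U) \<union> ?N = space L" by (auto simp: down_set_def)
  finally show ?thesis .
qed

lemma measurable_emeasure_down:
  assumes fin: "finite_measure \<nu>" and s[measurable_cong]: "sets \<nu> = sets L"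
  shows "(\<lambda>y. emeasure \<nu> (down y)) \<in> borel_measurable L"
proof -
  interpret finite_measure \<nu> by fact
  have "(\<lambda>y. \<integral>\<^sup>+z. indicator {z \<in> space L. prec z y} z \<partial>\<nu>) \<in> borel_measurable L"
    by measurable
  also have "?this \<longleftrightarrow> ?thesis"
    unfolding down_set_def
  proof (intro measurable_cong nn_integral_indicator)
    fix y assume [measurable]: "y \<in> space L"
    show "{z \<in> space L. prec z y} \<in> sets \<nu>" unfolding s by measurable
  qed
  finally show ?thesis .
qed

text \<open>Almost everywhere, \<open>n + 1\<close> independent points drawn from \<open>\<nu>\<close> are pairwise comparable, and
  each of them is equally likely to be the largest one.\<close>

lemma nn_integral_emeasure_down_power:
  assumes "finite_measure \<nu>" "sets \<nu> = sets L" "absolutely_continuous L \<nu>"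
  shows "of_nat (Suc n) * (\<integral>\<^sup>+y. emeasure \<nu> (down y) ^ n \<partial>\<nu>) = emeasure \<nu> (space L) ^ Suc n"
  using assms
proof (induct n arbitrary: \<nu>)
  case 0
  then show ?case using sets_eq_imp_space_eq[of \<nu> L] by simp
next
  case (Suc n)
  note s[measurable_cong] = Suc(3)
  interpret finite_measure \<nu> by (rule Suc)
  interpret pair_sigma_finite \<nu> \<nu> ..
  have [simp]: "space \<nu> = space L" using s by (rule sets_eq_imp_space_eq)
  let ?F = "\<lambda>y. emeasure \<nu> (down y)" and ?m = "emeasure \<nu> (space L)"
  have F[measurable]: "?F \<in> borel_measurable L" by (rule measurable_emeasure_down[OF Suc(2,3)])
  \<comment> \<open>The induction hypothesis is applied to \<nu> restricted to
    \<open>down y\<close>, which is why \<nu> is arbitrary in the induction. By transitivity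
    \<open>down z\<close> lies inside \<open>down y\<close> for z below y, so the restriction does
    not change its mass.\<close>
  have rec: "?F y ^ Suc n = of_nat (Suc n) * (\<integral>\<^sup>+z. ?F z ^ n * indicator {z \<in> space L. prec z y} z \<partial>\<nu>)"
    if y[measurable]: "y \<in> space L" for y
  proof -
    have d[measurable]: "down y \<in> sets L" using y by (rule down_sets)
    let ?\<nu> = "restr_measure \<nu> (down y)"
    have "finite_measure ?\<nu>"
      by (intro finite_measureI) (simp add: emeasure_restr_measure s)
    moreover have "absolutely_continuous L ?\<nu>"
    proof -
      have "absolutely_continuous \<nu> ?\<nu>"
        unfolding restr_measure_def by (rule absolutely_continuousI_density) measurable
      then show ?thesis using Suc(4) by (auto simp: absolutely_continuous_def)
    qed
    ultimately have "of_nat (Suc n) * (\<integral>\<^sup>+z. emeasure ?\<nu> (down z) ^ n \<partial>?\<nu>) = emeasure ?\<nu> (space L) ^ Suc n"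
      by (intro Suc(1)) (simp_all add: s)
    moreover have "emeasure ?\<nu> (space L) = ?F y"
      using sets.sets_into_space[OF d] by (simp add: emeasure_restr_measure s Int_absorb2)
    moreover have "(\<integral>\<^sup>+z. emeasure ?\<nu> (down z) ^ n \<partial>?\<nu>) = (\<integral>\<^sup>+z. ?F z ^ n \<partial>?\<nu>)"
    proof (rule nn_integral_cong_AE)
      have "AE z in ?\<nu>. z \<in> down y"
        unfolding restr_measure_def by (subst AE_density) (auto simp: indicator_def)
      then show "AE z in ?\<nu>. emeasure ?\<nu> (down z) ^ n = ?F z ^ n"
      proof eventually_elim
        case (elim z)
        then have z: "z \<in> space L" "prec z y" by (auto simp: down_set_def)
        have "down z \<subseteq> down y"
          using trans z y by (auto simp: down_set_def dest: transp_onD)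
        then have "down y \<inter> down z = down z" by auto
        then show ?case using z down_sets by (simp add: emeasure_restr_measure s)
      qed
    qed
    moreover have "(\<integral>\<^sup>+z. ?F z ^ n \<partial>?\<nu>) = (\<integral>\<^sup>+z. ?F z ^ n * indicator {z \<in> space L. prec z y} z \<partial>\<nu>)"
      by (subst nn_integral_restr_measure) (auto simp: s down_set_def)
    ultimately show ?thesis by simp
  qed
  have "(\<integral>\<^sup>+y. ?F y ^ Suc n \<partial>\<nu>) = (\<integral>\<^sup>+y. of_nat (Suc n) * (\<integral>\<^sup>+z. ?F z ^ n * indicator {z \<in> space L. prec z y} z \<partial>\<nu>) \<partial>\<nu>)"
    by (intro nn_integral_cong rec) simp
  also have "\<dots> = of_nat (Suc n) * (\<integral>\<^sup>+y. (\<integral>\<^sup>+z. ?F z ^ n * indicator {z \<in> space L. prec z y} z \<partial>\<nu>) \<partial>\<nu>)"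
    by (rule nn_integral_cmult) measurable
  also have "(\<integral>\<^sup>+y. (\<integral>\<^sup>+z. ?F z ^ n * indicator {z \<in> space L. prec z y} z \<partial>\<nu>) \<partial>\<nu>) =
      (\<integral>\<^sup>+z. (\<integral>\<^sup>+y. ?F z ^ n * indicator {z \<in> space L. prec z y} z \<partial>\<nu>) \<partial>\<nu>)"
    by (rule Fubini') measurable
  also have "\<dots> = (\<integral>\<^sup>+z. ?F z ^ n * emeasure \<nu> {y \<in> space L. prec z y} \<partial>\<nu>)"
  proof (rule nn_integral_cong)
    fix z assume "z \<in> space \<nu>"
    then have z[measurable]: "z \<in> space L" by simp
    have "(\<integral>\<^sup>+y. ?F z ^ n * indicator {z \<in> space L. prec z y} z \<partial>\<nu>) = (\<integral>\<^sup>+y. ?F z ^ n * indicator {y \<in> space L. prec z y} y \<partial>\<nu>)"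
      using z by (intro nn_integral_cong) (auto simp: indicator_def)
    also have "\<dots> = ?F z ^ n * emeasure \<nu> {y \<in> space L. prec z y}"
      by (rule nn_integral_cmult_indicator) measurable
    finally show "(\<integral>\<^sup>+y. ?F z ^ n * indicator {z \<in> space L. prec z y} z \<partial>\<nu>) = ?F z ^ n * emeasure \<nu> {y \<in> space L. prec z y}" .
  qed
  finally have 1: "(\<integral>\<^sup>+y. ?F y ^ Suc n \<partial>\<nu>) = of_nat (Suc n) * (\<integral>\<^sup>+z. ?F z ^ n * emeasure \<nu> {y \<in> space L. prec z y} \<partial>\<nu>)" .
  have [measurable]: "(\<lambda>z. emeasure \<nu> {y \<in> space L. prec z y}) \<in> borel_measurable L"
  proof -
    have "(\<lambda>z. \<integral>\<^sup>+y. indicator {y \<in> space L. prec z y} y \<partial>\<nu>) \<in> borel_measurable L"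
      by measurable
    also have "?this \<longleftrightarrow> ?thesis"
    proof (intro measurable_cong nn_integral_indicator)
      fix z assume [measurable]: "z \<in> space L"
      show "{y \<in> space L. prec z y} \<in> sets \<nu>" unfolding s by measurable
    qed
    finally show ?thesis .
  qed
  \<comment> \<open>One of the n + 2 copies is rewritten by the exchanged integral and contributes
    the mass above z, the other n + 1 contribute the mass below z. Together they give the total mass
    as a constant factor.\<close>
  have "of_nat (Suc (Suc n)) * (\<integral>\<^sup>+y. ?F y ^ Suc n \<partial>\<nu>) = (\<integral>\<^sup>+y. ?F y ^ Suc n \<partial>\<nu>) + of_nat (Suc n) * (\<integral>\<^sup>+y. ?F y ^ Suc n \<partial>\<nu>)"
    by (simp add: distrib_right)
  also have "\<dots> = of_nat (Suc n) * ((\<integral>\<^sup>+z. ?F z ^ n * emeasure \<nu> {y \<in> space L. prec z y} \<partial>\<nu>) + (\<integral>\<^sup>+z. ?F z ^ Suc n \<partial>\<nu>))"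
    by (subst (1) 1) (simp add: distrib_left)
  also have "(\<integral>\<^sup>+z. ?F z ^ n * emeasure \<nu> {y \<in> space L. prec z y} \<partial>\<nu>) + (\<integral>\<^sup>+z. ?F z ^ Suc n \<partial>\<nu>) =
      (\<integral>\<^sup>+z. ?F z ^ n * emeasure \<nu> {y \<in> space L. prec z y} + ?F z ^ Suc n \<partial>\<nu>)"
    by (rule nn_integral_add[symmetric]) measurable
  also have "\<dots> = (\<integral>\<^sup>+z. ?F z ^ n * ?m \<partial>\<nu>)"
  proof (rule nn_integral_cong)
    fix z assume "z \<in> space \<nu>"
    then have "?m = ?F z + emeasure \<nu> {y \<in> space L. prec z y}"
      using emeasure_down_up[OF Suc(2,3,4), of z] by simp
    then show "?F z ^ n * emeasure \<nu> {y \<in> space L. prec z y} + ?F z ^ Suc n = ?F z ^ n * ?m"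
      by (simp add: distrib_left ac_simps)
  qed
  also have "\<dots> = (\<integral>\<^sup>+z. ?F z ^ n \<partial>\<nu>) * ?m"
    by (rule nn_integral_multc) measurable
  also have "of_nat (Suc n) * ((\<integral>\<^sup>+z. ?F z ^ n \<partial>\<nu>) * ?m) = ?m ^ Suc n * ?m"
    by (simp only: mult.assoc[symmetric] Suc(1)[OF Suc(2,3,4)])
  finally show ?case by (simp add: ac_simps)
qed

text \<open>The exponential series is integrated term by term. The term of order n integrates to the
  term of order n + 1 of exp (\<nu> Y), so only the constant term is missing, whence the -1.\<close>

lemma nn_integral_exp_measure_down:
  assumes fin: "finite_measure \<nu>" and s[measurable_cong]: "sets \<nu> = sets L" and ac: "absolutely_continuous L \<nu>"
  shows "(\<integral>\<^sup>+y. ennreal (exp (measure \<nu> (down y))) \<partial>\<nu>) = ennreal (exp (measure \<nu> (space L)) - 1)"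
proof -
  interpret finite_measure \<nu> by fact
  define m where "m = measure \<nu> (space L)"
  have [measurable]: "(\<lambda>y. measure \<nu> (down y)) \<in> borel_measurable L"
    unfolding measure_def by (rule measurable_compose[OF measurable_emeasure_down[OF fin s]]) measurable
  have pow: "(\<integral>\<^sup>+y. ennreal (measure \<nu> (down y) ^ n /\<^sub>R fact n) \<partial>\<nu>) = ennreal (m ^ Suc n /\<^sub>R fact (Suc n))" for n
  proof -
    define I where "I = (\<integral>\<^sup>+y. emeasure \<nu> (down y) ^ n \<partial>\<nu>)"
    have eq: "ennreal (real (Suc n)) * I = ennreal (m ^ Suc n)"
      using nn_integral_emeasure_down_power[OF assms, of n]
      unfolding I_def m_def by (simp only: emeasure_eq_measure ennreal_power measure_nonneg ennreal_of_nat_eq_real_of_nat)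
    then have "I \<noteq> \<infinity>" by (auto simp: ennreal_mult_top)
    then obtain r where r: "I = ennreal r" "0 \<le> r" by (cases I) auto
    then have "real (Suc n) * r = m ^ Suc n"
      using eq by (simp add: ennreal_mult[symmetric] m_def del: of_nat_Suc power_Suc)
    then have rr: "r = m ^ Suc n / real (Suc n)" by (simp add: field_simps)
    have "(\<integral>\<^sup>+y. ennreal (measure \<nu> (down y) ^ n /\<^sub>R fact n) \<partial>\<nu>) = (\<integral>\<^sup>+y. ennreal (inverse (fact n)) * emeasure \<nu> (down y) ^ n \<partial>\<nu>)"
      by (simp add: emeasure_eq_measure ennreal_power ennreal_mult)
    also have "\<dots> = ennreal (inverse (fact n)) * I"
    proof -
      define E where "E = (\<lambda>y. emeasure \<nu> (down y))"
      have [measurable]: "E \<in> borel_measurable L"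
        unfolding E_def by (rule measurable_emeasure_down[OF fin s])
      have "(\<integral>\<^sup>+y. ennreal (inverse (fact n)) * E y ^ n \<partial>\<nu>) = ennreal (inverse (fact n)) * (\<integral>\<^sup>+y. E y ^ n \<partial>\<nu>)"
        by (rule nn_integral_cmult) measurable
      then show ?thesis by (simp only: I_def E_def)
    qed
    also have "\<dots> = ennreal (m ^ Suc n /\<^sub>R fact (Suc n))"
      using r by (simp add: ennreal_mult[symmetric] rr field_simps)
    finally show ?thesis .
  qed
  have "(\<integral>\<^sup>+y. ennreal (exp (measure \<nu> (down y))) \<partial>\<nu>) = (\<integral>\<^sup>+y. (\<Sum>n. ennreal (measure \<nu> (down y) ^ n /\<^sub>R fact n)) \<partial>\<nu>)"
    by (intro nn_integral_cong suminf_ennreal_eq[symmetric] exp_converges) simp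
  also have "\<dots> = (\<Sum>n. \<integral>\<^sup>+y. ennreal (measure \<nu> (down y) ^ n /\<^sub>R fact n) \<partial>\<nu>)"
    by (rule nn_integral_suminf) measurable
  also have "\<dots> = (\<Sum>n. ennreal (m ^ Suc n /\<^sub>R fact (Suc n)))"
    by (simp only: pow)
  also have "\<dots> = ennreal (exp m - 1)"
  proof (rule suminf_ennreal_eq)
    show "(\<lambda>n. m ^ Suc n /\<^sub>R fact (Suc n)) sums (exp m - 1)"
      using exp_converges[of m] by (subst sums_Suc_iff) simp
    show "0 \<le> m ^ Suc n /\<^sub>R fact (Suc n)" for n by (simp add: m_def)
  qed
  finally show ?thesis unfolding m_def .
qed

section \<open>The conditional difference operator through an independent copy\<close>

definition incr :: "('a measure \<Rightarrow> real) \<Rightarrow> 'w \<times> 'a \<Rightarrow> 'w \<Rightarrow> real" where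
  "incr f x \<omega>' = f (add_measure (mix (fst x) \<omega>' (snd x)) (return L (snd x))) - f (mix (fst x) \<omega>' (snd x))"

text \<open>The pair (\<omega>, y) is a single argument, so that this becomes a function on the
  product \<open>P \<Otimes>\<^sub>M L\<close>, in whose L^2 space the isometry takes its
  values.\<close>

definition cond_incr :: "('a measure \<Rightarrow> real) \<Rightarrow> 'w \<times> 'a \<Rightarrow> real" where
  "cond_incr f x = (\<integral>\<omega>'. incr f x \<omega>' \<partial>P)"

lemma measurable_incr:
  assumes [measurable]: "f \<in> borel_measurable (config_space L)"
  shows "(\<lambda>(x, \<omega>'). incr f x \<omega>') \<in> borel_measurable ((P \<Otimes>\<^sub>M L) \<Otimes>\<^sub>M P)"
  unfolding incr_def by measurable

lemma measurable_cond_incr [measurable]: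
  assumes "f \<in> borel_measurable (config_space L)"
  shows "cond_incr f \<in> borel_measurable (P \<Otimes>\<^sub>M L)"
  unfolding cond_incr_def[abs_def] using measurable_incr[OF assms] by (rule borel_measurable_lebesgue_integral)

lemma measurable_incr2:
  assumes [measurable]: "f \<in> borel_measurable (config_space L)" and x[measurable]: "x \<in> space (P \<Otimes>\<^sub>M L)"
  shows "incr f x \<in> borel_measurable P"
  using measurable_compose_Pair1[OF x measurable_incr[OF assms(1)]] by simp

text \<open>The law of the future is transported back to \<open>P\<close>, and the restriction to
  the complement is replaced by \<open>future\<close>. They differ only for \<omega>' in a null set,
  which is integrated out, so the equality holds at every \<omega> and y.\<close>

lemma cond_diff_eq:
  assumes f[measurable]: "f \<in> borel_measurable (config_space L)" and w: "\<omega> \<in> space P" and y[measurable]: "y \<in> space L"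
  shows "cond_diff P L \<eta> prec f \<omega> y = cond_incr f (\<omega>, y)"
proof -
  let ?C = "space L - down y"
  have C[measurable]: "?C \<in> sets L" using down_sets[OF y] by auto
  have pc: "past (\<eta> \<omega>) y \<in> int_valued_measures L" using w y by (intro past_config eta_config)
  then have [measurable]: "past (\<eta> \<omega>) y \<in> space (config_space L)" by (simp add: space_config_space)
  let ?g = "\<lambda>\<mu>. f (add_measure (add_measure (past (\<eta> \<omega>) y) \<mu>) (return L y)) - f (add_measure (past (\<eta> \<omega>) y) \<mu>)"
  have g: "diff_op y f (add_measure (past (\<eta> \<omega>) y) \<mu>) = ?g \<mu>" for \<mu>
    using config_spaceD(1)[OF pc] by (simp add: diff_op_def cong: return_cong)
  have g_meas: "?g \<in> borel_measurable (config_space L)" by measurable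
  have r_meas: "(\<lambda>\<omega>. restr_measure (\<eta> \<omega>) ?C) \<in> measurable P (config_space L)"
    using measurable_compose[OF measurable_eta measurable_restr_measure[OF C]] .
  have "cond_diff P L \<eta> prec f \<omega> y = (\<integral>\<omega>'. ?g (restr_measure (\<eta> \<omega>') ?C) \<partial>P)"
    unfolding cond_diff_def future_law_def g by (rule integral_distr[OF r_meas g_meas])
  also have "\<dots> = (\<integral>\<omega>'. ?g (future (\<eta> \<omega>') y) \<partial>P)"
  proof (rule integral_cong_AE)
    show "AE \<omega>' in P. ?g (restr_measure (\<eta> \<omega>') ?C) = ?g (future (\<eta> \<omega>') y)"
      using AE_future by eventually_elim simp
    show "(\<lambda>\<omega>'. ?g (restr_measure (\<eta> \<omega>') ?C)) \<in> borel_measurable P"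
      using measurable_compose[OF r_meas g_meas] .
  qed measurable
  finally show ?thesis by (simp add: cond_incr_def incr_def mix_def)
qed

text \<open>The difference is bounded by the sum of absolute values. For fixed y the mixed
  configuration has the law of \<eta>; then Mecke's formula turns the added point into the count in
  \<open>B\<close>, while the other term yields the intensity of \<open>B\<close>.\<close>

lemma nn_integral_incr_le:
  assumes f[measurable]: "f \<in> borel_measurable (config_space L)" and B[measurable]: "B \<in> sets L" and fin: "emeasure L B < \<infinity>"
  shows "(\<integral>\<^sup>+x. (\<integral>\<^sup>+\<omega>'. ennreal \<bar>incr f x \<omega>'\<bar> \<partial>P) * indicator B (snd x) \<partial>(P \<Otimes>\<^sub>M L)) \<le>
    (\<integral>\<^sup>+\<omega>. ennreal \<bar>f (\<eta> \<omega>)\<bar> * (emeasure (\<eta> \<omega>) B + emeasure L B) \<partial>P)"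
proof -
  interpret PL: pair_sigma_finite P L ..
  note [measurable] = measurable_incr[OF f]
  let ?F = "\<lambda>y \<mu>. ennreal \<bar>f (add_measure \<mu> (return L y))\<bar> + ennreal \<bar>f \<mu>\<bar>"
  have "(\<integral>\<^sup>+x. (\<integral>\<^sup>+\<omega>'. ennreal \<bar>incr f x \<omega>'\<bar> \<partial>P) * indicator B (snd x) \<partial>(P \<Otimes>\<^sub>M L)) \<le>
     (\<integral>\<^sup>+x. (\<integral>\<^sup>+\<omega>'. ?F (snd x) (mix (fst x) \<omega>' (snd x)) \<partial>P) * indicator B (snd x) \<partial>(P \<Otimes>\<^sub>M L))"
    unfolding incr_def
    by (intro nn_integral_mono mult_right_mono) (auto simp flip: ennreal_plus intro!: ennreal_leI)
  also have "\<dots> = (\<integral>\<^sup>+y. (\<integral>\<^sup>+\<omega>. (\<integral>\<^sup>+\<omega>'. ?F y (mix \<omega> \<omega>' y) \<partial>P) * indicator B y \<partial>P) \<partial>L)"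
    by (subst PL.nn_integral_snd[symmetric]) simp_all
  also have "\<dots> = (\<integral>\<^sup>+y. (\<integral>\<^sup>+\<omega>. ?F y (\<eta> \<omega>) \<partial>P) * indicator B y \<partial>L)"
  proof (rule nn_integral_cong)
    fix y assume y[measurable]: "y \<in> space L"
    have "(\<integral>\<^sup>+\<omega>. (\<integral>\<^sup>+\<omega>'. ?F y (mix \<omega> \<omega>' y) \<partial>P) * indicator B y \<partial>P) = (\<integral>\<^sup>+\<omega>. (\<integral>\<^sup>+\<omega>'. ?F y (mix \<omega> \<omega>' y) \<partial>P) \<partial>P) * indicator B y"
      by (rule nn_integral_multc) measurable
    also have "(\<integral>\<^sup>+\<omega>. (\<integral>\<^sup>+\<omega>'. ?F y (mix \<omega> \<omega>' y) \<partial>P) \<partial>P) = (\<integral>\<^sup>+\<omega>. ?F y (\<eta> \<omega>) \<partial>P)"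
      by (rule nn_integral_mix[OF y]) measurable
    finally show "(\<integral>\<^sup>+\<omega>. (\<integral>\<^sup>+\<omega>'. ?F y (mix \<omega> \<omega>' y) \<partial>P) * indicator B y \<partial>P) = (\<integral>\<^sup>+\<omega>. ?F y (\<eta> \<omega>) \<partial>P) * indicator B y" .
  qed
  also have "\<dots> = (\<integral>\<^sup>+y. (\<integral>\<^sup>+\<omega>. ?F y (\<eta> \<omega>) * indicator B y \<partial>P) \<partial>L)"
    by (intro nn_integral_cong nn_integral_multc[symmetric]) measurable
  also have "\<dots> = (\<integral>\<^sup>+\<omega>. (\<integral>\<^sup>+y. ?F y (\<eta> \<omega>) * indicator B y \<partial>L) \<partial>P)"
    by (rule PL.Fubini') measurable
  also have "\<dots> = (\<integral>\<^sup>+\<omega>. (\<integral>\<^sup>+y\<in>B. ennreal \<bar>f (add_measure (\<eta> \<omega>) (return L y))\<bar> \<partial>L) + ennreal \<bar>f (\<eta> \<omega>)\<bar> * emeasure L B \<partial>P)"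
    by (intro nn_integral_cong) (simp add: distrib_right nn_integral_add nn_integral_cmult_indicator)
  also have "\<dots> = (\<integral>\<^sup>+\<omega>. (\<integral>\<^sup>+y\<in>B. ennreal \<bar>f (add_measure (\<eta> \<omega>) (return L y))\<bar> \<partial>L) \<partial>P) + (\<integral>\<^sup>+\<omega>. ennreal \<bar>f (\<eta> \<omega>)\<bar> * emeasure L B \<partial>P)"
    by (rule nn_integral_add) measurable
  also have "(\<integral>\<^sup>+\<omega>. (\<integral>\<^sup>+y\<in>B. ennreal \<bar>f (add_measure (\<eta> \<omega>) (return L y))\<bar> \<partial>L) \<partial>P) = (\<integral>\<^sup>+\<omega>. ennreal \<bar>f (\<eta> \<omega>)\<bar> * emeasure (\<eta> \<omega>) B \<partial>P)"
    by (rule mecke[OF B fin]) measurable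
  also have "\<dots> + (\<integral>\<^sup>+\<omega>. ennreal \<bar>f (\<eta> \<omega>)\<bar> * emeasure L B \<partial>P) = (\<integral>\<^sup>+\<omega>. ennreal \<bar>f (\<eta> \<omega>)\<bar> * (emeasure (\<eta> \<omega>) B + emeasure L B) \<partial>P)"
    by (simp add: nn_integral_add distrib_left)
  finally show ?thesis .
qed

end

section \<open>The isometry on Laplace functionals\<close>

context poisson begin

section \<open>Square-integrable functionals, covariances and second moments\<close>

abbreviation "L2 \<equiv> L2_functionals P L \<eta>"
abbreviation "cov f g \<equiv> covariance P (\<lambda>\<omega>. f (\<eta> \<omega>)) (\<lambda>\<omega>. g (\<eta> \<omega>))"

definition second_moment :: "('a measure \<Rightarrow> real) \<Rightarrow> real" where "second_moment f = (\<integral>\<omega>. (f (\<eta> \<omega>))\<^sup>2 \<partial>P)"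

lemma second_moment_nonneg [simp]: "0 \<le> second_moment f" by (simp add: second_moment_def)

lemma L2D:
  assumes "f \<in> L2"
  shows "f \<in> borel_measurable (config_space L)" "integrable P (\<lambda>\<omega>. (f (\<eta> \<omega>))\<^sup>2)"
  using assms by (auto simp: L2_functionals_def)

lemma L2_mult_integrable: "f \<in> L2 \<Longrightarrow> g \<in> L2 \<Longrightarrow> integrable P (\<lambda>\<omega>. f (\<eta> \<omega>) * g (\<eta> \<omega>))"
  using L2D[of f] L2D[of g] by (intro square_integrable_mult) (auto intro: measurable_compose[OF measurable_eta])

lemma L2_bounded:
  assumes f[measurable]: "f \<in> borel_measurable (config_space L)"
    and C: "\<And>\<mu>. \<mu> \<in> int_valued_measures L \<Longrightarrow> \<bar>f \<mu>\<bar> \<le> C"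
  shows "f \<in> L2"
proof -
  have "integrable P (\<lambda>\<omega>. (f (\<eta> \<omega>))\<^sup>2)"
  proof (rule integrable_const_bound[of _ "C\<^sup>2"])
    show "AE \<omega> in P. norm ((f (\<eta> \<omega>))\<^sup>2) \<le> C\<^sup>2"
      using C[OF eta_config] by (intro AE_I2) (auto simp: abs_le_square_iff[symmetric] intro: order_trans[OF _ abs_ge_self])
  qed measurable
  then show ?thesis by (simp add: L2_functionals_def)
qed

lemma L2_const: "(\<lambda>_. c) \<in> L2" by (rule L2_bounded[of _ "\<bar>c\<bar>"]) auto

lemma L2_integrable: "f \<in> L2 \<Longrightarrow> integrable P (\<lambda>\<omega>. f (\<eta> \<omega>))"
  using L2_mult_integrable[OF _ L2_const[of 1]] by simp

lemma L2_add:
  assumes f: "f \<in> L2" and g: "g \<in> L2"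
  shows "(\<lambda>\<mu>. f \<mu> + g \<mu>) \<in> L2"
proof -
  have "(\<lambda>\<omega>. (f (\<eta> \<omega>) + g (\<eta> \<omega>))\<^sup>2) = (\<lambda>\<omega>. (f (\<eta> \<omega>))\<^sup>2 + 2 * (f (\<eta> \<omega>) * g (\<eta> \<omega>)) + (g (\<eta> \<omega>))\<^sup>2)"
    by (simp add: fun_eq_iff power2_eq_square algebra_simps)
  then have "integrable P (\<lambda>\<omega>. (f (\<eta> \<omega>) + g (\<eta> \<omega>))\<^sup>2)"
    using L2D[OF f] L2D[OF g] L2_mult_integrable[OF f g] by simp
  then show ?thesis using L2D[OF f] L2D[OF g] by (simp add: L2_functionals_def)
qed

lemma L2_scale: "f \<in> L2 \<Longrightarrow> (\<lambda>\<mu>. c * f \<mu>) \<in> L2"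
  by (auto simp: L2_functionals_def power_mult_distrib)

lemma L2_diff: "f \<in> L2 \<Longrightarrow> g \<in> L2 \<Longrightarrow> (\<lambda>\<mu>. f \<mu> - g \<mu>) \<in> L2"
  using L2_add[of f "\<lambda>\<mu>. (-1) * g \<mu>"] L2_scale[of g "-1"] by simp

lemma lap_span_L2: "s \<in> lap_span L \<Longrightarrow> s \<in> L2"
  using lap_span_bounded[of s L] L2_bounded[OF lap_span_measurable] by blast

lemma cov_eq:
  assumes "f \<in> L2" "g \<in> L2"
  shows "cov f g = (\<integral>\<omega>. f (\<eta> \<omega>) * g (\<eta> \<omega>) \<partial>P) - (\<integral>\<omega>. f (\<eta> \<omega>) \<partial>P) * (\<integral>\<omega>. g (\<eta> \<omega>) \<partial>P)"
proof -
  define a b where "a = (\<integral>\<omega>. f (\<eta> \<omega>) \<partial>P)" and "b = (\<integral>\<omega>. g (\<eta> \<omega>) \<partial>P)"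
  have "cov f g = (\<integral>\<omega>. f (\<eta> \<omega>) * g (\<eta> \<omega>) - a * g (\<eta> \<omega>) - b * f (\<eta> \<omega>) + a * b \<partial>P)"
    unfolding covariance_def a_def[symmetric] b_def[symmetric] by (simp add: algebra_simps)
  also have "\<dots> = (\<integral>\<omega>. f (\<eta> \<omega>) * g (\<eta> \<omega>) \<partial>P) - a * b - b * a + a * b"
    using assms by (simp add: L2_mult_integrable L2_integrable a_def b_def prob_space)
  finally show ?thesis by (simp add: a_def b_def)
qed

lemma cov_add:
  assumes "f \<in> L2" "g \<in> L2" "h \<in> L2"
  shows "cov (\<lambda>\<mu>. f \<mu> + g \<mu>) h = cov f h + cov g h"
  unfolding cov_eq[OF L2_add[OF assms(1,2)] assms(3)] cov_eq[OF assms(1,3)] cov_eq[OF assms(2,3)]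
  using assms by (simp add: L2_mult_integrable L2_integrable distrib_right)

lemma cov_scale:
  assumes "f \<in> L2" "h \<in> L2"
  shows "cov (\<lambda>\<mu>. c * f \<mu>) h = c * cov f h"
  unfolding cov_eq[OF L2_scale[OF assms(1)] assms(2)] cov_eq[OF assms]
  by (simp add: mult.assoc right_diff_distrib)

lemma cov_commute: "cov f g = cov g f"
  by (simp add: covariance_def mult.commute)

lemma cov_self_le: "f \<in> L2 \<Longrightarrow> cov f f \<le> second_moment f"
  by (simp add: cov_eq second_moment_def power2_eq_square)

text \<open>Cauchy-Schwarz for the centred functionals, whose variances are at most the second
  moments.\<close>

lemma cov_square_le:
  assumes f: "f \<in> L2" and g: "g \<in> L2"
  shows "(cov f g)\<^sup>2 \<le> second_moment f * second_moment g"
proof -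
  have nn: "0 \<le> cov f f" for f
    by (simp add: covariance_def power2_eq_square[symmetric])
  have c: "(\<lambda>\<mu>. f \<mu> - c) \<in> L2" "(\<lambda>\<mu>. g \<mu> - c) \<in> L2" for c
    using f g L2_const[of c] by (auto intro: L2_diff)
  have "(cov f g)\<^sup>2 \<le> cov f f * cov g g"
    unfolding covariance_def power2_eq_square[symmetric]
    using L2D[OF c(1)] L2D[OF c(2)]
    by (intro Cauchy_Schwarz_integral) (auto intro: measurable_compose[OF measurable_eta])
  also have "\<dots> \<le> second_moment f * second_moment g"
    by (intro mult_mono cov_self_le f g nn second_moment_nonneg)
  finally show ?thesis .
qed

lemma lap_span_approx:
  assumes f: "f \<in> L2" and e: "e > 0"
  shows "\<exists>s\<in>lap_span L. second_moment (\<lambda>\<mu>. f \<mu> - s \<mu>) \<le> e"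
proof -
  let ?N = "distr P (config_space L) \<eta>"
  note [measurable] = L2D(1)[OF f]
  have "lap_approx L ?N f"
  proof (rule L.lap_approx_L2)
    show "finite_measure ?N" by (rule finite_measure_distr) measurable
    show "integrable ?N (\<lambda>\<mu>. (f \<mu>)\<^sup>2)"
      using L2D(2)[OF f] by (subst integrable_distr_eq) measurable
  qed auto
  then obtain s where s: "s \<in> lap_span L" "(\<integral>\<^sup>+\<mu>. ennreal ((f \<mu> - s \<mu>)\<^sup>2) \<partial>?N) \<le> ennreal e"
    using e unfolding lap_approx_def by blast
  have [measurable]: "s \<in> borel_measurable (config_space L)" using s(1) by (rule lap_span_measurable)
  have "(\<integral>\<^sup>+\<mu>. ennreal ((f \<mu> - s \<mu>)\<^sup>2) \<partial>?N) = (\<integral>\<^sup>+\<omega>. ennreal ((f (\<eta> \<omega>) - s (\<eta> \<omega>))\<^sup>2) \<partial>P)"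
    by (rule nn_integral_distr) measurable
  also have "\<dots> = ennreal (second_moment (\<lambda>\<mu>. f \<mu> - s \<mu>))"
    unfolding second_moment_def using L2D(2)[OF L2_diff[OF f lap_span_L2[OF s(1)]]] by (intro nn_integral_eq_integral) auto
  finally show ?thesis using s e by (auto simp: ennreal_le_iff)
qed

text \<open>The squared L^2 norm of the random weight in \<open>nn_integral_incr_le\<close>;
  together with Cauchy-Schwarz it bounds the L^1 norm of the increments over \<open>B\<close> by the
  L^2 norm of the functional.\<close>

definition count_weight :: "'a set \<Rightarrow> real" where
  "count_weight B = (\<integral>\<omega>. (measure (\<eta> \<omega>) B + measure L B)\<^sup>2 \<partial>P)"

lemma nn_integral_weighted_le:
  assumes f: "f \<in> L2" and B[measurable]: "B \<in> sets L" and fin: "emeasure L B < \<infinity>"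
  shows "(\<integral>\<^sup>+\<omega>. ennreal \<bar>f (\<eta> \<omega>)\<bar> * (emeasure (\<eta> \<omega>) B + emeasure L B) \<partial>P) \<le> ennreal (sqrt (second_moment f * count_weight B))"
proof -
  note [measurable] = L2D(1)[OF f]
  have [measurable]: "(\<lambda>\<omega>. measure (\<eta> \<omega>) B) \<in> borel_measurable P"
    unfolding measure_def by measurable
  let ?W = "\<lambda>\<omega>. measure (\<eta> \<omega>) B + measure L B"
  have W: "integrable P (\<lambda>\<omega>. (?W \<omega>)\<^sup>2)"
    using integrable_count_square[OF B fin] integral_count(2)[OF B fin] by (simp add: power2_sum)
  have f2: "integrable P (\<lambda>\<omega>. \<bar>f (\<eta> \<omega>)\<bar>\<^sup>2)" using L2D(2)[OF f] by simp
  have "(\<integral>\<^sup>+\<omega>. ennreal \<bar>f (\<eta> \<omega>)\<bar> * (emeasure (\<eta> \<omega>) B + emeasure L B) \<partial>P) = (\<integral>\<^sup>+\<omega>. ennreal (\<bar>f (\<eta> \<omega>)\<bar> * ?W \<omega>) \<partial>P)"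
    using integral_count(1)[OF B fin] fin
    by (intro nn_integral_cong_AE) (auto simp: emeasure_eq_ennreal_measure ennreal_mult)
  also have "\<dots> = ennreal (\<integral>\<omega>. \<bar>f (\<eta> \<omega>)\<bar> * ?W \<omega> \<partial>P)"
    by (intro nn_integral_eq_integral square_integrable_mult f2 W) auto
  also have "\<dots> \<le> ennreal (sqrt (second_moment f * count_weight B))"
    using Cauchy_Schwarz_integral[OF _ _ f2 W]
    by (intro ennreal_leI real_le_rsqrt) (simp add: second_moment_def count_weight_def)
  finally show ?thesis .
qed

end

section \<open>Conditional increments of square-integrable functionals\<close>

context poisson_order begin

text \<open>Over each set of the exhaustion the absolute increments have finite total integral,
  hence the inner integral is finite almost everywhere. The Bochner integral takes the value 0
  elsewhere and need not be additive there, so linearity depends on this.\<close>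

lemma AE_integrable_incr:
  assumes f: "f \<in> L2"
  shows "AE x in P \<Otimes>\<^sub>M L. integrable P (incr f x)"
proof -
  note [measurable] = L2D(1)[OF f] and [measurable] = measurable_incr[OF L2D(1)[OF f]]
  let ?G = "\<lambda>x. \<integral>\<^sup>+\<omega>'. ennreal \<bar>incr f x \<omega>'\<bar> \<partial>P"
  have "AE x in P \<Otimes>\<^sub>M L. ?G x * indicator (exhaust i) (snd x) \<noteq> \<infinity>" for i
  proof (rule nn_integral_PInf_AE)
    have "(\<integral>\<^sup>+x. ?G x * indicator (exhaust i) (snd x) \<partial>(P \<Otimes>\<^sub>M L)) \<le> ennreal (sqrt (second_moment f * count_weight (exhaust i)))"
      using nn_integral_incr_le[OF L2D(1)[OF f] exhaust(1,3)] nn_integral_weighted_le[OF f exhaust(1,3)]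
      by (rule order_trans)
    then show "(\<integral>\<^sup>+x. ?G x * indicator (exhaust i) (snd x) \<partial>(P \<Otimes>\<^sub>M L)) \<noteq> \<infinity>"
      by (auto simp: top_unique)
  qed measurable
  then have "AE x in P \<Otimes>\<^sub>M L. \<forall>i. ?G x * indicator (exhaust i) (snd x) \<noteq> \<infinity>"
    by (simp add: AE_all_countable)
  then show ?thesis using AE_space
  proof eventually_elim
    case (elim x)
    then have "snd x \<in> (\<Union>i. exhaust i)"
      unfolding exhaust(2) by (auto simp: space_pair_measure)
    then obtain i where "snd x \<in> exhaust i" by blast
    then have "?G x < \<infinity>" using elim(1)[rule_format, of i] by (simp add: less_top)
    then show ?case using measurable_incr2[OF L2D(1)[OF f] elim(2)] by (intro integrableI_bounded) auto
  qed
qed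

lemma cond_incr_add:
  assumes f: "f \<in> L2" and g: "g \<in> L2"
  shows "AE x in P \<Otimes>\<^sub>M L. cond_incr (\<lambda>\<mu>. f \<mu> + g \<mu>) x = cond_incr f x + cond_incr g x"
  using AE_integrable_incr[OF f] AE_integrable_incr[OF g]
proof eventually_elim
  case (elim x)
  have "incr (\<lambda>\<mu>. f \<mu> + g \<mu>) x = (\<lambda>\<omega>'. incr f x \<omega>' + incr g x \<omega>')" by (simp add: incr_def fun_eq_iff)
  then show ?case using elim by (simp add: cond_incr_def)
qed

text \<open>Unlike additivity this holds everywhere: for c \<noteq> 0 scaling does not affect
  integrability, so the default value 0 appears on both sides at once.\<close>

lemma cond_incr_scale: "cond_incr (\<lambda>\<mu>. c * f \<mu>) x = c * cond_incr f x"
  by (simp add: cond_incr_def incr_def right_diff_distrib[symmetric])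

lemma cond_incr_diff:
  assumes f: "f \<in> L2" and g: "g \<in> L2"
  shows "AE x in P \<Otimes>\<^sub>M L. cond_incr (\<lambda>\<mu>. f \<mu> - g \<mu>) x = cond_incr f x - cond_incr g x"
  using cond_incr_add[OF f L2_scale[OF g, of "-1"]] by (simp add: cond_incr_scale[of "-1", simplified])

lemma cond_incr_cong:
  assumes fg: "\<And>\<mu>. \<mu> \<in> int_valued_measures L \<Longrightarrow> f \<mu> = g \<mu>" and x: "x \<in> space (P \<Otimes>\<^sub>M L)"
  shows "cond_incr f x = cond_incr g x"
  unfolding cond_incr_def incr_def using x
  by (intro Bochner_Integration.integral_cong refl)
    (auto simp: space_pair_measure intro!: arg_cong2[where f = "(-)"] fg mix_config add_measure_config return_config)

lemma nn_integral_cond_incr_le: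
  assumes f: "f \<in> L2" and B[measurable]: "B \<in> sets L" and fin: "emeasure L B < \<infinity>"
  shows "(\<integral>\<^sup>+x. ennreal \<bar>cond_incr f x\<bar> * indicator B (snd x) \<partial>(P \<Otimes>\<^sub>M L)) \<le> ennreal (sqrt (second_moment f * count_weight B))"
proof -
  \<comment> \<open>Where the increment is not integrable, the left-hand side is the default value
    0.\<close>
  have "ennreal \<bar>cond_incr f x\<bar> \<le> (\<integral>\<^sup>+\<omega>'. ennreal \<bar>incr f x \<omega>'\<bar> \<partial>P)" for x
  proof (cases "integrable P (incr f x)")
    case True
    then show ?thesis using integral_norm_bound_ennreal[OF True] by (simp add: cond_incr_def)
  qed (simp add: cond_incr_def not_integrable_integral_eq)
  then have "(\<integral>\<^sup>+x. ennreal \<bar>cond_incr f x\<bar> * indicator B (snd x) \<partial>(P \<Otimes>\<^sub>M L)) \<le>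
     (\<integral>\<^sup>+x. (\<integral>\<^sup>+\<omega>'. ennreal \<bar>incr f x \<omega>'\<bar> \<partial>P) * indicator B (snd x) \<partial>(P \<Otimes>\<^sub>M L))"
    by (intro nn_integral_mono mult_right_mono) auto
  also have "\<dots> \<le> ennreal (sqrt (second_moment f * count_weight B))"
    using nn_integral_incr_le[OF L2D(1)[OF f] B fin] nn_integral_weighted_le[OF f B fin]
    by (rule order_trans)
  finally show ?thesis .
qed

text \<open>The Laplace functional of the mixed configuration is a product of a past and a future
  factor, and the extra point contributes exp (- h y). Averaging over \<omega>' replaces the future
  factor by its mean.\<close>

lemma cond_incr_lap:
  assumes h[measurable]: "h \<in> borel_measurable L" and w: "\<omega> \<in> space P" and y[measurable]: "y \<in> space L"
  shows "cond_incr (lap h) (\<omega>, y) = - ((1 - exp_neg (h y)) * lap h (past (\<eta> \<omega>) y) *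
    exp_neg (\<integral>\<^sup>+z\<in>space L - down y. ennreal (1 - exp_neg (h z)) \<partial>L))"
proof -
  have "incr (lap h) (\<omega>, y) \<omega>' = - ((1 - exp_neg (h y)) * lap h (past (\<eta> \<omega>) y)) * lap h (future (\<eta> \<omega>') y)"
    if w': "\<omega>' \<in> space P" for \<omega>'
  proof -
    have p: "past (\<eta> \<omega>) y \<in> int_valued_measures L" "future (\<eta> \<omega>') y \<in> int_valued_measures L"
      using w w' y by (auto intro: past_config future_config eta_config)
    then have m: "lap h (mix \<omega> \<omega>' y) = lap h (past (\<eta> \<omega>) y) * lap h (future (\<eta> \<omega>') y)"
      unfolding mix_def by (rule lap_add_measure[OF h])
    have "lap h (add_measure (mix \<omega> \<omega>' y) (return L y)) = lap h (mix \<omega> \<omega>' y) * exp_neg (h y)"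
      using mix_config[OF w w' y] y by (simp add: lap_add_measure[OF h] return_config lap_return)
    then show ?thesis using m by (simp add: incr_def algebra_simps)
  qed
  then have "cond_incr (lap h) (\<omega>, y) = (\<integral>\<omega>'. - ((1 - exp_neg (h y)) * lap h (past (\<eta> \<omega>) y)) * lap h (future (\<eta> \<omega>') y) \<partial>P)"
    unfolding cond_incr_def by (intro Bochner_Integration.integral_cong refl)
  then show ?thesis by (simp add: integral_lap_future[OF h y])
qed

text \<open>For fixed y only the factor \<open>lap (h + k)\<close> of the past is random, and
  \<open>integral_lap_past\<close> gives its mean. What remains is exp (- A) times an integral
  against \<nu>, known from \<open>nn_integral_exp_measure_down\<close>.\<close>

lemma nn_integral_cond_incr_lap:
  assumes h: "h \<in> lap_funs L" and k: "k \<in> lap_funs L"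
  shows "(\<integral>\<^sup>+x. ennreal (cond_incr (lap h) x * cond_incr (lap k) x) \<partial>(P \<Otimes>\<^sub>M L)) = ennreal (cov (lap h) (lap k))"
    and "x \<in> space (P \<Otimes>\<^sub>M L) \<Longrightarrow> 0 \<le> cond_incr (lap h) x * cond_incr (lap k) x"
proof -
  interpret PL: pair_sigma_finite P L ..
  have hk[measurable]: "h \<in> borel_measurable L" "k \<in> borel_measurable L"
    using h k by (auto intro: lap_funs_measurable)
  let ?u = "\<lambda>z. ennreal (1 - exp_neg (h z))" and ?v = "\<lambda>z. ennreal (1 - exp_neg (k z))"
  let ?w = "\<lambda>z. ennreal (1 - exp_neg (h z + k z))"
  let ?uv = "\<lambda>z. ennreal ((1 - exp_neg (h z)) * (1 - exp_neg (k z)))"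
  define \<nu> where "\<nu> = density L ?uv"
  define A where "A = (\<integral>\<^sup>+z. ?u z \<partial>L) + (\<integral>\<^sup>+z. ?v z \<partial>L)"
  have A: "A < \<infinity>" using h k by (simp add: A_def lap_funs_def)
  \<comment> \<open>This is w = u + v - u v, arranged as a sum to avoid truncated
    subtraction.\<close>
  have uv_w: "?u z + ?v z = ?w z + ?uv z" for z
  proof -
    have "?u z + ?v z = ennreal ((1 - exp_neg (h z)) + (1 - exp_neg (k z)))"
      by (rule ennreal_plus[symmetric]) simp_all
    also have "\<dots> = ennreal ((1 - exp_neg (h z + k z)) + (1 - exp_neg (h z)) * (1 - exp_neg (k z)))"
      by (simp add: exp_neg_add algebra_simps)
    also have "\<dots> = ?w z + ?uv z"
      by (rule ennreal_plus) simp_all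
    finally show ?thesis .
  qed
  have s[simp]: "sets \<nu> = sets L" "space \<nu> = space L" by (simp_all add: \<nu>_def)
  have nu: "emeasure \<nu> B = (\<integral>\<^sup>+z\<in>B. ?uv z \<partial>L)" if "B \<in> sets L" for B
    using that by (simp add: \<nu>_def emeasure_density)
  have split: "(\<integral>\<^sup>+z\<in>B. ?u z \<partial>L) + (\<integral>\<^sup>+z\<in>B. ?v z \<partial>L) = (\<integral>\<^sup>+z\<in>B. ?w z \<partial>L) + emeasure \<nu> B"
    if [measurable]: "B \<in> sets L" for B
    by (simp add: nu nn_integral_add[symmetric] distrib_right[symmetric] uv_w)
  have "(\<integral>\<^sup>+z\<in>space L. f z \<partial>L) = (\<integral>\<^sup>+z. f z \<partial>L)" for f
    by (intro nn_integral_cong) simp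
  then have A_eq: "A = (\<integral>\<^sup>+z. ?w z \<partial>L) + emeasure \<nu> (space L)"
    using split[OF sets.top] by (simp add: A_def)
  then have "emeasure \<nu> (space \<nu>) \<noteq> \<infinity>" using A by auto
  then interpret N: finite_measure \<nu> by (rule finite_measureI)
  have ac: "absolutely_continuous L \<nu>"
    unfolding \<nu>_def by (rule absolutely_continuousI_density) measurable
  \<comment> \<open>Adding a point can only decrease a Laplace functional, so both conditional
    increments are nonpositive and their product is nonnegative. The nonnegative integral and
    Tonelli's theorem therefore apply directly.\<close>
  have T: "cond_incr (lap h) (\<omega>, y) * cond_incr (lap k) (\<omega>, y) =
      (1 - exp_neg (h y)) * (1 - exp_neg (k y)) * exp_neg (\<integral>\<^sup>+z\<in>space L - down y. ?u z \<partial>L) * exp_neg (\<integral>\<^sup>+z\<in>space L - down y. ?v z \<partial>L)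
        * lap (\<lambda>z. h z + k z) (past (\<eta> \<omega>) y)"
    if "\<omega> \<in> space P" "y \<in> space L" for \<omega> y
    using that
    by (simp add: cond_incr_lap[OF hk(1)] cond_incr_lap[OF hk(2)] lap_add_fun[OF hk past_config[OF eta_config]])
  then show "x \<in> space (P \<Otimes>\<^sub>M L) \<Longrightarrow> 0 \<le> cond_incr (lap h) x * cond_incr (lap k) x"
    by (cases x) (auto simp: space_pair_measure)
  have inner: "(\<integral>\<^sup>+\<omega>. ennreal (cond_incr (lap h) (\<omega>, y) * cond_incr (lap k) (\<omega>, y)) \<partial>P) =
      ennreal (exp_neg A) * (?uv y * ennreal (exp (measure \<nu> (down y))))" if y: "y \<in> space L" for y
  proof -
    have d[measurable]: "down y \<in> sets L" and [measurable]: "y \<in> space L" using y by (auto intro: down_sets)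
    let ?hC = "\<integral>\<^sup>+z\<in>space L - down y. ?u z \<partial>L" and ?kC = "\<integral>\<^sup>+z\<in>space L - down y. ?v z \<partial>L"
    let ?c = "(1 - exp_neg (h y)) * (1 - exp_neg (k y)) * exp_neg ?hC * exp_neg ?kC"
    have "A = (?hC + ?kC) + ((\<integral>\<^sup>+z\<in>down y. ?u z \<partial>L) + (\<integral>\<^sup>+z\<in>down y. ?v z \<partial>L))"
    proof -
      have "(\<integral>\<^sup>+z\<in>down y. ?u z \<partial>L) + ?hC = (\<integral>\<^sup>+z. ?u z \<partial>L)" "(\<integral>\<^sup>+z\<in>down y. ?v z \<partial>L) + ?kC = (\<integral>\<^sup>+z. ?v z \<partial>L)"
        by (intro nn_integral_split_down[OF _ y]; measurable)+
      moreover have "a + c = u \<Longrightarrow> b + d = v \<Longrightarrow> u + v = (c + d) + (a + b)" for a b c d u v :: ennreal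
        by (auto simp: ac_simps)
      ultimately show ?thesis unfolding A_def by blast
    qed
    \<comment> \<open>Outside the past the exponents of \<open>h\<close> and \<open>k\<close> are
      kept apart, inside it they are merged into w and \<nu>. As \<nu>(down y) is finite, its
      exponential can then be moved to the other side.\<close>
    then have "exp_neg A = exp_neg ?hC * exp_neg ?kC * (exp_neg (\<integral>\<^sup>+z\<in>down y. ?w z \<partial>L) * exp_neg (emeasure \<nu> (down y)))"
      by (simp only: split[OF d] exp_neg_add)
    moreover have "exp_neg (emeasure \<nu> (down y)) = exp (- measure \<nu> (down y))"
      by (simp add: N.emeasure_eq_measure exp_neg_ennreal)
    ultimately have key: "exp_neg ?hC * exp_neg ?kC * exp_neg (\<integral>\<^sup>+z\<in>down y. ?w z \<partial>L) = exp_neg A * exp (measure \<nu> (down y))"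
      by (simp add: exp_minus field_simps)
    have "(\<integral>\<^sup>+\<omega>. ennreal (cond_incr (lap h) (\<omega>, y) * cond_incr (lap k) (\<omega>, y)) \<partial>P) =
        (\<integral>\<^sup>+\<omega>. ennreal (?c * lap (\<lambda>z. h z + k z) (past (\<eta> \<omega>) y)) \<partial>P)"
      by (intro nn_integral_cong) (simp only: T[OF _ y])
    also have "\<dots> = ennreal (\<integral>\<omega>. ?c * lap (\<lambda>z. h z + k z) (past (\<eta> \<omega>) y) \<partial>P)"
    proof (rule nn_integral_eq_integral)
      have "integrable P (\<lambda>\<omega>. lap (\<lambda>z. h z + k z) (past (\<eta> \<omega>) y))"
        by (rule integrable_const_bound[of _ 1]) auto
      then show "integrable P (\<lambda>\<omega>. ?c * lap (\<lambda>z. h z + k z) (past (\<eta> \<omega>) y))" by simp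
    qed auto
    also have "(\<integral>\<omega>. ?c * lap (\<lambda>z. h z + k z) (past (\<eta> \<omega>) y) \<partial>P) = ?c * exp_neg (\<integral>\<^sup>+z\<in>down y. ?w z \<partial>L)"
      using integral_lap_past[of "\<lambda>z. h z + k z", OF _ y] by simp
    also have "\<dots> = exp_neg A * ((1 - exp_neg (h y)) * (1 - exp_neg (k y)) * exp (measure \<nu> (down y)))"
      using key by (simp add: ac_simps)
    finally show ?thesis by (simp add: ennreal_mult)
  qed
  have [measurable]: "lap h \<in> borel_measurable (config_space L)" "lap k \<in> borel_measurable (config_space L)"
    by measurable
  have m: "(\<lambda>y. measure \<nu> (down y)) \<in> borel_measurable L"
    unfolding measure_def
    by (rule measurable_compose[OF measurable_emeasure_down[OF N.finite_measure_axioms s(1)]]) measurable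
  have "(\<integral>\<^sup>+x. ennreal (cond_incr (lap h) x * cond_incr (lap k) x) \<partial>(P \<Otimes>\<^sub>M L)) =
      (\<integral>\<^sup>+y. (\<integral>\<^sup>+\<omega>. ennreal (cond_incr (lap h) (\<omega>, y) * cond_incr (lap k) (\<omega>, y)) \<partial>P) \<partial>L)"
    by (rule PL.nn_integral_snd[symmetric]) measurable
  also have "\<dots> = (\<integral>\<^sup>+y. ennreal (exp_neg A) * (?uv y * ennreal (exp (measure \<nu> (down y)))) \<partial>L)"
    by (intro nn_integral_cong inner)
  also have "\<dots> = ennreal (exp_neg A) * (\<integral>\<^sup>+y. ennreal (exp (measure \<nu> (down y))) \<partial>\<nu>)"
    unfolding \<nu>_def using m[unfolded \<nu>_def] by (simp add: nn_integral_density nn_integral_cmult)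
  also have "\<dots> = ennreal (exp_neg A) * ennreal (exp (measure \<nu> (space L)) - 1)"
    by (simp only: nn_integral_exp_measure_down[OF N.finite_measure_axioms s(1) ac])
  also have "\<dots> = ennreal (exp_neg A * exp (measure \<nu> (space L)) - exp_neg A)"
    by (simp add: ennreal_mult[symmetric] right_diff_distrib)
  \<comment> \<open>The splitting is now used on the whole space: removing \<nu> from A leaves the
    integral of w, the exponent in the mean of \<open>lap (h + k)\<close>.\<close>
  also have "exp_neg A * exp (measure \<nu> (space L)) = (\<integral>\<omega>. lap h (\<eta> \<omega>) * lap k (\<eta> \<omega>) \<partial>P)"
  proof -
    from A_eq have "exp_neg A = exp_neg (\<integral>\<^sup>+z. ?w z \<partial>L) * exp (- measure \<nu> (space L))"
      by (simp add: exp_neg_add N.emeasure_eq_measure exp_neg_ennreal)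
    then have "exp_neg A * exp (measure \<nu> (space L)) = exp_neg (\<integral>\<^sup>+z. ?w z \<partial>L)"
      by (simp add: exp_minus field_simps)
    also have "\<dots> = (\<integral>\<omega>. lap (\<lambda>z. h z + k z) (\<eta> \<omega>) \<partial>P)"
      by (rule laplace[symmetric]) measurable
    also have "\<dots> = (\<integral>\<omega>. lap h (\<eta> \<omega>) * lap k (\<eta> \<omega>) \<partial>P)"
      by (intro Bochner_Integration.integral_cong refl lap_add_fun[OF hk eta_config])
    finally show ?thesis .
  qed
  also have "exp_neg A = (\<integral>\<omega>. lap h (\<eta> \<omega>) \<partial>P) * (\<integral>\<omega>. lap k (\<eta> \<omega>) \<partial>P)"
    by (simp add: laplace A_def exp_neg_add)
  finally show "(\<integral>\<^sup>+x. ennreal (cond_incr (lap h) x * cond_incr (lap k) x) \<partial>(P \<Otimes>\<^sub>M L)) = ennreal (cov (lap h) (lap k))"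
    using h k by (simp add: cov_eq lap_span_L2 lap_span.lap)
qed

end

section \<open>Extension to square-integrable functionals\<close>

context poisson_order begin

abbreviation "PL \<equiv> P \<Otimes>\<^sub>M L"

definition cond_incr_inner :: "('a measure \<Rightarrow> real) \<Rightarrow> ('a measure \<Rightarrow> real) \<Rightarrow> real" where
  "cond_incr_inner f g = (\<integral>x. cond_incr f x * cond_incr g x \<partial>PL)"

definition cond_incr_L2 :: "('a measure \<Rightarrow> real) \<Rightarrow> bool" where
  "cond_incr_L2 f \<longleftrightarrow> integrable PL (\<lambda>x. (cond_incr f x)\<^sup>2)"

lemma cond_incr_inner_commute: "cond_incr_inner f g = cond_incr_inner g f"
  by (simp add: cond_incr_inner_def mult.commute)

lemma integrable_cond_incr_mult:
  assumes "f \<in> L2" "g \<in> L2" "cond_incr_L2 f" "cond_incr_L2 g"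
  shows "integrable PL (\<lambda>x. cond_incr f x * cond_incr g x)"
  using assms L2D(1)[of f] L2D(1)[of g] unfolding cond_incr_L2_def
  by (intro square_integrable_mult measurable_cond_incr)

lemma cond_incr_L2_add:
  assumes f: "f \<in> L2" "cond_incr_L2 f" and g: "g \<in> L2" "cond_incr_L2 g"
  shows "cond_incr_L2 (\<lambda>\<mu>. f \<mu> + g \<mu>)"
proof -
  note [measurable] = L2D(1)[OF f(1)] L2D(1)[OF g(1)]
  have "integrable PL (\<lambda>x. (cond_incr f x)\<^sup>2 + 2 * (cond_incr f x * cond_incr g x) + (cond_incr g x)\<^sup>2)"
    using f g integrable_cond_incr_mult[OF f(1) g(1) f(2) g(2)] by (simp add: cond_incr_L2_def)
  also have "?this \<longleftrightarrow> ?thesis"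
    unfolding cond_incr_L2_def
  proof (rule integrable_cong_AE)
    show "AE x in PL. (cond_incr f x)\<^sup>2 + 2 * (cond_incr f x * cond_incr g x) + (cond_incr g x)\<^sup>2 = (cond_incr (\<lambda>\<mu>. f \<mu> + g \<mu>) x)\<^sup>2"
      using cond_incr_add[OF f(1) g(1)] by eventually_elim (simp add: power2_sum)
  qed measurable
  finally show ?thesis .
qed

lemma cond_incr_L2_scale: "cond_incr_L2 f \<Longrightarrow> cond_incr_L2 (\<lambda>\<mu>. c * f \<mu>)"
  by (simp add: cond_incr_L2_def cond_incr_scale power_mult_distrib)

lemma cond_incr_inner_add:
  assumes f: "f \<in> L2" "cond_incr_L2 f" and g: "g \<in> L2" "cond_incr_L2 g" and h: "h \<in> L2" "cond_incr_L2 h"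
  shows "cond_incr_inner (\<lambda>\<mu>. f \<mu> + g \<mu>) h = cond_incr_inner f h + cond_incr_inner g h"
proof -
  note [measurable] = L2D(1)[OF f(1)] L2D(1)[OF g(1)] L2D(1)[OF h(1)]
  have "cond_incr_inner (\<lambda>\<mu>. f \<mu> + g \<mu>) h = (\<integral>x. cond_incr f x * cond_incr h x + cond_incr g x * cond_incr h x \<partial>PL)"
    unfolding cond_incr_inner_def
  proof (rule integral_cong_AE)
    show "AE x in PL. cond_incr (\<lambda>\<mu>. f \<mu> + g \<mu>) x * cond_incr h x = cond_incr f x * cond_incr h x + cond_incr g x * cond_incr h x"
      using cond_incr_add[OF f(1) g(1)] by eventually_elim (simp add: distrib_right)
  qed measurable
  then show ?thesis
    using integrable_cond_incr_mult[OF f(1) h(1) f(2) h(2)] integrable_cond_incr_mult[OF g(1) h(1) g(2) h(2)] by (simp add: cond_incr_inner_def)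
qed

lemma cond_incr_inner_scale: "cond_incr_inner (\<lambda>\<mu>. c * f \<mu>) h = c * cond_incr_inner f h"
  by (simp add: cond_incr_inner_def cond_incr_scale mult.assoc)

lemma cond_incr_inner_lap:
  assumes h: "h \<in> lap_funs L" and k: "k \<in> lap_funs L"
  shows "cond_incr_inner (lap h) (lap k) = cov (lap h) (lap k)"
proof -
  note [measurable] = L2D(1)[OF lap_span_L2[OF lap_span.lap[OF h]]] L2D(1)[OF lap_span_L2[OF lap_span.lap[OF k]]]
  have AE: "AE x in PL. 0 \<le> cond_incr (lap h) x * cond_incr (lap k) x"
    using nn_integral_cond_incr_lap(2)[OF h k] by (rule AE_I2)
  \<comment> \<open>\<open>ennreal\<close> sends negative reals to 0, so the identity for
    nonnegative integrals determines the covariance only once its sign is known. The sign follows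
    from w \<le> u + v.\<close>
  have cov: "0 \<le> cov (lap h) (lap k)"
  proof -
    have hk[measurable]: "h \<in> borel_measurable L" "k \<in> borel_measurable L"
      using h k by (auto intro: lap_funs_measurable)
    have "cov (lap h) (lap k) = (\<integral>\<omega>. lap (\<lambda>z. h z + k z) (\<eta> \<omega>) \<partial>P) - (\<integral>\<omega>. lap h (\<eta> \<omega>) \<partial>P) * (\<integral>\<omega>. lap k (\<eta> \<omega>) \<partial>P)"
      by (subst cov_eq[OF lap_span_L2[OF lap_span.lap[OF h]] lap_span_L2[OF lap_span.lap[OF k]]])
        (auto intro!: arg_cong2[where f = "(-)"] Bochner_Integration.integral_cong lap_add_fun[OF hk eta_config, symmetric])
    moreover have "(\<integral>\<^sup>+z. ennreal (1 - exp_neg (h z + k z)) \<partial>L) \<le> (\<integral>\<^sup>+z. ennreal (1 - exp_neg (h z)) \<partial>L) + (\<integral>\<^sup>+z. ennreal (1 - exp_neg (k z)) \<partial>L)"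
      by (subst nn_integral_add[symmetric]) (auto intro!: nn_integral_mono one_minus_exp_neg_add_le)
    ultimately show ?thesis
      by (simp add: laplace exp_neg_add[symmetric] exp_neg_mono)
  qed
  show ?thesis
    unfolding cond_incr_inner_def using nn_integral_cond_incr_lap(1)[OF h k] cov
    by (subst integral_eq_nn_integral[OF _ AE]) simp_all
qed

lemma cond_incr_L2_lap:
  assumes h: "h \<in> lap_funs L"
  shows "cond_incr_L2 (lap h)"
proof -
  note [measurable] = L2D(1)[OF lap_span_L2[OF lap_span.lap[OF h]]]
  show ?thesis
    unfolding cond_incr_L2_def using nn_integral_cond_incr_lap(1)[OF h h]
    by (intro integrableI_bounded) (auto simp: power2_eq_square)
qed

lemma cond_incr_L2_cong:
  assumes "\<And>\<mu>. \<mu> \<in> int_valued_measures L \<Longrightarrow> f \<mu> = g \<mu>"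
  shows "cond_incr_L2 f \<longleftrightarrow> cond_incr_L2 g"
  unfolding cond_incr_L2_def
  by (intro Bochner_Integration.integrable_cong refl) (simp add: cond_incr_cong[OF assms])

lemma cond_incr_L2_span: "s \<in> lap_span L \<Longrightarrow> cond_incr_L2 s"
proof (induct rule: lap_span.induct)
  case (add f g)
  then show ?case by (intro cond_incr_L2_add lap_span_L2)
next
  case (cong f g)
  then show ?case using cond_incr_L2_cong[of f g] by simp
qed (auto intro: cond_incr_L2_lap cond_incr_L2_scale)

lemma cond_incr_inner_cong:
  assumes "\<And>\<mu>. \<mu> \<in> int_valued_measures L \<Longrightarrow> f \<mu> = g \<mu>"
  shows "cond_incr_inner f h = cond_incr_inner g h"
  unfolding cond_incr_inner_def
  by (intro Bochner_Integration.integral_cong refl) (simp add: cond_incr_cong[OF assms])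

lemma cov_cong:
  assumes "\<And>\<mu>. \<mu> \<in> int_valued_measures L \<Longrightarrow> f \<mu> = g \<mu>"
  shows "cov f h = cov g h"
proof -
  have "(\<integral>\<omega>. f (\<eta> \<omega>) \<partial>P) = (\<integral>\<omega>. g (\<eta> \<omega>) \<partial>P)"
    by (intro Bochner_Integration.integral_cong refl assms eta_config)
  then show ?thesis
    unfolding covariance_def by (intro Bochner_Integration.integral_cong refl) (simp add: assms eta_config)
qed

text \<open>Both forms are linear in the left argument. Their symmetry then allows a second use for
  the right argument in \<open>cond_incr_inner_span\<close>.\<close>

lemma cond_incr_inner_span_left:
  assumes t: "t \<in> lap_span L" and lap: "\<And>h. h \<in> lap_funs L \<Longrightarrow> cond_incr_inner (lap h) t = cov (lap h) t"
  shows "s \<in> lap_span L \<Longrightarrow> cond_incr_inner s t = cov s t"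
proof (induct rule: lap_span.induct)
  case (lap h)
  then show ?case by (rule assms(2))
next
  case (add f g)
  then show ?case
    using t by (simp add: cond_incr_inner_add cov_add lap_span_L2 cond_incr_L2_span)
next
  case (scale f c)
  then show ?case using t by (simp add: cond_incr_inner_scale cov_scale lap_span_L2)
next
  case (cong f g)
  then show ?case using cond_incr_inner_cong[of f g t] cov_cong[of f g t] by simp
qed

lemma cond_incr_inner_span:
  assumes "s \<in> lap_span L" "t \<in> lap_span L"
  shows "cond_incr_inner s t = cov s t"
proof (rule cond_incr_inner_span_left[OF assms(2) _ assms(1)])
  fix h assume h: "h \<in> lap_funs L"
  have "cond_incr_inner t (lap h) = cov t (lap h)"
    by (rule cond_incr_inner_span_left[OF lap_span.lap[OF h] _ assms(2)]) (rule cond_incr_inner_lap[OF _ h])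
  then show "cond_incr_inner (lap h) t = cov (lap h) t"
    by (simp add: cond_incr_inner_commute[of "lap h"] cov_commute[of "lap h"])
qed

lemma nn_integral_cond_incr_square_span_le:
  assumes s: "s \<in> lap_span L"
  shows "(\<integral>\<^sup>+x. ennreal ((cond_incr s x)\<^sup>2) \<partial>PL) \<le> ennreal (second_moment s)"
proof -
  have "(\<integral>\<^sup>+x. ennreal ((cond_incr s x)\<^sup>2) \<partial>PL) = ennreal (cond_incr_inner s s)"
    using cond_incr_L2_span[OF s] unfolding cond_incr_L2_def
    by (subst nn_integral_eq_integral) (auto simp: cond_incr_inner_def power2_eq_square)
  also have "\<dots> \<le> ennreal (second_moment s)"
    using cov_self_le[OF lap_span_L2[OF s]] by (simp add: cond_incr_inner_span[OF s s] ennreal_leI)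
  finally show ?thesis .
qed

lemma second_moment_add_le:
  assumes f: "f \<in> L2" and g: "g \<in> L2"
  shows "second_moment (\<lambda>\<mu>. f \<mu> + g \<mu>) \<le> 2 * second_moment f + 2 * second_moment g"
proof -
  have "second_moment (\<lambda>\<mu>. f \<mu> + g \<mu>) \<le> (\<integral>\<omega>. 2 * (f (\<eta> \<omega>))\<^sup>2 + 2 * (g (\<eta> \<omega>))\<^sup>2 \<partial>P)"
    unfolding second_moment_def
  proof (rule integral_mono)
    show "integrable P (\<lambda>\<omega>. (f (\<eta> \<omega>) + g (\<eta> \<omega>))\<^sup>2)" using L2D(2)[OF L2_add[OF f g]] .
    show "integrable P (\<lambda>\<omega>. 2 * (f (\<eta> \<omega>))\<^sup>2 + 2 * (g (\<eta> \<omega>))\<^sup>2)" using L2D(2)[OF f] L2D(2)[OF g] by simp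
    show "(f (\<eta> \<omega>) + g (\<eta> \<omega>))\<^sup>2 \<le> 2 * (f (\<eta> \<omega>))\<^sup>2 + 2 * (g (\<eta> \<omega>))\<^sup>2" for \<omega>
      using zero_le_power2[of "f (\<eta> \<omega>) - g (\<eta> \<omega>)"] by (simp add: power2_eq_square algebra_simps)
  qed
  also have "\<dots> = 2 * second_moment f + 2 * second_moment g"
    using L2D(2)[OF f] L2D(2)[OF g] by (simp add: second_moment_def)
  finally show ?thesis .
qed

text \<open>On a set of finite intensity, \<open>cond_incr\<close> is continuous from \<open>L\<^sup>2\<close> to \<open>L\<^sup>1\<close> by Mecke's
  formula. This identifies the limit of the approximations, and Fatou's lemma transfers their bound.\<close>

lemma nn_integral_cond_incr_square_local_le:
  assumes f: "f \<in> L2" and B[measurable]: "B \<in> sets L" and fin: "emeasure L B < \<infinity>"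
  shows "(\<integral>\<^sup>+x. ennreal ((cond_incr f x)\<^sup>2) * indicator B (snd x) \<partial>PL) \<le> ennreal (2 * second_moment f)"
proof -
  note [measurable] = L2D(1)[OF f]
  have "\<exists>s. s \<in> lap_span L \<and> second_moment (\<lambda>\<mu>. s \<mu> - f \<mu>) \<le> 1 / real (Suc n)" for n
  proof -
    obtain s where "s \<in> lap_span L" "second_moment (\<lambda>\<mu>. f \<mu> - s \<mu>) \<le> 1 / real (Suc n)"
      using lap_span_approx[OF f, of "1 / real (Suc n)"] by auto
    then show ?thesis by (intro exI[of _ s]) (simp add: second_moment_def power2_commute)
  qed
  then obtain s where s: "\<And>n. s n \<in> lap_span L" and second_moment: "\<And>n. second_moment (\<lambda>\<mu>. s n \<mu> - f \<mu>) \<le> 1 / real (Suc n)"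
    by metis
  note s_L2 = lap_span_L2[OF s]
  note d_L2 = L2_diff[OF s_L2 f]
  note [measurable] = L2D(1)[OF s_L2] L2D(1)[OF d_L2]
  define u where "u n x = cond_incr (\<lambda>\<mu>. s n \<mu> - f \<mu>) x * indicator B (snd x)" for n x
  have [measurable]: "u n \<in> borel_measurable PL" for n unfolding u_def by measurable
  \<comment> \<open>The second moment of the error is at most 1 / (n + 1), so its increments over
    \<open>B\<close> have an L^1 norm of order 1 / sqrt n.\<close>
  have u_le: "(\<integral>\<^sup>+x. ennreal (norm (u n x)) \<partial>PL) \<le> ennreal (sqrt (1 / real (Suc n) * count_weight B))" for n
  proof -
    have "(\<integral>\<^sup>+x. ennreal (norm (u n x)) \<partial>PL) = (\<integral>\<^sup>+x. ennreal \<bar>cond_incr (\<lambda>\<mu>. s n \<mu> - f \<mu>) x\<bar> * indicator B (snd x) \<partial>PL)"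
      by (intro nn_integral_cong) (auto simp: u_def indicator_def)
    also have "\<dots> \<le> ennreal (sqrt (second_moment (\<lambda>\<mu>. s n \<mu> - f \<mu>) * count_weight B))"
      by (rule nn_integral_cond_incr_le[OF d_L2 B fin])
    also have "\<dots> \<le> ennreal (sqrt (1 / real (Suc n) * count_weight B))"
      by (intro ennreal_leI real_sqrt_le_mono mult_right_mono second_moment) (simp add: count_weight_def)
    finally show ?thesis .
  qed
  have u_int: "integrable PL (u n)" for n
    using u_le[of n] by (intro integrableI_bounded) (auto intro: le_less_trans)
  have "(\<lambda>n. \<integral>x. norm (u n x) \<partial>PL) \<longlonglongrightarrow> 0"
  proof (rule tendsto_sandwich[OF always_eventually always_eventually tendsto_const])
    show "\<forall>n. 0 \<le> (\<integral>x. norm (u n x) \<partial>PL)" by simp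
    show "\<forall>n. (\<integral>x. norm (u n x) \<partial>PL) \<le> sqrt (1 / real (Suc n) * count_weight B)"
    proof
      fix n
      have "ennreal (\<integral>x. norm (u n x) \<partial>PL) \<le> ennreal (sqrt (1 / real (Suc n) * count_weight B))"
        using u_le[of n] u_int[of n] by (subst nn_integral_eq_integral[symmetric]) auto
      then show "(\<integral>x. norm (u n x) \<partial>PL) \<le> sqrt (1 / real (Suc n) * count_weight B)"
        by (subst (asm) ennreal_le_iff) (simp_all add: count_weight_def)
    qed
    have "(\<lambda>n. sqrt (1 / real (Suc n) * count_weight B)) \<longlonglongrightarrow> sqrt (0 * count_weight B)"
      by (intro tendsto_intros LIMSEQ_Suc[OF lim_1_over_n])
    then show "(\<lambda>n. sqrt (1 / real (Suc n) * count_weight B)) \<longlonglongrightarrow> 0" by simp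
  qed
  \<comment> \<open>Convergence in L^1 gives almost everywhere convergence along a subsequence,
    which is all that Fatou's lemma requires.\<close>
  from tendsto_L1_AE_subseq[OF u_int this] obtain r where r: "strict_mono r" "AE x in PL. (\<lambda>n. u (r n) x) \<longlonglongrightarrow> 0"
    by blast
  have AE: "AE x in PL. \<forall>n. u n x = (cond_incr (s n) x - cond_incr f x) * indicator B (snd x)"
    unfolding AE_all_countable u_def
  proof
    fix n
    show "AE x in PL. cond_incr (\<lambda>\<mu>. s n \<mu> - f \<mu>) x * indicator B (snd x) = (cond_incr (s n) x - cond_incr f x) * indicator B (snd x)"
      using cond_incr_diff[OF s_L2 f, of n] by eventually_elim simp
  qed
  have "(\<integral>\<^sup>+x. ennreal ((cond_incr f x)\<^sup>2) * indicator B (snd x) \<partial>PL) =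
     (\<integral>\<^sup>+x. liminf (\<lambda>n. ennreal ((cond_incr (s (r n)) x * indicator B (snd x))\<^sup>2)) \<partial>PL)"
  proof (rule nn_integral_cong_AE)
    show "AE x in PL. ennreal ((cond_incr f x)\<^sup>2) * indicator B (snd x) = liminf (\<lambda>n. ennreal ((cond_incr (s (r n)) x * indicator B (snd x))\<^sup>2))"
      using r(2) AE
    proof eventually_elim
      case (elim x)
      have "(\<lambda>n. (u (r n) x + cond_incr f x * indicator B (snd x))\<^sup>2) \<longlonglongrightarrow> (0 + cond_incr f x * indicator B (snd x))\<^sup>2"
        by (intro tendsto_intros elim(1))
      moreover have "u (r n) x + cond_incr f x * indicator B (snd x) = cond_incr (s (r n)) x * indicator B (snd x)" for n
        using elim(2) by (simp add: left_diff_distrib)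
      ultimately have "(\<lambda>n. ennreal ((cond_incr (s (r n)) x * indicator B (snd x))\<^sup>2)) \<longlonglongrightarrow> ennreal ((cond_incr f x * indicator B (snd x))\<^sup>2)"
        by (intro tendsto_ennrealI) simp
      then have "liminf (\<lambda>n. ennreal ((cond_incr (s (r n)) x * indicator B (snd x))\<^sup>2)) = ennreal ((cond_incr f x * indicator B (snd x))\<^sup>2)"
        by (intro lim_imp_Liminf) auto
      then show ?case by (simp add: indicator_def)
    qed
  qed
  also have "\<dots> \<le> liminf (\<lambda>n. \<integral>\<^sup>+x. ennreal ((cond_incr (s (r n)) x * indicator B (snd x))\<^sup>2) \<partial>PL)"
    by (rule nn_integral_liminf) measurable
  also have "\<dots> \<le> liminf (\<lambda>n. ennreal (2 * second_moment f + 2 * (1 / real (Suc (r n)))))"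
  proof (intro Liminf_mono always_eventually allI)
    fix n
    have "(\<integral>\<^sup>+x. ennreal ((cond_incr (s (r n)) x * indicator B (snd x))\<^sup>2) \<partial>PL) \<le> (\<integral>\<^sup>+x. ennreal ((cond_incr (s (r n)) x)\<^sup>2) \<partial>PL)"
      by (intro nn_integral_mono) (auto simp: indicator_def)
    also have "\<dots> \<le> ennreal (second_moment (s (r n)))" by (rule nn_integral_cond_incr_square_span_le[OF s])
    \<comment> \<open>Writing s = f + (s - f) costs the factor 2 in the final bound. The sharp
      constant is not sought here, since boundedness suffices for the extension.\<close>
    also have "second_moment (s (r n)) \<le> 2 * second_moment f + 2 * second_moment (\<lambda>\<mu>. s (r n) \<mu> - f \<mu>)"
      using second_moment_add_le[OF f d_L2, of "r n"] by simp
    also have "\<dots> \<le> 2 * second_moment f + 2 * (1 / real (Suc (r n)))"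
      by (intro add_left_mono mult_left_mono second_moment) simp
    finally show "(\<integral>\<^sup>+x. ennreal ((cond_incr (s (r n)) x * indicator B (snd x))\<^sup>2) \<partial>PL) \<le> ennreal (2 * second_moment f + 2 * (1 / real (Suc (r n))))"
      by (simp add: ennreal_leI)
  qed
  also have "\<dots> = ennreal (2 * second_moment f)"
  proof (rule lim_imp_Liminf)
    have "(\<lambda>n. 2 * second_moment f + 2 * (1 / real (Suc (r n)))) \<longlonglongrightarrow> 2 * second_moment f + 2 * 0"
      by (intro tendsto_intros LIMSEQ_subseq_LIMSEQ[OF LIMSEQ_Suc[OF lim_1_over_n] r(1), unfolded o_def])
    then show "(\<lambda>n. ennreal (2 * second_moment f + 2 * (1 / real (Suc (r n))))) \<longlonglongrightarrow> ennreal (2 * second_moment f)"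
      by (intro tendsto_ennrealI) simp
  qed simp
  finally show ?thesis .
qed

text \<open>The local bound does not depend on the set, so it survives monotone convergence along
  the exhaustion.\<close>

lemma nn_integral_cond_incr_square_le:
  assumes f: "f \<in> L2"
  shows "(\<integral>\<^sup>+x. ennreal ((cond_incr f x)\<^sup>2) \<partial>PL) \<le> ennreal (2 * second_moment f)"
proof -
  note [measurable] = L2D(1)[OF f]
  have "(\<integral>\<^sup>+x. ennreal ((cond_incr f x)\<^sup>2) \<partial>PL) = (\<integral>\<^sup>+x. (SUP i. ennreal ((cond_incr f x)\<^sup>2) * indicator (exhaust i) (snd x)) \<partial>PL)"
  proof (rule nn_integral_cong)
    fix x assume "x \<in> space PL"
    then have "snd x \<in> (\<Union>i. exhaust i)" unfolding exhaust(2) by (auto simp: space_pair_measure)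
    then obtain i where "snd x \<in> exhaust i" by blast
    then show "ennreal ((cond_incr f x)\<^sup>2) = (SUP i. ennreal ((cond_incr f x)\<^sup>2) * indicator (exhaust i) (snd x))"
      by (intro antisym SUP_least SUP_upper2[of i]) (auto simp: indicator_def)
  qed
  also have "\<dots> = (SUP i. \<integral>\<^sup>+x. ennreal ((cond_incr f x)\<^sup>2) * indicator (exhaust i) (snd x) \<partial>PL)"
  proof (rule nn_integral_monotone_convergence_SUP)
    show "incseq (\<lambda>i x. ennreal ((cond_incr f x)\<^sup>2) * indicator (exhaust i) (snd x))"
      using incseqD[OF exhaust(4)] by (intro monoI le_funI mult_left_mono) (auto simp: indicator_def)
  qed measurable
  also have "\<dots> \<le> ennreal (2 * second_moment f)"
    by (intro SUP_least nn_integral_cond_incr_square_local_le f exhaust)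
  finally show ?thesis .
qed

lemma L2_cond_incr_L2: "f \<in> L2 \<Longrightarrow> cond_incr_L2 f"
  unfolding cond_incr_L2_def using nn_integral_cond_incr_square_le[of f] measurable_cond_incr[OF L2D(1)[of f]]
  by (intro integrableI_bounded) (auto intro: le_less_trans)

text \<open>The constant is 10 = 2 * 4 + 2 * 1, from (a - b)^2 \<le> 2 a^2 + 2 b^2 with the squared
  bounds 4 for the inner product and 1 for the covariance. It expresses continuity of the difference
  of the two forms.\<close>

lemma cond_incr_inner_minus_cov_square_le:
  assumes f: "f \<in> L2" and g: "g \<in> L2"
  shows "(cond_incr_inner f g - cov f g)\<^sup>2 \<le> 10 * second_moment f * second_moment g"
proof -
  have le: "(\<integral>x. (cond_incr f x)\<^sup>2 \<partial>PL) \<le> 2 * second_moment f" if "f \<in> L2" for f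
    using nn_integral_cond_incr_square_le[OF that] L2_cond_incr_L2[OF that] unfolding cond_incr_L2_def
    by (subst (asm) nn_integral_eq_integral) auto
  have "(cond_incr_inner f g)\<^sup>2 \<le> (\<integral>x. (cond_incr f x)\<^sup>2 \<partial>PL) * (\<integral>x. (cond_incr g x)\<^sup>2 \<partial>PL)"
    unfolding cond_incr_inner_def using L2_cond_incr_L2[OF f] L2_cond_incr_L2[OF g] L2D(1)[OF f] L2D(1)[OF g]
    by (intro Cauchy_Schwarz_integral measurable_cond_incr) (auto simp: cond_incr_L2_def)
  also have "\<dots> \<le> (2 * second_moment f) * (2 * second_moment g)"
    by (intro mult_mono le f g) auto
  finally have cond_incr_inner: "(cond_incr_inner f g)\<^sup>2 \<le> 4 * (second_moment f * second_moment g)" by simp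
  have "(cond_incr_inner f g - cov f g)\<^sup>2 \<le> 2 * (cond_incr_inner f g)\<^sup>2 + 2 * (cov f g)\<^sup>2"
    using zero_le_power2[of "cond_incr_inner f g + cov f g"] by (simp add: power2_eq_square algebra_simps)
  also have "\<dots> \<le> 2 * (4 * (second_moment f * second_moment g)) + 2 * (second_moment f * second_moment g)"
    by (intro add_mono mult_left_mono cond_incr_inner cov_square_le f g) auto
  finally show ?thesis by simp
qed

text \<open>The difference of the two forms is bilinear and vanishes at (s, g), so at (f, g) it
  equals its value at (f - s, g), which is small when s is close to f.\<close>

lemma cond_incr_inner_eq_cov_of_span:
  assumes f: "f \<in> L2" and g: "g \<in> L2" and span: "\<And>s. s \<in> lap_span L \<Longrightarrow> cond_incr_inner s g = cov s g"
  shows "cond_incr_inner f g = cov f g"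
proof -
  have "(cond_incr_inner f g - cov f g)\<^sup>2 \<le> 0"
  proof (rule field_le_epsilon)
    fix e :: real assume e: "e > 0"
    \<comment> \<open>Chosen so that 10 * d * second_moment g \<le> e; the summand 1 covers a
      vanishing second moment of g.\<close>
    define d where "d = e / (1 + 10 * second_moment g)"
    have d: "d > 0" using e by (auto simp: d_def intro!: divide_pos_pos add_pos_nonneg)
    obtain s where s: "s \<in> lap_span L" "second_moment (\<lambda>\<mu>. f \<mu> - s \<mu>) \<le> d"
      using lap_span_approx[OF f d] by blast
    note sL2 = lap_span_L2[OF s(1)] and dL2 = L2_diff[OF f lap_span_L2[OF s(1)]]
    have "cond_incr_inner f g = cond_incr_inner (\<lambda>\<mu>. f \<mu> - s \<mu>) g + cond_incr_inner s g"
      using cond_incr_inner_add[OF dL2 _ sL2 _ g] L2_cond_incr_L2 dL2 sL2 g by simp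
    moreover have "cov f g = cov (\<lambda>\<mu>. f \<mu> - s \<mu>) g + cov s g"
      using cov_add[OF dL2 sL2 g] by simp
    ultimately have "(cond_incr_inner f g - cov f g)\<^sup>2 = (cond_incr_inner (\<lambda>\<mu>. f \<mu> - s \<mu>) g - cov (\<lambda>\<mu>. f \<mu> - s \<mu>) g)\<^sup>2"
      using span[OF s(1)] by simp
    also have "\<dots> \<le> 10 * second_moment (\<lambda>\<mu>. f \<mu> - s \<mu>) * second_moment g"
      by (rule cond_incr_inner_minus_cov_square_le[OF dL2 g])
    also have "\<dots> \<le> 10 * d * second_moment g"
      by (intro mult_right_mono mult_left_mono s) auto
    also have "\<dots> \<le> e"
    proof -
      have "d * (1 + 10 * second_moment g) = e"
        unfolding d_def using add_pos_nonneg[of 1 "10 * second_moment g"] by simp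
      then show ?thesis using d by (simp add: algebra_simps)
    qed
    finally show "(cond_incr_inner f g - cov f g)\<^sup>2 \<le> 0 + e" by simp
  qed
  then show ?thesis by simp
qed

text \<open>The density argument is used once for each argument: first against a fixed element of
  the span, then, after symmetry, against an arbitrary g.\<close>

lemma cond_incr_inner_eq_cov:
  assumes f: "f \<in> L2" and g: "g \<in> L2"
  shows "cond_incr_inner f g = cov f g"
proof (rule cond_incr_inner_eq_cov_of_span[OF f g])
  fix s assume s: "s \<in> lap_span L"
  have "cond_incr_inner g s = cov g s"
    by (rule cond_incr_inner_eq_cov_of_span[OF g lap_span_L2[OF s]]) (rule cond_incr_inner_span[OF _ s])
  then show "cond_incr_inner s g = cov s g" by (simp add: cond_incr_inner_commute[of s] cov_commute[of s])
qed

end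

theorem theorem1p5:
  fixes P :: "'w measure" and L :: "'a measure" and \<eta> :: "'w \<Rightarrow> 'a measure"
    and prec :: "'a \<Rightarrow> 'a \<Rightarrow> bool"
  assumes "sigma_finite_measure L"
    and "prob_space P"
    and "poisson_process P L \<eta>"
    and "transp_on (space L) prec"
    and "{(y, z) \<in> space L \<times> space L. prec y z} \<in> sets (L \<Otimes>\<^sub>M L)"
    and "\<forall>y\<in>space L. \<forall>z\<in>space L. \<not> (prec y z \<and> prec z y)"
    and "\<forall>y\<in>space L. emeasure L (space L - {z \<in> space L. prec z y \<or> prec y z}) = 0"
    and "(\<lambda>(\<mu>, y). past_measure L prec \<mu> y) \<in> measurable (config_space L \<Otimes>\<^sub>M L) (config_space L)"
  shows "(\<forall>f \<in> L2_functionals P L \<eta>.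
            (\<integral>\<^sup>+\<omega>. (\<integral>\<^sup>+y. ennreal ((cond_diff P L \<eta> prec f \<omega> y)\<^sup>2) \<partial>L) \<partial>P) < \<infinity>) \<and>
         (\<forall>f \<in> L2_functionals P L \<eta>. \<forall>g \<in> L2_functionals P L \<eta>.
            covariance P (\<lambda>\<omega>. f (\<eta> \<omega>)) (\<lambda>\<omega>. g (\<eta> \<omega>)) =
            (\<integral>\<omega>. (\<integral>y. cond_diff P L \<eta> prec f \<omega> y * cond_diff P L \<eta> prec g \<omega> y \<partial>L) \<partial>P))"
proof -
  interpret L: sigma_finite_measure L by fact
  interpret prob_space P by fact
  interpret poisson_order P L \<eta> prec
    by unfold_locales (use assms in auto)
  interpret PL: pair_sigma_finite P L ..
  have "(\<integral>\<^sup>+\<omega>. (\<integral>\<^sup>+y. ennreal ((cond_diff P L \<eta> prec f \<omega> y)\<^sup>2) \<partial>L) \<partial>P) < \<infinity>" if f: "f \<in> L2" for f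
  proof -
    note [measurable] = L2D(1)[OF f]
    have "(\<integral>\<^sup>+\<omega>. (\<integral>\<^sup>+y. ennreal ((cond_diff P L \<eta> prec f \<omega> y)\<^sup>2) \<partial>L) \<partial>P) = (\<integral>\<^sup>+\<omega>. (\<integral>\<^sup>+y. ennreal ((cond_incr f (\<omega>, y))\<^sup>2) \<partial>L) \<partial>P)"
      by (intro nn_integral_cong) (simp add: cond_diff_eq L2D(1)[OF f])
    also have "\<dots> = (\<integral>\<^sup>+x. ennreal ((cond_incr f x)\<^sup>2) \<partial>PL)"
      by (rule L.nn_integral_fst) measurable
    also have "\<dots> \<le> ennreal (2 * second_moment f)" by (rule nn_integral_cond_incr_square_le[OF f])
    finally show ?thesis by (auto intro: le_less_trans)
  qed
  moreover have "cov f g = (\<integral>\<omega>. (\<integral>y. cond_diff P L \<eta> prec f \<omega> y * cond_diff P L \<eta> prec g \<omega> y \<partial>L) \<partial>P)"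
    if f: "f \<in> L2" and g: "g \<in> L2" for f g
  proof -
    have "(\<integral>\<omega>. (\<integral>y. cond_diff P L \<eta> prec f \<omega> y * cond_diff P L \<eta> prec g \<omega> y \<partial>L) \<partial>P) =
        (\<integral>\<omega>. (\<integral>y. cond_incr f (\<omega>, y) * cond_incr g (\<omega>, y) \<partial>L) \<partial>P)"
      by (intro Bochner_Integration.integral_cong refl) (simp add: cond_diff_eq L2D(1)[OF f] L2D(1)[OF g])
    also have "\<dots> = cond_incr_inner f g"
      \<comment> \<open>The integrand is signed, so Fubini's theorem needs integrability on the
        product space; it holds because both conditional increments are square-integrable.\<close>
      unfolding cond_incr_inner_def by (rule PL.integral_fst') (intro integrable_cond_incr_mult f g L2_cond_incr_L2)
    finally show ?thesis using cond_incr_inner_eq_cov[OF f g] by simp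
  qed
  ultimately show ?thesis by blast
qed

end
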